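(* Let $C$ be a tropical curve in $\mathbb{R}^2$ and let $(G,p)$ be a reciprocal diagram of $C$. Then the following properties are equivalent. (1) $C$ is extremal. (2) $(G,p)$ is infinitesimally rigid.
   Context: Tropical varieties. Polyhedral complexes are finite and nonempty; their cells are convex polyhedra, possibly unbounded. Let $C \subset \mathbb{R}^d$ be a polyhedral complex of dimension $k$ (identified with its underlying set). $\widetilde{E}$ is the set of its $k$-dimensional cells (maximal faces) and $\widetilde{V}$ the set of its $(k-1)$-dimensional cells (ridges). $C$ is always assumed pure (every cell of dimension less than $k$ is a face of a $k$-dimensional cell) and rational: for each cell $\rho \in \widetilde{E}\cup\widetilde{V}$, with $L_\rho$ the linear space parallel to $\rho$, the lattice $L_\rho \cap \mathbb{Z}^d$ has rank $\dim \rho$. For $\tau \in \widetilde{V}$, $\sigma \in \widetilde{E}$ with $\tau \subset \sigma$, fix $z_\tau(\sigma) \in L_\sigma \cap \mathbb{Z}^d$ such that $L_\sigma \cap \mathbb{Z}^d = (L_\tau \cap \mathbb{Z}^d) + \mathbb{Z} z_\tau(\sigma)$ and $x + \lambda z_\tau(\sigma) \in \sigma$ for some $x \in \tau$, $\lambda > 0$ (it is unique modulo $L_\tau \cap \mathbb{Z}^d$). A weighting is a map $\omega: \widetilde{E} \to \mathbb{Z}_{>0}$; it is balanced if for every $\tau \in \widetilde{V}$, $\sum_{\sigma \supset \tau} \omega(\sigma) z_\tau(\sigma) \in L_\tau$ (sum over $\sigma \in \widetilde{E}$ having $\tau$ as a face). $C$ is a tropical variety of dimension $k$ if it has a balanced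 weighting. A tropical variety $C$ is extremal if it cannot be written as $C = C_1 \cup C_2$ with $C_1, C_2$ tropical varieties in $\mathbb{R}^d$ that are both proper subsets of $C$. Tropical curves. A tropical curve is a tropical variety of dimension $1$ in $\mathbb{R}^2$. Let $V$ be the (finite) set of closures of the connected components of $\mathbb{R}^2 \setminus C$; these are convex polyhedra. $C$ carries the polyhedral structure for which the maximal faces are exactly the $1$-dimensional intersections $v \cap w$ of distinct $v,w \in V$. The dual graph of $C$ is the finite simple graph $G=(V,E)$ with $vw \in E$ if and only if $v \cap w \in \widetilde{E}$. For $\sigma = v \cap w \in \widetilde{E}$, $x_\sigma(v,w) \in \mathbb{Z}^2$ is the shortest nonzero integer vector perpendicular to $L_\sigma$ oriented in the direction travelled when crossing $\sigma$ from $w$ to $v$. Frameworks. A framework in $\mathbb{R}^2$ is a pair $(G,p)$ with $G=(V,E)$ a finite simple graph and $p: V \to \mathbb{R}^2$. A framework $(G,p)$ on the dual graph $G$ of $C$ is a reciprocal diagram of $C$ if for every edge $vw\in E$, with $\sigma=v\cap w$, $p(v)-p(w)$ is a positive rational multiple of $x_\sigma(v,w)$. An infinitesimal flex of $(G,p)$ is a map $u: V \to \mathbb{R}^2$ with $(p(v)-p(w))\cdot(u(v)-u(w)) = 0$ for all $vw \in E$ (an element of the kernel of the rigidity matrix). It is trivial if there are a skew-symmetric $2\times 2$ real matrix $M$ and $a \in \mathbb{R}^2$ with $u(v) = Mp(v)+a$ for all $v \in V$. $(G,p)$ is infinitesimally rigid if every infinitesimal flex is trivial. *)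

theory Defs
  imports "HOL-Analysis.Analysis"
begin

section \<open>Tropical varieties\<close>

text \<open>Cells are nonempty, so the \<open>(k - 1)\<close>-dimensional cells of a \<open>0\<close>-dimensional complex
  form the empty set; \<open>face_of\<close> also admits the empty face, which is not counted as a cell.\<close>

definition polyhedral_complex :: "(real ^ 'd) set set \<Rightarrow> bool" where
  "polyhedral_complex X \<longleftrightarrow>
     finite X \<and> X \<noteq> {} \<and>
     (\<forall>\<rho>\<in>X. polyhedron \<rho> \<and> \<rho> \<noteq> {}) \<and>
     (\<forall>\<rho>\<in>X. \<forall>\<tau>. \<tau> face_of \<rho> \<and> \<tau> \<noteq> {} \<longrightarrow> \<tau> \<in> X) \<and>
     (\<forall>\<rho>\<in>X. \<forall>\<rho>'\<in>X. \<rho> \<inter> \<rho>' \<noteq> {} \<longrightarrow> (\<rho> \<inter> \<rho>') face_of \<rho> \<and> (\<rho> \<inter> \<rho>') face_of \<rho>')"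

definition complex_dim :: "(real ^ 'd) set set \<Rightarrow> int" where
  "complex_dim X = Max (aff_dim ` X)"

definition max_cells :: "(real ^ 'd) set set \<Rightarrow> (real ^ 'd) set set" where
  "max_cells X = {\<sigma>\<in>X. aff_dim \<sigma> = complex_dim X}"

definition ridges :: "(real ^ 'd) set set \<Rightarrow> (real ^ 'd) set set" where
  "ridges X = {\<tau>\<in>X. aff_dim \<tau> = complex_dim X - 1}"

definition pure_complex :: "(real ^ 'd) set set \<Rightarrow> bool" where
  "pure_complex X \<longleftrightarrow>
     (\<forall>\<rho>\<in>X. aff_dim \<rho> < complex_dim X \<longrightarrow> (\<exists>\<sigma>\<in>max_cells X. \<rho> face_of \<sigma>))"

definition direction_space :: "(real ^ 'd) set \<Rightarrow> (real ^ 'd) set" where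
  "direction_space \<rho> = span {x - y | x y. x \<in> \<rho> \<and> y \<in> \<rho>}"

definition integer_vectors :: "(real ^ 'd) set" where
  "integer_vectors = {x. \<forall>i. x $ i \<in> \<int>}"

definition cell_lattice :: "(real ^ 'd) set \<Rightarrow> (real ^ 'd) set" where
  "cell_lattice \<rho> = direction_space \<rho> \<inter> integer_vectors"

text \<open>The rank of a lattice (a discrete subgroup of \<open>\<real>\<^sup>d\<close>) is the dimension of its linear span,
  which is what \<open>dim\<close> computes for an arbitrary set of vectors.\<close>

definition rational_complex :: "(real ^ 'd) set set \<Rightarrow> bool" where
  "rational_complex X \<longleftrightarrow>
     (\<forall>\<rho> \<in> max_cells X \<union> ridges X. int (dim (cell_lattice \<rho>)) = aff_dim \<rho>)"

definition lattice_normal :: "(real ^ 'd) set \<Rightarrow> (real ^ 'd) set \<Rightarrow> real ^ 'd \<Rightarrow> bool" where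
  "lattice_normal \<tau> \<sigma> z \<longleftrightarrow>
     z \<in> cell_lattice \<sigma> \<and>
     cell_lattice \<sigma> = {y + of_int m *\<^sub>R z | y m. y \<in> cell_lattice \<tau>} \<and>
     (\<exists>x\<in>\<tau>. \<exists>c>0. x + c *\<^sub>R z \<in> \<sigma>)"

text \<open>The vector \<open>z \<tau> \<sigma>\<close> is unique modulo \<open>cell_lattice \<tau>\<close>, so
  the condition does not depend on the choice of \<open>z\<close>.\<close>

definition balanced_weighting :: "(real ^ 'd) set set \<Rightarrow> ((real ^ 'd) set \<Rightarrow> int) \<Rightarrow> bool" where
  "balanced_weighting X \<omega> \<longleftrightarrow>
     (\<forall>\<sigma>\<in>max_cells X. \<omega> \<sigma> > 0) \<and>
     (\<exists>z. (\<forall>\<tau>\<in>ridges X. \<forall>\<sigma>\<in>max_cells X. \<tau> \<subset> \<sigma> \<longrightarrow> lattice_normal \<tau> \<sigma> (z \<tau> \<sigma>)) \<and>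
          (\<forall>\<tau>\<in>ridges X.
             (\<Sum>\<sigma> | \<sigma> \<in> max_cells X \<and> \<tau> face_of \<sigma>. of_int (\<omega> \<sigma>) *\<^sub>R z \<tau> \<sigma>) \<in> direction_space \<tau>))"

text \<open>Tropical varieties are sets; the polyhedral structure is existentially quantified.\<close>

definition tropical_variety :: "nat \<Rightarrow> (real ^ 'd) set \<Rightarrow> bool" where
  "tropical_variety k C \<longleftrightarrow>
     (\<exists>X. polyhedral_complex X \<and> \<Union>X = C \<and> complex_dim X = int k \<and>
          pure_complex X \<and> rational_complex X \<and> (\<exists>\<omega>. balanced_weighting X \<omega>))"

definition extremal_tropical_variety :: "(real ^ 'd) set \<Rightarrow> bool" where
  "extremal_tropical_variety C \<longleftrightarrow>
     (\<exists>k. tropical_variety k C) \<and>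
     \<not> (\<exists>C1 C2. (\<exists>k. tropical_variety k C1) \<and> (\<exists>k. tropical_variety k C2) \<and>
                C1 \<subset> C \<and> C2 \<subset> C \<and> C = C1 \<union> C2)"


section \<open>Frameworks in the plane\<close>

text \<open>A simple graph is a pair of its vertex set and its set of edges \<open>{v, w}\<close> with \<open>v \<noteq> w\<close>.
  Only the values of \<open>p\<close> and \<open>u\<close> on the vertex set matter.\<close>

type_synonym 'v graph = "'v set \<times> 'v set set"

definition infinitesimal_flex :: "'v graph \<Rightarrow> ('v \<Rightarrow> real ^ 2) \<Rightarrow> ('v \<Rightarrow> real ^ 2) \<Rightarrow> bool" where
  "infinitesimal_flex G p u \<longleftrightarrow>
     (\<forall>v\<in>fst G. \<forall>w\<in>fst G. {v, w} \<in> snd G \<longrightarrow> (p v - p w) \<bullet> (u v - u w) = 0)"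

definition trivial_flex :: "'v graph \<Rightarrow> ('v \<Rightarrow> real ^ 2) \<Rightarrow> ('v \<Rightarrow> real ^ 2) \<Rightarrow> bool" where
  "trivial_flex G p u \<longleftrightarrow>
     (\<exists>(M :: real ^ 2 ^ 2) a. transpose M = - M \<and> (\<forall>v\<in>fst G. u v = M *v p v + a))"

definition infinitesimally_rigid :: "'v graph \<Rightarrow> ('v \<Rightarrow> real ^ 2) \<Rightarrow> bool" where
  "infinitesimally_rigid G p \<longleftrightarrow> (\<forall>u. infinitesimal_flex G p u \<longrightarrow> trivial_flex G p u)"


section \<open>Tropical curves and reciprocal diagrams\<close>

definition tropical_curve :: "(real ^ 2) set \<Rightarrow> bool" where
  "tropical_curve C \<longleftrightarrow> tropical_variety 1 C"

definition curve_regions :: "(real ^ 2) set \<Rightarrow> (real ^ 2) set set" where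
  "curve_regions C = closure ` components (- C)"

definition curve_edges :: "(real ^ 2) set \<Rightarrow> (real ^ 2) set set" where
  "curve_edges C = {v \<inter> w | v w. v \<in> curve_regions C \<and> w \<in> curve_regions C \<and> v \<noteq> w \<and>
                                  aff_dim (v \<inter> w) = 1}"

definition dual_graph :: "(real ^ 2) set \<Rightarrow> (real ^ 2) set graph" where
  "dual_graph C =
     (curve_regions C,
      {{v, w} | v w. v \<in> curve_regions C \<and> w \<in> curve_regions C \<and> v \<noteq> w \<and>
                     v \<inter> w \<in> curve_edges C})"

definition normal_integer_vector :: "(real ^ 2) set \<Rightarrow> real ^ 2 \<Rightarrow> bool" where
  "normal_integer_vector \<sigma> x \<longleftrightarrow>
     x \<in> integer_vectors \<and> x \<noteq> 0 \<and> (\<forall>y\<in>direction_space \<sigma>. x \<bullet> y = 0)"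

text \<open>The last conjunct says that travelling in direction \<open>x\<close> through a relatively interior point
  of \<open>v \<inter> w\<close> leads from \<open>w\<close> to \<open>v\<close>; it selects one of the two
  shortest normal integer vectors.\<close>

definition crossing_vector :: "(real ^ 2) set \<Rightarrow> (real ^ 2) set \<Rightarrow> real ^ 2 \<Rightarrow> bool" where
  "crossing_vector v w x \<longleftrightarrow>
     normal_integer_vector (v \<inter> w) x \<and>
     (\<forall>y. normal_integer_vector (v \<inter> w) y \<longrightarrow> norm x \<le> norm y) \<and>
     (\<exists>q\<in>rel_interior (v \<inter> w). \<exists>e>0. \<forall>t. 0 < t \<and> t < e \<longrightarrow>
        q + t *\<^sub>R x \<in> v \<and> q - t *\<^sub>R x \<in> w)"

definition reciprocal_diagram :: "(real ^ 2) set \<Rightarrow> ((real ^ 2) set \<Rightarrow> real ^ 2) \<Rightarrow> bool" where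
  "reciprocal_diagram C p \<longleftrightarrow>
     (\<forall>v\<in>fst (dual_graph C). \<forall>w\<in>fst (dual_graph C). {v, w} \<in> snd (dual_graph C) \<longrightarrow>
        (\<exists>x c. crossing_vector v w x \<and> c \<in> \<rat> \<and> c > 0 \<and> p v - p w = c *\<^sub>R x))"

end

theory Submission
  imports Defs
begin

text \<open>Rotating an infinitesimal flex by a right angle turns it into a parallel redrawing of the
  reciprocal diagram, that is, a function on the regions whose difference across each edge is
  normal to the edge. Seen as a locally constant function off the curve, such a redrawing has jumps
  \<open>s \<sigma> *\<^sub>R rot (d \<sigma>)\<close> across the cells \<open>\<sigma>\<close>, and \<open>s\<close> is exactly a real balanced weighting of the
  curve: in one direction because the jumps around a vertex cancel, in the other because the sum of
  the jumps of the cells met by the ray from \<open>x\<close> in a fixed generic direction is locally constant off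
  the curve if \<open>s\<close> is balanced. For positive \<open>s\<close> the resulting function is strictly monotone along
  generic segments, which makes the regions convex. Trivial flexes correspond to the multiples of
  the given weighting, so rigidity says that all real balanced weightings are proportional.
  A proper subcurve has a non-proportional weighting; conversely simultaneous Diophantine
  approximation turns a non-proportional real weighting into an integral one \<open>m\<close>, and combinations
  of \<open>m\<close> and \<open>\<omega>\<close> that vanish where \<open>m / \<omega>\<close> is maximal or minimal split the curve.\<close>

section \<open>Planar curves\<close>

text \<open>The difficulty is that three descriptions of the curve have to be matched. Balancing
  lives on an arbitrary complex \<open>X\<close>, which may subdivide an edge of the dual graph into
  several cells; the dual graph is defined by the topology of the complement alone; and a subcurve
  carries a complex unrelated to \<open>X\<close>. All comparisons are therefore local, at points of
  a cell that are vertices of no complex involved: there the curve is a straight line with one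
  region on each side. Convexity of the regions guarantees such points on every dual edge, since an
  intersection of affine dimension 1 of nonconvex sets could consist of two isolated points.
  Potentials are built by a ray sum because summing jumps along paths would require path
  independence first; moreover the ray sum exists for arbitrary jumps, and it turns a failure of
  balance at a vertex into a visible jump across a ray. This is what proves the converse, that a
  potential forces balance, without going around the vertex cell by cell.\<close>

definition rot :: "real ^ 2 \<Rightarrow> real ^ 2" where
  "rot x = vector [- x $ 2, x $ 1]"

lemma rot_components [simp]: "rot x $ 1 = - x $ 2" "rot x $ 2 = x $ 1"
  by (simp_all add: rot_def)

lemma inner_real_2: "(x :: real ^ 2) \<bullet> y = x $ 1 * y $ 1 + x $ 2 * y $ 2"
  by (simp add: inner_vec_def sum_2)

lemma rot_inner_rot [simp]: "rot x \<bullet> rot y = x \<bullet> y"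
  by (simp add: inner_real_2)

lemma rot_inner_self [simp]: "rot x \<bullet> x = 0" "x \<bullet> rot x = 0"
  by (simp_all add: inner_real_2)

lemma rot_rot [simp]: "rot (rot x) = - x"
  by (simp add: vec_eq_iff forall_2)

lemma rot_eq_0_iff [simp]: "rot x = 0 \<longleftrightarrow> x = 0"
  by (auto simp: vec_eq_iff forall_2)

lemma linear_rot: "linear rot"
  by (rule linearI) (simp_all add: vec_eq_iff forall_2)

lemmas rot_linear_simps =
  linear_add[OF linear_rot] linear_diff[OF linear_rot] linear_cmul[OF linear_rot]
  linear_0[OF linear_rot] linear_neg[OF linear_rot]

lemma perp_imp_multiple_rot:
  assumes "d \<noteq> 0" and "x \<bullet> d = 0"
  shows "\<exists>k. x = k *\<^sub>R rot d"
proof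
  have n: "d \<bullet> d \<noteq> 0" using assms(1) by simp
  show "x = ((x \<bullet> rot d) / (d \<bullet> d)) *\<^sub>R rot d"
    using n assms(2) unfolding vec_eq_iff forall_2 inner_real_2
    apply (simp add: field_simps)
    apply (intro conjI; algebra)
    done
qed

lemma perp_rot_imp_multiple:
  assumes "d \<noteq> 0" and "rot d \<bullet> x = 0"
  shows "\<exists>k. x = k *\<^sub>R d"
proof -
  have "x \<bullet> rot d = 0" using assms by (simp add: inner_commute)
  then obtain k where "x = k *\<^sub>R rot (rot d)"
    using perp_imp_multiple_rot[of "rot d" x] assms by auto
  then show ?thesis by (intro exI[of _ "- k"]) simp
qed

text \<open>Hyperplanes are negligible and a nonempty open set is not. This provides the functional
  \<open>e\<close> and the generic endpoints of test segments.\<close>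

lemma avoid_hyperplanes:
  fixes n :: "'i \<Rightarrow> 'a :: euclidean_space"
  assumes "open U" "U \<noteq> {}" "finite I" "\<And>i. i \<in> I \<Longrightarrow> n i \<noteq> 0"
  shows "\<exists>x\<in>U. \<forall>i\<in>I. n i \<bullet> x \<noteq> c i"
proof (rule ccontr)
  assume "\<not> ?thesis"
  then have "U \<subseteq> (\<Union>i\<in>I. {x. n i \<bullet> x = c i})" by auto
  moreover have "negligible (\<Union>i\<in>I. {x. n i \<bullet> x = c i})"
    using assms by (intro negligible_Union) (auto intro: negligible_hyperplane)
  ultimately show False
    using open_not_negligible[OF assms(1,2)] negligible_subset by blast
qed

text \<open>The functional \<open>x \<mapsto> e \<bullet> x\<close> is a coordinate in which no cell is vertical, with \<open>rot e\<close> as the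
  upward direction; \<open>d \<sigma>\<close> points to the right and \<open>rot (d \<sigma>)\<close> upwards.\<close>

locale planar_curve =
  fixes S :: "(real ^ 2) set set" and P :: "(real ^ 2) set"
    and d b :: "(real ^ 2) set \<Rightarrow> real ^ 2" and e :: "real ^ 2"
  assumes finite_S: "finite S" and finite_P: "finite P"
    and closed_cell: "\<sigma> \<in> S \<Longrightarrow> closed \<sigma>"
    and convex_cell: "\<sigma> \<in> S \<Longrightarrow> convex \<sigma>"
    and base_in: "\<sigma> \<in> S \<Longrightarrow> b \<sigma> \<in> \<sigma>"
    and cell_line: "\<sigma> \<in> S \<Longrightarrow> \<sigma> \<subseteq> range (\<lambda>t. b \<sigma> + t *\<^sub>R d \<sigma>)"
    and e_pos: "\<sigma> \<in> S \<Longrightarrow> 0 < e \<bullet> d \<sigma>"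
    and nontrivial_cell: "\<sigma> \<in> S \<Longrightarrow> \<exists>x\<in>\<sigma>. x \<noteq> b \<sigma>"
    and vertex_iff: "\<sigma> \<in> S \<Longrightarrow> y \<in> \<sigma> \<Longrightarrow> y \<in> P \<longleftrightarrow> y extreme_point_of \<sigma>"
    and cells_meet: "\<sigma> \<in> S \<Longrightarrow> \<sigma>' \<in> S \<Longrightarrow> \<sigma> \<noteq> \<sigma>' \<Longrightarrow> \<sigma> \<inter> \<sigma>' \<subseteq> P"
    and vertices_in: "P \<subseteq> \<Union>S"
begin

definition ht :: "(real ^ 2) set \<Rightarrow> real ^ 2 \<Rightarrow> real" where
  "ht \<sigma> x = rot (d \<sigma>) \<bullet> (x - b \<sigma>)"

text \<open>The projection of a cell is taken without its right endpoint, so that cells joined end to end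
  cover each abscissa once.\<close>

definition cover :: "(real ^ 2) set \<Rightarrow> real \<Rightarrow> bool" where
  "cover \<sigma> a \<longleftrightarrow> (\<exists>u\<in>\<sigma>. e \<bullet> u \<le> a) \<and> (\<exists>u\<in>\<sigma>. a < e \<bullet> u)"

text \<open>The orientation of \<open>d \<sigma>\<close> is fixed per cell, whereas balancing at a
  vertex \<open>y\<close> uses vectors pointing from \<open>y\<close> into the cell; this sign
  translates between the two. It has that meaning at endpoints of the cell only.\<close>

definition side :: "(real ^ 2) set \<Rightarrow> real ^ 2 \<Rightarrow> real" where
  "side \<sigma> y = (if \<exists>u\<in>\<sigma>. e \<bullet> y < e \<bullet> u then 1 else - 1)"

definition imbalance :: "((real ^ 2) set \<Rightarrow> real ^ 2) \<Rightarrow> real ^ 2 \<Rightarrow> real ^ 2" where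
  "imbalance j y = (\<Sum>\<sigma> | \<sigma> \<in> S \<and> y \<in> \<sigma>. side \<sigma> y *\<^sub>R j \<sigma>)"

text \<open>\<open>j \<sigma>\<close> is the jump of \<open>F\<close> in crossing
  \<open>\<sigma>\<close> upwards. A point outside \<open>P\<close> lies in at most one cell, so the
  sum has at most one term. Points of \<open>P\<close> may be left out because finitely many points
  do not disconnect the plane.\<close>

definition potential :: "(real ^ 2 \<Rightarrow> real ^ 2) \<Rightarrow> ((real ^ 2) set \<Rightarrow> real ^ 2) \<Rightarrow> bool" where
  "potential F j \<longleftrightarrow> (\<forall>x0. x0 \<notin> P \<longrightarrow> (\<exists>c. \<forall>\<^sub>F x in nhds x0. x \<notin> \<Union>S \<longrightarrow>
     F x = c + (\<Sum>\<sigma> | \<sigma> \<in> S \<and> x0 \<in> \<sigma>. if 0 < ht \<sigma> x then j \<sigma> else 0)))"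

section \<open>Coordinates along and above a cell\<close>

lemma d_nonzero: "\<sigma> \<in> S \<Longrightarrow> d \<sigma> \<noteq> 0"
  using e_pos by fastforce

lemma ht_on: "\<sigma> \<in> S \<Longrightarrow> x \<in> \<sigma> \<Longrightarrow> ht \<sigma> x = 0"
  using cell_line by (fastforce simp: ht_def)

lemma ht_eq_0_imp:
  assumes "\<sigma> \<in> S" "ht \<sigma> x = 0"
  shows "x = b \<sigma> + ((e \<bullet> x - e \<bullet> b \<sigma>) / (e \<bullet> d \<sigma>)) *\<^sub>R d \<sigma>"
proof -
  obtain k where k: "x - b \<sigma> = k *\<^sub>R d \<sigma>"
    using perp_rot_imp_multiple[OF d_nonzero[OF assms(1)]] assms(2) unfolding ht_def by metis
  then have x: "x = b \<sigma> + k *\<^sub>R d \<sigma>" by (simp add: algebra_simps)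
  then show ?thesis using e_pos[OF assms(1)] by (simp add: inner_add_right)
qed

lemma line_inj:
  assumes "\<sigma> \<in> S" "ht \<sigma> x = 0" "ht \<sigma> y = 0" "e \<bullet> x = e \<bullet> y"
  shows "x = y"
  using ht_eq_0_imp assms by metis

lemma ht_param [simp]: "ht \<sigma> (b \<sigma> + t *\<^sub>R d \<sigma>) = 0"
  by (simp add: ht_def)

lemma ht_diff: "ht \<sigma> x - ht \<sigma> y = rot (d \<sigma>) \<bullet> (x - y)"
  by (simp add: ht_def inner_diff_right)

lemma ht_up: "ht \<sigma> (y + t *\<^sub>R rot e) = ht \<sigma> y + t * (e \<bullet> d \<sigma>)"
  by (simp add: ht_def inner_add_right inner_diff_right inner_commute)

lemma tendsto_ht [tendsto_intros]: "(f \<longlongrightarrow> l) F \<Longrightarrow> ((\<lambda>x. ht \<sigma> (f x)) \<longlongrightarrow> ht \<sigma> l) F"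
  unfolding ht_def by (intro tendsto_intros)

lemma between_open_segment:
  assumes "\<sigma> \<in> S" "ht \<sigma> x = 0" "u \<in> \<sigma>" "v \<in> \<sigma>" "e \<bullet> u < e \<bullet> x" "e \<bullet> x < e \<bullet> v"
  shows "x \<in> open_segment u v"
proof -
  define k where "k = (e \<bullet> x - e \<bullet> u) / (e \<bullet> v - e \<bullet> u)"
  have k: "0 < k" "k < 1" using assms by (auto simp: k_def)
  define y where "y = (1 - k) *\<^sub>R u + k *\<^sub>R v"
  have "ht \<sigma> y = (1 - k) * ht \<sigma> u + k * ht \<sigma> v"
    by (simp add: y_def ht_def inner_add_right inner_diff_right algebra_simps)
  then have 1: "ht \<sigma> y = 0" using ht_on assms by simp
  have "e \<bullet> y = e \<bullet> u + k * (e \<bullet> v - e \<bullet> u)"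
    by (simp add: y_def inner_add_right algebra_simps)
  also have "\<dots> = e \<bullet> x" using assms by (simp add: k_def)
  finally have "x = y" using line_inj[OF assms(1,2) 1] by simp
  then show ?thesis using k assms(5,6) by (auto simp: in_segment y_def)
qed

lemma between_in_cell:
  assumes "\<sigma> \<in> S" "ht \<sigma> x = 0" "u \<in> \<sigma>" "v \<in> \<sigma>" "e \<bullet> u \<le> e \<bullet> x" "e \<bullet> x \<le> e \<bullet> v"
  shows "x \<in> \<sigma>"
proof (cases "e \<bullet> u = e \<bullet> x \<or> e \<bullet> x = e \<bullet> v")
  case True
  then have "x = u \<or> x = v" using line_inj ht_on assms by metis
  then show ?thesis using assms by auto
next
  case False
  then have "x \<in> open_segment u v" using between_open_segment assms by force
  then show ?thesis
    using assms convex_cell[OF assms(1)] by (meson convex_contains_open_segment subsetD)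
qed

lemma inner_cell_neighbours:
  assumes "\<sigma> \<in> S" "x \<in> \<sigma>" "x \<notin> P"
  shows "\<exists>u\<in>\<sigma>. \<exists>v\<in>\<sigma>. e \<bullet> u < e \<bullet> x \<and> e \<bullet> x < e \<bullet> v"
proof -
  obtain u v where uv: "u \<in> \<sigma>" "v \<in> \<sigma>" "x \<in> open_segment u v"
    using assms vertex_iff unfolding extreme_point_of_def by blast
  then obtain k where k: "0 < k" "k < 1" "x = (1 - k) *\<^sub>R u + k *\<^sub>R v" "u \<noteq> v"
    by (auto simp: in_segment)
  have ne: "e \<bullet> u \<noteq> e \<bullet> v" using line_inj[OF assms(1)] ht_on assms uv k by metis
  have 1: "e \<bullet> x - e \<bullet> u = k * (e \<bullet> v - e \<bullet> u)"
    and 2: "e \<bullet> v - e \<bullet> x = (1 - k) * (e \<bullet> v - e \<bullet> u)"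
    by (auto simp: k inner_add_right algebra_simps)
  show ?thesis
  proof (cases "e \<bullet> u < e \<bullet> v")
    case True
    then have "e \<bullet> x - e \<bullet> u > 0" "e \<bullet> v - e \<bullet> x > 0" unfolding 1 2 using k by auto
    then show ?thesis using uv by auto
  next
    case False
    then have "e \<bullet> x - e \<bullet> u < 0" "e \<bullet> v - e \<bullet> x < 0"
      unfolding 1 2 using k ne by (auto simp: mult_pos_neg)
    then show ?thesis using uv by (intro bexI[of _ v] bexI[of _ u]) auto
  qed
qed

lemma vertex_extremal:
  assumes "\<sigma> \<in> S" "y \<in> \<sigma>" "y \<in> P" "u \<in> \<sigma>" "v \<in> \<sigma>" "e \<bullet> u < e \<bullet> y" "e \<bullet> y < e \<bullet> v"
  shows False
  using between_open_segment[OF assms(1) ht_on[OF assms(1,2)] assms(4-7)] assms vertex_iff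
  unfolding extreme_point_of_def by blast

lemma cover_imp_in_cell:
  assumes "\<sigma> \<in> S" "ht \<sigma> x = 0" "cover \<sigma> (e \<bullet> x)"
  shows "x \<in> \<sigma>"
  using assms between_in_cell unfolding cover_def by (meson less_imp_le)

lemma tendsto_e: "((\<lambda>x. e \<bullet> x) \<longlongrightarrow> e \<bullet> x0) (nhds x0)"
  by (intro tendsto_intros) (simp add: tendsto_ident_at filterlim_ident)

lemma cover_inside:
  assumes "\<sigma> \<in> S" "x \<in> \<sigma>" "x \<notin> P"
  shows "\<forall>\<^sub>F a in nhds (e \<bullet> x). cover \<sigma> a"
proof -
  obtain u v where uv: "u \<in> \<sigma>" "v \<in> \<sigma>" "e \<bullet> u < e \<bullet> x" "e \<bullet> x < e \<bullet> v"
    using inner_cell_neighbours[OF assms] by auto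
  have "\<forall>\<^sub>F a in nhds (e \<bullet> x). a \<in> {e \<bullet> u <..< e \<bullet> v}"
    by (rule eventually_nhds_in_open) (use uv in auto)
  then show ?thesis
    by eventually_elim (use uv in \<open>auto simp: cover_def intro: less_imp_le\<close>)
qed

lemma cover_outside:
  assumes "\<sigma> \<in> S" "\<And>x. x \<in> \<sigma> \<Longrightarrow> e \<bullet> x \<noteq> a0"
  shows "\<forall>\<^sub>F a in nhds a0. \<not> cover \<sigma> a"
proof -
  \<comment> \<open>\<open>f a\<close> is the point with abscissa \<open>a\<close> on the line
    carrying the cell. Closedness of the cell thus becomes an open condition on \<open>a\<close>,
    also for unbounded cells.\<close>
  define f where "f a = b \<sigma> + ((a - e \<bullet> b \<sigma>) / (e \<bullet> d \<sigma>)) *\<^sub>R d \<sigma>" for a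
  have ef: "e \<bullet> f a = a" for a
    using e_pos[OF assms(1)] by (simp add: f_def inner_add_right)
  have hf: "ht \<sigma> (f a) = 0" for a by (simp add: f_def)
  have "continuous_on UNIV f" unfolding f_def by (intro continuous_intros) (use e_pos[OF assms(1)] in auto)
  moreover have "open (- \<sigma>)" using closed_cell[OF assms(1)] by auto
  ultimately have "open (f -` (- \<sigma>))" by (simp add: continuous_on_open_vimage)
  moreover have "a0 \<in> f -` (- \<sigma>)" using assms(2) ef by auto
  ultimately have "\<forall>\<^sub>F a in nhds a0. a \<in> f -` (- \<sigma>)" by (rule eventually_nhds_in_open)
  then show ?thesis
    by eventually_elim (use cover_imp_in_cell[OF assms(1) hf] ef in auto)
qed

lemma cover_end:
  assumes "\<sigma> \<in> S" "y \<in> \<sigma>" "y \<in> P"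
  shows "\<forall>\<^sub>F a in nhds (e \<bullet> y). cover \<sigma> a = (if side \<sigma> y = 1 then e \<bullet> y \<le> a else a < e \<bullet> y)"
proof (cases "\<exists>u\<in>\<sigma>. e \<bullet> y < e \<bullet> u")
  case True
  then obtain u where u: "u \<in> \<sigma>" "e \<bullet> y < e \<bullet> u" by auto
  have low: "e \<bullet> y \<le> e \<bullet> v" if "v \<in> \<sigma>" for v
    using vertex_extremal[OF assms that u(1) _ u(2)] by force
  have "\<forall>\<^sub>F a in nhds (e \<bullet> y). a \<in> {..< e \<bullet> u}"
    by (rule eventually_nhds_in_open) (use u in auto)
  then show ?thesis
    by eventually_elim (use True low u assms in \<open>force simp: cover_def side_def\<close>)
next
  case False
  obtain z where z: "z \<in> \<sigma>" "z \<noteq> y"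
    using nontrivial_cell[OF assms(1)] base_in[OF assms(1)] by metis
  have "e \<bullet> z \<noteq> e \<bullet> y" using line_inj[OF assms(1)] ht_on assms z by metis
  then have zy: "e \<bullet> z < e \<bullet> y" using False z by force
  have "\<forall>\<^sub>F a in nhds (e \<bullet> y). a \<in> {e \<bullet> z <..}"
    by (rule eventually_nhds_in_open) (use zy in auto)
  then show ?thesis
    by eventually_elim (use False zy z assms in \<open>force simp: cover_def side_def\<close>)
qed

end


section \<open>Potentials of balanced jumps\<close>

text \<open>The local constants form a function that is defined on \<open>C\<close> as well. As
  \<open>C\<close> has empty interior, overlapping neighbourhoods share a point off
  \<open>C\<close>, so this function is locally constant on the connected set
  \<open>U\<close>.\<close>

lemma locally_constant_extension:
  fixes G :: "'a :: real_normed_vector \<Rightarrow> 'b"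
  assumes U: "open U" "connected U" and C: "interior C = {}"
    and loc: "\<And>x0. x0 \<in> U \<Longrightarrow> \<exists>c. \<forall>\<^sub>F x in nhds x0. x \<notin> C \<longrightarrow> G x = c"
  shows "\<exists>c. \<forall>x\<in>U - C. G x = c"
proof -
  obtain c where c: "\<And>x0. x0 \<in> U \<Longrightarrow> \<forall>\<^sub>F x in nhds x0. x \<notin> C \<longrightarrow> G x = c x0"
    using loc by metis
  have cG: "c x = G x" if "x \<in> U" "x \<notin> C" for x
    using eventually_nhds_x_imp_x[OF c[OF that(1)]] that by simp
  have "\<forall>a\<in>U. \<forall>\<^sub>F x in at a within U. c a = c x"
  proof
    fix a assume a: "a \<in> U"
    obtain V where V: "open V" "a \<in> V" "\<And>x. x \<in> V \<Longrightarrow> x \<notin> C \<longrightarrow> G x = c a"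
      using c[OF a] unfolding eventually_nhds by blast
    have "c a = c x" if x: "x \<in> V" "x \<in> U" for x
    proof -
      obtain W where W: "open W" "x \<in> W" "\<And>z. z \<in> W \<Longrightarrow> z \<notin> C \<longrightarrow> G z = c x"
        using c[OF x(2)] unfolding eventually_nhds by blast
      have "open (V \<inter> W)" "x \<in> V \<inter> W" using V W x by auto
      then have "\<not> V \<inter> W \<subseteq> C" using C interior_maximal[of "V \<inter> W" C] by auto
      then obtain z where "z \<in> V" "z \<in> W" "z \<notin> C" by auto
      then show ?thesis using V(3) W(3) by metis
    qed
    then show "\<forall>\<^sub>F x in at a within U. c a = c x"
      unfolding eventually_at_topological using V by blast
  qed
  then have "c x = c y" if "x \<in> U" "y \<in> U" for x y
    using connected_local_const[OF U(2) that] by blast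
  then show ?thesis using cG by (metis Diff_iff)
qed

context planar_curve
begin

section \<open>Half strips above the cells\<close>

definition under :: "real ^ 2 \<Rightarrow> real ^ 2 \<Rightarrow> bool" where
  "under y x \<longleftrightarrow> (\<exists>t>0. x = y + t *\<^sub>R rot e)"

lemma under_ht: "\<sigma> \<in> S \<Longrightarrow> y \<in> \<sigma> \<Longrightarrow> under y x \<Longrightarrow> 0 < ht \<sigma> x"
  using e_pos by (auto simp: under_def ht_up ht_on)

lemma under_e: "under y x \<Longrightarrow> e \<bullet> y = e \<bullet> x"
  by (auto simp: under_def inner_add_right)

lemma under_if:
  assumes "\<sigma> \<in> S" "y \<in> \<sigma>" "0 < ht \<sigma> x" "e \<bullet> y = e \<bullet> x"
  shows "under y x"
proof -
  have "e \<noteq> 0" using e_pos[OF assms(1)] by auto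
  moreover have "(x - y) \<bullet> e = 0" using assms(4) by (simp add: inner_commute inner_diff_right)
  ultimately obtain t where t: "x - y = t *\<^sub>R rot e" using perp_imp_multiple_rot by metis
  then have x: "x = y + t *\<^sub>R rot e" by (simp add: algebra_simps)
  then have "0 < t * (e \<bullet> d \<sigma>)" using assms(3) ht_on[OF assms(1,2)] by (simp add: ht_up)
  then have "t > 0" using e_pos[OF assms(1)] by (simp add: zero_less_mult_iff)
  then show ?thesis using x under_def by auto
qed

lemma eventually_ht_pos: "0 < ht \<sigma> x0 \<Longrightarrow> \<forall>\<^sub>F x in nhds x0. 0 < ht \<sigma> x"
  by (rule order_tendstoD(1)[OF tendsto_ht]) (simp_all add: filterlim_ident)

lemma eventually_ht_neg: "ht \<sigma> x0 < 0 \<Longrightarrow> \<forall>\<^sub>F x in nhds x0. ht \<sigma> x < 0"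
  by (rule order_tendstoD(2)[OF tendsto_ht]) (simp_all add: filterlim_ident)

lemma eventually_e: "\<forall>\<^sub>F a in nhds (e \<bullet> x0). Q a \<Longrightarrow> \<forall>\<^sub>F x in nhds x0. Q (e \<bullet> x)"
  using tendsto_e unfolding filterlim_iff by blast

text \<open>The points above a cell form a strip bounded by the cell and by the upward rays from its
  endpoints. Near \<open>x0\<close> the indicator can therefore change only across the cell through
  \<open>x0\<close>, or across the ray from an endpoint straight below \<open>x0\<close>, where it
  steps up to the right of a left end and down to the right of a right end.\<close>

lemma strip_indicator_local:
  assumes S: "\<sigma> \<in> S" and x0: "x0 \<notin> P"
  shows "\<exists>c::real. \<forall>\<^sub>F x in nhds x0. (if 0 < ht \<sigma> x \<and> cover \<sigma> (e \<bullet> x) then 1 else 0) =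
     c + (if x0 \<in> \<sigma> \<and> 0 < ht \<sigma> x then 1 else 0) +
     (\<Sum>y | y \<in> P \<and> y \<in> \<sigma> \<and> under y x0. if e \<bullet> y \<le> e \<bullet> x then side \<sigma> y else 0)"
proof -
  consider (cell) "x0 \<in> \<sigma>" | (line) "x0 \<notin> \<sigma>" "ht \<sigma> x0 = 0" | (below) "ht \<sigma> x0 < 0"
    | (vertex) y where "0 < ht \<sigma> x0" "y \<in> P" "y \<in> \<sigma>" "e \<bullet> y = e \<bullet> x0"
    | (above) "0 < ht \<sigma> x0" "\<And>y. y \<in> P \<Longrightarrow> y \<in> \<sigma> \<Longrightarrow> e \<bullet> y \<noteq> e \<bullet> x0"
    using less_linear[of 0 "ht \<sigma> x0"] by metis
  then show ?thesis
  proof cases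
    case cell
    then have none: "{y. y \<in> P \<and> y \<in> \<sigma> \<and> under y x0} = {}"
      using under_ht[OF S] ht_on[OF S cell] by fastforce
    have "\<forall>\<^sub>F x in nhds x0. cover \<sigma> (e \<bullet> x)"
      using eventually_e[OF cover_inside[OF S cell x0]] by simp
    then show ?thesis unfolding none
      by (intro exI[of _ 0], elim eventually_mono) (use cell in auto)
  next
    case line
    then have none: "{y. y \<in> P \<and> y \<in> \<sigma> \<and> under y x0} = {}"
      using under_ht[OF S] by fastforce
    \<comment> \<open>On the line but off the cell the height has no fixed sign nearby, so the
      indicator must vanish through \<open>cover\<close>: a cell point with the abscissa of
      \<open>x0\<close> would be \<open>x0\<close>.\<close>
    have "e \<bullet> x \<noteq> e \<bullet> x0" if "x \<in> \<sigma>" for x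
      using line_inj[OF S line(2) ht_on[OF S that]] that line by auto
    then have ev: "\<forall>\<^sub>F x in nhds x0. \<not> cover \<sigma> (e \<bullet> x)"
      using eventually_e[OF cover_outside[OF S]] by blast
    then show ?thesis unfolding none
      by (intro exI[of _ 0], elim eventually_mono) (use line in auto)
  next
    case below
    then have none: "{y. y \<in> P \<and> y \<in> \<sigma> \<and> under y x0} = {}"
      using under_ht[OF S] by fastforce
    from eventually_ht_neg[OF below] show ?thesis unfolding none
      by (intro exI[of _ 0], elim eventually_mono) auto
  next
    case vertex
    have uniq: "z = y" if "z \<in> \<sigma>" "under z x0" for z
      using line_inj[OF S ht_on[OF S that(1)] ht_on[OF S vertex(3)]] under_e[OF that(2)] vertex(4) by simp
    have "under y x0" by (rule under_if[OF S vertex(3,1,4)])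
    then have one: "{y. y \<in> P \<and> y \<in> \<sigma> \<and> under y x0} = {y}"
      using uniq vertex(2,3) by blast
    have x0': "x0 \<notin> \<sigma>" using vertex(1) ht_on[OF S] by force
    have "\<forall>\<^sub>F a in nhds (e \<bullet> x0). cover \<sigma> a = (if side \<sigma> y = 1 then e \<bullet> y \<le> a else a < e \<bullet> y)"
      using cover_end[OF S vertex(3,2)] vertex by simp
    from eventually_e[OF this] eventually_ht_pos[OF vertex(1)]
    \<comment> \<open>At a right end the indicator is 1 to the left of the ray, so the constant is 1
      and the side -1 cancels it from the ray on.\<close>
    have "\<forall>\<^sub>F x in nhds x0. (if 0 < ht \<sigma> x \<and> cover \<sigma> (e \<bullet> x) then 1 else 0) =
        (if side \<sigma> y = 1 then 0 else 1) + (if e \<bullet> y \<le> e \<bullet> x then side \<sigma> y else 0)"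
      by eventually_elim (auto simp: side_def)
    then show ?thesis unfolding one using x0'
      by (intro exI[of _ "if side \<sigma> y = 1 then 0 else 1"]) simp
  next
    case above
    then have none: "{y. y \<in> P \<and> y \<in> \<sigma> \<and> under y x0} = {}"
      using under_e above(2) by blast
    have x0': "x0 \<notin> \<sigma>" using above(1) ht_on[OF S] by force
    have "\<exists>Q. \<forall>\<^sub>F a in nhds (e \<bullet> x0). cover \<sigma> a = Q"
    proof (cases "\<exists>x\<in>\<sigma>. e \<bullet> x = e \<bullet> x0")
      case True
      then obtain x where x: "x \<in> \<sigma>" "e \<bullet> x = e \<bullet> x0" by auto
      then have "x \<notin> P" using above(2) by blast
      from cover_inside[OF S x(1) this] show ?thesis unfolding x(2) by (intro exI[of _ True]) simp
    next
      case False
      then show ?thesis using cover_outside[OF S, of "e \<bullet> x0"] by (intro exI[of _ False]) auto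
    qed
    then obtain Q where "\<forall>\<^sub>F a in nhds (e \<bullet> x0). cover \<sigma> a = Q" ..
    from eventually_e[OF this] eventually_ht_pos[OF above(1)]
    have "\<forall>\<^sub>F x in nhds x0. (if 0 < ht \<sigma> x \<and> cover \<sigma> (e \<bullet> x) then 1 else 0) =
        (if Q then 1 else (0 :: real))"
      by eventually_elim auto
    then show ?thesis unfolding none using x0'
      by (intro exI[of _ "if Q then 1 else 0"]) simp
  qed
qed

definition strip_sum :: "((real ^ 2) set \<Rightarrow> real ^ 2) \<Rightarrow> real ^ 2 \<Rightarrow> real ^ 2" where
  "strip_sum j x = (\<Sum>\<sigma>\<in>S. if 0 < ht \<sigma> x \<and> cover \<sigma> (e \<bullet> x) then j \<sigma> else 0)"

text \<open>An unbalanced vertex is seen by the strip sum as a jump across the upward ray from it.\<close>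

lemma strip_sum_local:
  assumes x0: "x0 \<notin> P"
  shows "\<exists>c. \<forall>\<^sub>F x in nhds x0. strip_sum j x =
     c + (\<Sum>\<sigma> | \<sigma> \<in> S \<and> x0 \<in> \<sigma>. if 0 < ht \<sigma> x then j \<sigma> else 0) +
     (\<Sum>y | y \<in> P \<and> under y x0. if e \<bullet> y \<le> e \<bullet> x then imbalance j y else 0)"
proof -
  define g where "g \<sigma> y x = (if e \<bullet> y \<le> e \<bullet> x then side \<sigma> y else 0)" for \<sigma> y x
  have "\<forall>\<sigma>\<in>S. \<exists>c. \<forall>\<^sub>F x in nhds x0. (if 0 < ht \<sigma> x \<and> cover \<sigma> (e \<bullet> x) then 1 else 0) =
      c + (if x0 \<in> \<sigma> \<and> 0 < ht \<sigma> x then 1 else 0) + (\<Sum>y | y \<in> P \<and> y \<in> \<sigma> \<and> under y x0. g \<sigma> y x)"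
    unfolding g_def by (intro ballI strip_indicator_local x0)
  from bchoice[OF this] obtain c where c: "\<forall>\<sigma>\<in>S. \<forall>\<^sub>F x in nhds x0.
      (if 0 < ht \<sigma> x \<and> cover \<sigma> (e \<bullet> x) then 1 else 0) =
      c \<sigma> + (if x0 \<in> \<sigma> \<and> 0 < ht \<sigma> x then 1 else 0) + (\<Sum>y | y \<in> P \<and> y \<in> \<sigma> \<and> under y x0. g \<sigma> y x)"
    by (elim exE)
  have "\<forall>\<^sub>F x in nhds x0. \<forall>\<sigma>\<in>S.
      (if 0 < ht \<sigma> x \<and> cover \<sigma> (e \<bullet> x) then 1 else 0) =
      c \<sigma> + (if x0 \<in> \<sigma> \<and> 0 < ht \<sigma> x then 1 else 0) + (\<Sum>y | y \<in> P \<and> y \<in> \<sigma> \<and> under y x0. g \<sigma> y x)"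
    by (rule eventually_ball_finite[OF finite_S c])
  then have "\<forall>\<^sub>F x in nhds x0. strip_sum j x = (\<Sum>\<sigma>\<in>S. c \<sigma> *\<^sub>R j \<sigma>) +
     (\<Sum>\<sigma> | \<sigma> \<in> S \<and> x0 \<in> \<sigma>. if 0 < ht \<sigma> x then j \<sigma> else 0) +
     (\<Sum>y | y \<in> P \<and> under y x0. if e \<bullet> y \<le> e \<bullet> x then imbalance j y else 0)"
  proof eventually_elim
    case (elim x)
    have "strip_sum j x = (\<Sum>\<sigma>\<in>S. (if 0 < ht \<sigma> x \<and> cover \<sigma> (e \<bullet> x) then 1 else 0) *\<^sub>R j \<sigma>)"
      unfolding strip_sum_def by (rule sum.cong) auto
    also have "\<dots> = (\<Sum>\<sigma>\<in>S. (c \<sigma> + (if x0 \<in> \<sigma> \<and> 0 < ht \<sigma> x then 1 else 0)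
        + (\<Sum>y | y \<in> P \<and> y \<in> \<sigma> \<and> under y x0. g \<sigma> y x)) *\<^sub>R j \<sigma>)"
      by (rule sum.cong) (use elim in auto)
    also have "\<dots> = (\<Sum>\<sigma>\<in>S. c \<sigma> *\<^sub>R j \<sigma>) + (\<Sum>\<sigma>\<in>S. (if x0 \<in> \<sigma> \<and> 0 < ht \<sigma> x then 1 else 0) *\<^sub>R j \<sigma>)
        + (\<Sum>\<sigma>\<in>S. (\<Sum>y | y \<in> P \<and> y \<in> \<sigma> \<and> under y x0. g \<sigma> y x) *\<^sub>R j \<sigma>)"
      by (simp only: scaleR_add_left sum.distrib)
    also have "(\<Sum>\<sigma>\<in>S. (\<Sum>y | y \<in> P \<and> y \<in> \<sigma> \<and> under y x0. g \<sigma> y x) *\<^sub>R j \<sigma>) =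
        (\<Sum>\<sigma>\<in>S. \<Sum>y | y \<in> P \<and> y \<in> \<sigma> \<and> under y x0. g \<sigma> y x *\<^sub>R j \<sigma>)"
      by (simp only: scaleR_sum_left)
    also have "(\<Sum>\<sigma>\<in>S. (if x0 \<in> \<sigma> \<and> 0 < ht \<sigma> x then 1 else 0) *\<^sub>R j \<sigma>) =
        (\<Sum>\<sigma>\<in>S. if x0 \<in> \<sigma> then (if 0 < ht \<sigma> x then j \<sigma> else 0) else 0)"
      by (rule sum.cong) auto
    also have "(\<Sum>\<sigma>\<in>S. if x0 \<in> \<sigma> then (if 0 < ht \<sigma> x then j \<sigma> else 0) else 0) =
        (\<Sum>\<sigma> | \<sigma> \<in> S \<and> x0 \<in> \<sigma>. if 0 < ht \<sigma> x then j \<sigma> else 0)"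
      using sum.inter_filter[OF finite_S, of "\<lambda>\<sigma>. if 0 < ht \<sigma> x then j \<sigma> else 0" "\<lambda>\<sigma>. x0 \<in> \<sigma>"] by simp
    also have "(\<Sum>\<sigma>\<in>S. \<Sum>y | y \<in> P \<and> y \<in> \<sigma> \<and> under y x0. g \<sigma> y x *\<^sub>R j \<sigma>) =
        (\<Sum>\<sigma>\<in>S. \<Sum>y | y \<in> {y \<in> P. under y x0} \<and> y \<in> \<sigma>. g \<sigma> y x *\<^sub>R j \<sigma>)"
      by (intro sum.cong) auto
    \<comment> \<open>Collecting the ray terms by vertex instead of by cell produces the
      imbalances.\<close>
    also have "\<dots> = (\<Sum>y\<in>{y \<in> P. under y x0}. \<Sum>\<sigma> | \<sigma> \<in> S \<and> y \<in> \<sigma>. g \<sigma> y x *\<^sub>R j \<sigma>)"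
      by (rule sum.swap_restrict) (use finite_S finite_P in auto)
    also have "\<dots> = (\<Sum>y | y \<in> P \<and> under y x0. if e \<bullet> y \<le> e \<bullet> x then imbalance j y else 0)"
      by (rule sum.cong) (auto simp: imbalance_def g_def)
    finally show ?case .
  qed
  then show ?thesis
    by (intro exI[of _ "\<Sum>\<sigma>\<in>S. c \<sigma> *\<^sub>R j \<sigma>"])
qed

lemma potential_exists:
  assumes "\<And>y. y \<in> P \<Longrightarrow> imbalance j y = 0"
  shows "potential (strip_sum j) j"
  unfolding potential_def
proof (intro allI impI)
  fix x0 assume "x0 \<notin> P"
  from strip_sum_local[OF this, of j] obtain c where
    c: "\<forall>\<^sub>F x in nhds x0. strip_sum j x =
     c + (\<Sum>\<sigma> | \<sigma> \<in> S \<and> x0 \<in> \<sigma>. if 0 < ht \<sigma> x then j \<sigma> else 0) +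
     (\<Sum>y | y \<in> P \<and> under y x0. if e \<bullet> y \<le> e \<bullet> x then imbalance j y else 0)"
    by (elim exE)
  have z: "(\<Sum>y | y \<in> P \<and> under y x0. if e \<bullet> y \<le> e \<bullet> x then imbalance j y else 0) = 0" for x
    by (rule sum.neutral) (use assms in auto)
  show "\<exists>c. \<forall>\<^sub>F x in nhds x0. x \<notin> \<Union>S \<longrightarrow>
     strip_sum j x = c + (\<Sum>\<sigma> | \<sigma> \<in> S \<and> x0 \<in> \<sigma>. if 0 < ht \<sigma> x then j \<sigma> else 0)"
    by (rule exI[of _ c], rule eventually_mono[OF c]) (simp add: z)
qed

lemma negligible_curve: "negligible (\<Union>S)"
proof (rule negligible_Union[OF finite_S])
  fix \<sigma> assume s: "\<sigma> \<in> S"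
  have "\<sigma> \<subseteq> {x. rot (d \<sigma>) \<bullet> x = rot (d \<sigma>) \<bullet> b \<sigma>}"
    using ht_on[OF s] by (auto simp: ht_def inner_diff_right)
  then show "negligible \<sigma>"
    using negligible_hyperplane d_nonzero[OF s] negligible_subset
    by (metis rot_eq_0_iff)
qed

lemma interior_curve: "interior (\<Union>S) = {}"
  using open_not_negligible[OF open_interior] negligible_subset[OF negligible_curve interior_subset]
  by blast

lemma closed_curve: "closed (\<Union>S)"
  using finite_S closed_cell by blast

end


section \<open>Jumps of locally constant functions\<close>

text \<open>The part of a neighbourhood on one side of a hyperplane through its centre is open and
  nonempty, hence not inside a set with empty interior. Local formulas for potentials and regions
  are evaluated at such points.\<close>

lemma generic_side:
  fixes x0 :: "'a :: euclidean_space"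
  assumes "\<forall>\<^sub>F x in nhds x0. Q x" "n \<noteq> 0" "interior C = {}"
  shows "\<exists>x. Q x \<and> n \<bullet> x0 < n \<bullet> x \<and> x \<notin> C"
proof -
  obtain r where r: "r > 0" "\<And>x. dist x x0 < r \<Longrightarrow> Q x"
    using assms(1) unfolding eventually_nhds_metric by auto
  define V where "V = ball x0 r \<inter> {x. n \<bullet> x0 < n \<bullet> x}"
  define z where "z = x0 + (r / (2 * norm n)) *\<^sub>R n"
  have "0 < (r / (2 * norm n)) * (n \<bullet> n)" using r assms(2) by simp
  then have "z \<in> V" using r assms(2) by (simp add: V_def z_def dist_norm inner_add_right)
  moreover have "open V" unfolding V_def by (intro open_Int open_ball open_halfspace_gt)
  ultimately have "\<not> V \<subseteq> C" using assms(3) interior_maximal[of V C] by auto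
  then obtain x where "x \<in> V" "x \<notin> C" by auto
  then show ?thesis using r(2)[of x] by (intro exI[of _ x]) (auto simp: V_def dist_commute)
qed

lemma starlike_connected:
  fixes U :: "'a :: real_normed_vector set"
  assumes "\<And>x. x \<in> U \<Longrightarrow> closed_segment c x \<subseteq> U"
  shows "connected U"
proof -
  have "connected (\<Union>x\<in>U. closed_segment c x)"
    by (rule connected_Union) auto
  moreover have "(\<Union>x\<in>U. closed_segment c x) = U" using assms by auto
  ultimately show ?thesis by simp
qed

context planar_curve
begin

lemma norm_decomp: "(e \<bullet> v)\<^sup>2 + (rot e \<bullet> v)\<^sup>2 = (e \<bullet> e) * (v \<bullet> v)"
  unfolding inner_real_2 by (simp add: algebra_simps power2_eq_square)

lemma e_nonzero: "y \<in> P \<Longrightarrow> e \<noteq> 0"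
  using vertices_in e_pos by fastforce

lemma potentialD:
  assumes "potential F j" "x0 \<notin> P"
  shows "\<exists>c. \<forall>\<^sub>F x in nhds x0. x \<notin> \<Union>S \<longrightarrow>
     F x = c + (\<Sum>\<sigma> | \<sigma> \<in> S \<and> x0 \<in> \<sigma>. if 0 < ht \<sigma> x then j \<sigma> else 0)"
  using assms by (simp add: potential_def)

text \<open>Near the lowest unbalanced vertex \<open>y0\<close>, the difference of \<open>F\<close> and the strip sum is locally
  constant off the upward ray from \<open>y0\<close>, but jumps by the imbalance across that ray.\<close>

lemma potential_balanced:
  assumes pot: "potential F j" and "y \<in> P"
  shows "imbalance j y = 0"
proof (rule ccontr)
  assume "imbalance j y \<noteq> 0"
  define B where "B = {y \<in> P. imbalance j y \<noteq> 0}"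
  have "finite B" "B \<noteq> {}" using \<open>imbalance j y \<noteq> 0\<close> assms(2) finite_P by (auto simp: B_def)
  then obtain y0 where y0: "y0 \<in> B" and low: "\<And>y. y \<in> B \<Longrightarrow> rot e \<bullet> y0 \<le> rot e \<bullet> y"
    using ex_is_arg_min_if_finite[of B "\<lambda>y. rot e \<bullet> y"] by (auto simp: is_arg_min_linorder)
  have y0P: "y0 \<in> P" using y0 by (simp add: B_def)
  have e0: "e \<noteq> 0" using e_nonzero[OF y0P] .
  obtain \<epsilon> where eps: "\<epsilon> > 0" "\<And>y. y \<in> P \<Longrightarrow> y \<noteq> y0 \<Longrightarrow> \<epsilon> \<le> dist y0 y"
    using finite_set_avoid[OF finite_P, of y0] by auto
  define bad where "bad x \<longleftrightarrow> e \<bullet> x = e \<bullet> y0 \<and> rot e \<bullet> y0 \<le> rot e \<bullet> x" for x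
  \<comment> \<open>The ball slit along the closed upward ray from \<open>y0\<close>. It is
    star-shaped about the point \<open>c\<close> straight below \<open>y0\<close>, hence
    connected.\<close>
  define U where "U = ball y0 \<epsilon> \<inter> - ({x. e \<bullet> x = e \<bullet> y0} \<inter> {x. rot e \<bullet> y0 \<le> rot e \<bullet> x})"
  have U_iff: "x \<in> U \<longleftrightarrow> dist y0 x < \<epsilon> \<and> \<not> bad x" for x by (auto simp: U_def bad_def)
  have "open U" unfolding U_def
    by (intro open_Int open_ball open_Compl closed_Int closed_hyperplane closed_halfspace_ge)
  define c where "c = y0 - (\<epsilon> / (2 * norm e)) *\<^sub>R rot e"
  have nrot: "norm (rot e) = norm e" by (simp add: norm_eq_sqrt_inner)
  have cU: "dist y0 c < \<epsilon>" using eps e0 by (simp add: c_def dist_norm nrot)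
  have "connected U"
  proof (rule starlike_connected)
    fix x assume x: "x \<in> U"
    show "closed_segment c x \<subseteq> U"
    proof
      fix z assume z: "z \<in> closed_segment c x"
      have "z \<in> ball y0 \<epsilon>"
        using z x cU convex_ball[of y0 \<epsilon>] U_iff closed_segment_subset[of c "ball y0 \<epsilon>" x] by auto
      moreover have "\<not> bad z"
      proof
        assume bad: "bad z"
        obtain u where u: "0 \<le> u" "u \<le> 1" "z = (1 - u) *\<^sub>R c + u *\<^sub>R x"
          using z by (auto simp: in_segment)
        define k where "k = \<epsilon> / (2 * norm e) * (e \<bullet> e)"
        have k: "k > 0" using eps e0 by (simp add: k_def)
        have ez: "e \<bullet> z - e \<bullet> y0 = u * (e \<bullet> x - e \<bullet> y0)"
          by (simp add: u(3) c_def inner_add_right inner_diff_right algebra_simps)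
        have rz: "rot e \<bullet> z - rot e \<bullet> y0 = u * (rot e \<bullet> x - rot e \<bullet> y0) - (1 - u) * k"
          by (simp add: u(3) c_def k_def inner_add_right inner_diff_right algebra_simps)
        show False
        proof (cases "u = 0")
          case True
          then show False using rz k bad by (simp add: bad_def)
        next
          case False
          then have "e \<bullet> x = e \<bullet> y0" using ez bad by (simp add: bad_def)
          then have "rot e \<bullet> x - rot e \<bullet> y0 < 0" using x by (auto simp: U_iff bad_def)
          then have "u * (rot e \<bullet> x - rot e \<bullet> y0) < 0" using u False by (simp add: mult_pos_neg)
          moreover have "(1 - u) * k \<ge> 0" using u k by simp
          ultimately show False using rz bad by (simp add: bad_def)
        qed
      qed
      ultimately show "z \<in> U" by (simp add: U_iff)
    qed
  qed
  \<comment> \<open>Here the lowest choice of \<open>y0\<close> matters: an unbalanced vertex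
    straight below \<open>x\<close> has the abscissa of \<open>x\<close> and a height between those
    of \<open>y0\<close> and \<open>x\<close>, so it is at least as close to \<open>y0\<close> as
    \<open>x\<close> and falls into the ball.\<close>
  have only: "y = y0" if yx: "y \<in> B" "under y x" "dist y0 x < \<epsilon>" for x y
  proof (rule ccontr)
    assume "y \<noteq> y0"
    then have far: "\<epsilon> \<le> dist y0 y" using eps yx by (simp add: B_def)
    obtain t where t: "t > 0" "x = y + t *\<^sub>R rot e" using yx(2) by (auto simp: under_def)
    have 1: "e \<bullet> (x - y0) = e \<bullet> (y - y0)" by (simp add: t inner_diff_right inner_add_right)
    have 2: "0 \<le> rot e \<bullet> (y - y0)" using low[OF yx(1)] by (simp add: inner_diff_right)
    have 3: "rot e \<bullet> (y - y0) \<le> rot e \<bullet> (x - y0)" using t by (simp add: inner_diff_right inner_add_right)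
    have "(rot e \<bullet> (y - y0))\<^sup>2 \<le> (rot e \<bullet> (x - y0))\<^sup>2" using 2 3 by (rule power_mono[rotated])
    then have "(e \<bullet> e) * ((y - y0) \<bullet> (y - y0)) \<le> (e \<bullet> e) * ((x - y0) \<bullet> (x - y0))"
      using norm_decomp[of "y - y0"] norm_decomp[of "x - y0"] 1 by simp
    then have "(y - y0) \<bullet> (y - y0) \<le> (x - y0) \<bullet> (x - y0)" using e0 by simp
    then have "norm (y - y0) \<le> norm (x - y0)" by (simp add: norm_le)
    then show False using far yx(3) by (simp add: dist_norm norm_minus_commute)
  qed
  define G where "G x = F x - strip_sum j x" for x
  have G_local: "\<exists>c. \<forall>\<^sub>F x in nhds x0. x \<notin> \<Union>S \<longrightarrow> G x = c -
     (\<Sum>y | y \<in> P \<and> under y x0. if e \<bullet> y \<le> e \<bullet> x then imbalance j y else 0)" if x0: "x0 \<notin> P" for x0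
  proof -
    from potentialD[OF pot x0] obtain c1 where c1: "\<forall>\<^sub>F x in nhds x0. x \<notin> \<Union>S \<longrightarrow>
       F x = c1 + (\<Sum>\<sigma> | \<sigma> \<in> S \<and> x0 \<in> \<sigma>. if 0 < ht \<sigma> x then j \<sigma> else 0)"
      by (elim exE)
    from strip_sum_local[OF x0, of j] obtain c2 where c2: "\<forall>\<^sub>F x in nhds x0. strip_sum j x =
       c2 + (\<Sum>\<sigma> | \<sigma> \<in> S \<and> x0 \<in> \<sigma>. if 0 < ht \<sigma> x then j \<sigma> else 0) +
       (\<Sum>y | y \<in> P \<and> under y x0. if e \<bullet> y \<le> e \<bullet> x then imbalance j y else 0)"
      by (elim exE)
    from c1 c2 have "\<forall>\<^sub>F x in nhds x0. x \<notin> \<Union>S \<longrightarrow> G x = c1 - c2 -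
       (\<Sum>y | y \<in> P \<and> under y x0. if e \<bullet> y \<le> e \<bullet> x then imbalance j y else 0)"
      by eventually_elim (simp add: G_def)
    then show ?thesis by (intro exI[of _ "c1 - c2"])
  qed
  have "\<exists>k. \<forall>\<^sub>F x in nhds x0. x \<notin> \<Union>S \<longrightarrow> G x = k" if x0: "x0 \<in> U" for x0
  proof -
    have "x0 \<noteq> y0" using x0 by (auto simp: U_iff bad_def)
    then have "x0 \<notin> P" using eps(2)[of x0] x0 by (auto simp: U_iff)
    from G_local[OF this] obtain k where k: "\<forall>\<^sub>F x in nhds x0. x \<notin> \<Union>S \<longrightarrow> G x = k -
       (\<Sum>y | y \<in> P \<and> under y x0. if e \<bullet> y \<le> e \<bullet> x then imbalance j y else 0)"
      by (elim exE)
    have "\<not> under y0 x0"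
      using x0 by (auto simp: U_iff under_def bad_def inner_add_right)
    then have "imbalance j y = 0" if "y \<in> P" "under y x0" for y
      using only[of y x0] that x0 by (auto simp: U_iff B_def)
    then have z: "(\<Sum>y | y \<in> P \<and> under y x0. if e \<bullet> y \<le> e \<bullet> x then imbalance j y else 0) = 0" for x
      by (intro sum.neutral) auto
    show ?thesis using k unfolding z by (intro exI[of _ k]) simp
  qed
  from locally_constant_extension[OF \<open>open U\<close> \<open>connected U\<close> interior_curve this]
  obtain k where k: "\<And>x. x \<in> U \<Longrightarrow> x \<notin> \<Union>S \<Longrightarrow> G x = k" by blast
  \<comment> \<open>A point on the slit itself. Generic points just right and left of it lie in
    \<open>U\<close>, where \<open>G\<close> equals \<open>k\<close>, while the local formula at
    \<open>x1\<close> gives values differing by the imbalance of \<open>y0\<close>.\<close>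
  define x1 where "x1 = y0 + (\<epsilon> / (2 * norm e)) *\<^sub>R rot e"
  have x1d: "dist y0 x1 < \<epsilon>" using eps e0 by (simp add: x1_def dist_norm nrot)
  have "x1 \<noteq> y0" using eps e0 by (simp add: x1_def)
  then have "x1 \<notin> P" using eps(2)[of x1] x1d by auto
  from G_local[OF this] obtain l where l: "\<forall>\<^sub>F x in nhds x1. x \<notin> \<Union>S \<longrightarrow> G x = l -
     (\<Sum>y | y \<in> P \<and> under y x1. if e \<bullet> y \<le> e \<bullet> x then imbalance j y else 0)"
    by (elim exE)
  have "under y0 x1" unfolding under_def x1_def using eps e0 by (intro exI[of _ "\<epsilon> / (2 * norm e)"]) simp
  then have "(\<Sum>y\<in>{y0}. if e \<bullet> y \<le> e \<bullet> x then imbalance j y else 0) =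
      (\<Sum>y | y \<in> P \<and> under y x1. if e \<bullet> y \<le> e \<bullet> x then imbalance j y else 0)" for x
    using only[of _ x1] x1d y0P finite_P by (intro sum.mono_neutral_left) (auto simp: B_def)
  then have s: "(\<Sum>y | y \<in> P \<and> under y x1. if e \<bullet> y \<le> e \<bullet> x then imbalance j y else 0) =
      (if e \<bullet> y0 \<le> e \<bullet> x then imbalance j y0 else 0)" for x by simp
  have ex1: "e \<bullet> x1 = e \<bullet> y0" by (simp add: x1_def inner_add_right)
  have "\<forall>\<^sub>F x in nhds x1. x \<in> ball y0 \<epsilon>"
    by (rule eventually_nhds_in_open) (use x1d in auto)
  with l have ev: "\<forall>\<^sub>F x in nhds x1. dist y0 x < \<epsilon> \<and> (x \<notin> \<Union>S \<longrightarrow>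
      G x = l - (if e \<bullet> y0 \<le> e \<bullet> x then imbalance j y0 else 0))"
    by eventually_elim (simp add: s)
  obtain x where x: "dist y0 x < \<epsilon>" "x \<notin> \<Union>S" "e \<bullet> x1 < e \<bullet> x"
      "G x = l - (if e \<bullet> y0 \<le> e \<bullet> x then imbalance j y0 else 0)"
    using generic_side[OF ev e0 interior_curve] by blast
  obtain x' where x': "dist y0 x' < \<epsilon>" "x' \<notin> \<Union>S" "(- e) \<bullet> x1 < (- e) \<bullet> x'"
      "G x' = l - (if e \<bullet> y0 \<le> e \<bullet> x' then imbalance j y0 else 0)"
    using generic_side[OF ev _ interior_curve, of "- e"] e0 by auto
  have "G x = k" using k[of x] x ex1 by (auto simp: U_iff bad_def)
  moreover have "G x' = k" using k[of x'] x' ex1 by (auto simp: U_iff bad_def)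
  ultimately have "imbalance j y0 = 0" using x x' ex1 by auto
  then show False using y0 by (simp add: B_def)
qed

text \<open>The complement of the finite set \<open>P\<close> is connected and the potential is
  locally constant there up to the curve, which has empty interior.\<close>

lemma potential_zero_constant:
  assumes pot: "potential F j" and z: "\<And>\<sigma>. \<sigma> \<in> S \<Longrightarrow> j \<sigma> = 0"
  shows "\<exists>c. \<forall>x. x \<notin> \<Union>S \<longrightarrow> F x = c"
proof -
  have "connected (UNIV - P)"
    using finite_P by (intro connected_open_delete_finite) auto
  then have con: "connected (- P)" by (simp add: Compl_eq_Diff_UNIV)
  have op: "open (- P)" using finite_P by (simp add: finite_imp_closed open_Compl)
  have "\<exists>c. \<forall>\<^sub>F x in nhds x0. x \<notin> \<Union>S \<longrightarrow> F x = c" if "x0 \<in> - P" for x0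
  proof -
    from that have "x0 \<notin> P" by simp
    from potentialD[OF pot this] obtain c where c: "\<forall>\<^sub>F x in nhds x0. x \<notin> \<Union>S \<longrightarrow>
       F x = c + (\<Sum>\<sigma> | \<sigma> \<in> S \<and> x0 \<in> \<sigma>. if 0 < ht \<sigma> x then j \<sigma> else 0)"
      by (elim exE)
    have "(\<Sum>\<sigma> | \<sigma> \<in> S \<and> x0 \<in> \<sigma>. if 0 < ht \<sigma> x then j \<sigma> else 0) = 0" for x
      by (rule sum.neutral) (auto simp: z)
    with c show ?thesis by auto
  qed
  from locally_constant_extension[OF op con interior_curve this]
  show ?thesis using vertices_in by blast
qed

lemma potential_locally_constant:
  assumes "potential F j" "x0 \<notin> \<Union>S"
  shows "\<exists>c. \<forall>\<^sub>F x in nhds x0. x \<notin> \<Union>S \<longrightarrow> F x = c"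
proof -
  have x0: "x0 \<notin> P" using assms vertices_in by auto
  have none: "{\<sigma>. \<sigma> \<in> S \<and> x0 \<in> \<sigma>} = {}" using assms by auto
  from potentialD[OF assms(1) x0] obtain c where c: "\<forall>\<^sub>F x in nhds x0. x \<notin> \<Union>S \<longrightarrow>
     F x = c + (\<Sum>\<sigma> | \<sigma> \<in> S \<and> x0 \<in> \<sigma>. if 0 < ht \<sigma> x then j \<sigma> else 0)"
      by (elim exE)
  show ?thesis using c unfolding none by auto
qed

lemma potential_component_constant:
  assumes "potential F j" "connected_component (- \<Union>S) x y"
  shows "F x = F y"
proof -
  define U where "U = connected_component_set (- \<Union>S) x"
  have "open U" "connected U"
    unfolding U_def using closed_curve by (auto intro: open_connected_component)
  have "U \<subseteq> - \<Union>S" unfolding U_def by (rule connected_component_subset)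
  have "x \<in> U" "y \<in> U"
    using assms(2) connected_component_in(1)[OF assms(2)] by (auto simp: U_def)
  have "\<exists>c. \<forall>z\<in>U - \<Union>S. F z = c"
    by (rule locally_constant_extension[OF \<open>open U\<close> \<open>connected U\<close> interior_curve])
      (use \<open>U \<subseteq> - \<Union>S\<close> potential_locally_constant[OF assms(1)] in blast)
  then obtain c where "\<And>z. z \<in> U - \<Union>S \<Longrightarrow> F z = c" by blast
  moreover have "x \<in> U - \<Union>S" "y \<in> U - \<Union>S" using \<open>x \<in> U\<close> \<open>y \<in> U\<close> \<open>U \<subseteq> - \<Union>S\<close> by auto
  ultimately show ?thesis by metis
qed

lemma unique_cell:
  assumes "\<sigma> \<in> S" "x0 \<in> \<sigma>" "x0 \<notin> P"
  shows "{\<sigma>'. \<sigma>' \<in> S \<and> x0 \<in> \<sigma>'} = {\<sigma>}"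
  using assms cells_meet by blast

text \<open>The other cells are closed and miss \<open>x0\<close>, and a non-vertex point has cell
  points on both sides of it along the line.\<close>

lemma curve_near_cell_point:
  assumes "\<sigma> \<in> S" "x0 \<in> \<sigma>" "x0 \<notin> P"
  shows "\<exists>r>0. \<forall>x\<in>ball x0 r. x \<in> \<Union>S \<longleftrightarrow> ht \<sigma> x = 0"
proof -
  have "open (- \<Union>(S - {\<sigma>}))" using finite_S closed_cell by blast
  moreover have "x0 \<in> - \<Union>(S - {\<sigma>})" using unique_cell[OF assms] by blast
  ultimately have "\<forall>\<^sub>F x in nhds x0. x \<in> - \<Union>(S - {\<sigma>})" by (rule eventually_nhds_in_open)
  with eventually_e[OF cover_inside[OF assms]]
  have "\<forall>\<^sub>F x in nhds x0. x \<in> \<Union>S \<longleftrightarrow> ht \<sigma> x = 0"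
  proof eventually_elim
    case (elim x)
    then show ?case using cover_imp_in_cell[OF assms(1)] ht_on[OF assms(1)] assms(1) by blast
  qed
  then obtain r where "r > 0" "\<forall>x. dist x x0 < r \<longrightarrow> (x \<in> \<Union>S \<longleftrightarrow> ht \<sigma> x = 0)"
    unfolding eventually_nhds_metric by blast
  then show ?thesis by (intro exI[of _ r]) (simp add: dist_commute)
qed

text \<open>Each of the two open halves of a small ball is convex and misses the curve; positivity
  of the product handles both halves at once.\<close>

lemma sides_connected:
  assumes "\<sigma> \<in> S" "x0 \<in> \<sigma>" "x0 \<notin> P"
  shows "\<exists>r>0. \<forall>x\<in>ball x0 r. \<forall>x'\<in>ball x0 r.
     (x \<in> \<Union>S \<longleftrightarrow> ht \<sigma> x = 0) \<and>
     (ht \<sigma> x * ht \<sigma> x' > 0 \<longrightarrow> connected_component (- \<Union>S) x x')"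
proof -
  obtain r where r: "r > 0" "\<And>x. x \<in> ball x0 r \<Longrightarrow> x \<in> \<Union>S \<longleftrightarrow> ht \<sigma> x = 0"
    using curve_near_cell_point[OF assms] by auto
  have "connected_component (- \<Union>S) x x'"
    if x: "x \<in> ball x0 r" "x' \<in> ball x0 r" "ht \<sigma> x * ht \<sigma> x' > 0" for x x'
  proof -
    have seg: "ht \<sigma> z \<noteq> 0" if z: "z \<in> closed_segment x x'" for z
    proof -
      obtain u where u: "0 \<le> u" "u \<le> 1" "z = (1 - u) *\<^sub>R x + u *\<^sub>R x'"
        using z by (auto simp: in_segment)
      have "ht \<sigma> z = (1 - u) * ht \<sigma> x + u * ht \<sigma> x'"
        by (simp add: u(3) ht_def inner_add_right inner_diff_right algebra_simps)
      moreover have "(1 - u) * a + u * a' \<noteq> 0" if "a * a' > 0" for a a'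
      proof (cases "a > 0")
        case True
        then have "a' > 0" using that by (simp add: zero_less_mult_iff)
        then have "u * a' \<ge> 0" "(1 - u) * a \<ge> 0" using u True by auto
        moreover have "u * a' > 0 \<or> (1 - u) * a > 0" using u True \<open>a' > 0\<close> by (cases "u = 0") auto
        ultimately show ?thesis by linarith
      next
        case False
        then have "a < 0" "a' < 0" using that by (auto simp: zero_less_mult_iff)
        then have "u * a' \<le> 0" "(1 - u) * a \<le> 0" using u by (auto simp: mult_nonneg_nonpos)
        moreover have "u * a' < 0 \<or> (1 - u) * a < 0"
          using u \<open>a < 0\<close> \<open>a' < 0\<close> by (cases "u = 0") (auto simp: mult_pos_neg)
        ultimately show ?thesis by linarith
      qed
      ultimately show ?thesis using x(3) by simp
    qed
    have "closed_segment x x' \<subseteq> ball x0 r" using x convex_ball by (simp add: closed_segment_subset)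
    then have "closed_segment x x' \<subseteq> - \<Union>S" using seg r(2) by blast
    then show ?thesis unfolding connected_component_def
      by (intro exI[of _ "closed_segment x x'"]) auto
  qed
  then show ?thesis using r by blast
qed

text \<open>Cells are uncountable. The extra set \<open>Q\<close> makes room for the vertices of a
  second curve.\<close>

lemma cell_avoid:
  assumes "\<sigma> \<in> S" "finite Q"
  shows "\<exists>x\<in>\<sigma>. x \<notin> P \<and> x \<notin> Q"
proof -
  obtain x where x: "x \<in> \<sigma>" "x \<noteq> b \<sigma>" using nontrivial_cell[OF assms(1)] by auto
  have "uncountable (open_segment (b \<sigma>) x)" using x by (simp add: uncountable_open_segment)
  moreover have "open_segment (b \<sigma>) x \<subseteq> \<sigma>"
    using x base_in[OF assms(1)] convex_cell[OF assms(1)] by (meson convex_contains_open_segment)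
  ultimately have "uncountable \<sigma>" using countable_subset by blast
  moreover have "countable (P \<union> Q)" using assms finite_P by (simp add: countable_finite)
  ultimately have "\<not> \<sigma> \<subseteq> P \<union> Q" using countable_subset by blast
  then show ?thesis by auto
qed

text \<open>Deleting extreme points from a convex set leaves it convex.\<close>

lemma connected_inner_cell: "\<sigma> \<in> S \<Longrightarrow> connected (\<sigma> - P)"
proof (rule convex_connected)
  assume s: "\<sigma> \<in> S"
  show "convex (\<sigma> - P)"
    unfolding convex_contains_open_segment
  proof (intro ballI subsetI)
    fix u v w assume *: "u \<in> \<sigma> - P" "v \<in> \<sigma> - P" "w \<in> open_segment u v"
    then have "w \<in> \<sigma>" using convex_cell[OF s] by (meson DiffD1 convex_contains_open_segment subsetD)
    then show "w \<in> \<sigma> - P" using * vertex_iff[OF s] by (auto simp: extreme_point_of_def)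
  qed
qed

lemma ht_generic:
  assumes "\<sigma> \<in> S" "\<forall>\<^sub>F x in nhds x0. Q x" "ht \<sigma> x0 = 0"
  shows "\<exists>x. Q x \<and> 0 < ht \<sigma> x \<and> x \<notin> \<Union>S" "\<exists>x. Q x \<and> ht \<sigma> x < 0 \<and> x \<notin> \<Union>S"
  using generic_side[OF assms(2) _ interior_curve, of "rot (d \<sigma>)"]
    generic_side[OF assms(2) _ interior_curve, of "- rot (d \<sigma>)"] d_nonzero[OF assms(1)] assms(3)
  by (auto simp: ht_def inner_diff_right)

lemma potential_jump:
  assumes "potential F j" "\<sigma> \<in> S" "x0 \<in> \<sigma>" "x0 \<notin> P"
  shows "\<exists>c. \<forall>\<^sub>F x in nhds x0. (0 < ht \<sigma> x \<longrightarrow> F x = c + j \<sigma>) \<and> (ht \<sigma> x < 0 \<longrightarrow> F x = c)"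
proof -
  from potentialD[OF assms(1,4)] obtain c where c: "\<forall>\<^sub>F x in nhds x0. x \<notin> \<Union>S \<longrightarrow>
     F x = c + (\<Sum>\<sigma> | \<sigma> \<in> S \<and> x0 \<in> \<sigma>. if 0 < ht \<sigma> x then j \<sigma> else 0)"
      by (elim exE)
  have s: "(\<Sum>\<sigma> | \<sigma> \<in> S \<and> x0 \<in> \<sigma>. if 0 < ht \<sigma> x then j \<sigma> else 0) = (if 0 < ht \<sigma> x then j \<sigma> else 0)" for x
    unfolding unique_cell[OF assms(2-4)] by simp
  obtain r where r: "r > 0" "\<And>x. x \<in> ball x0 r \<Longrightarrow> x \<in> \<Union>S \<longleftrightarrow> ht \<sigma> x = 0"
    using curve_near_cell_point[OF assms(2-4)] by auto
  have "\<forall>\<^sub>F x in nhds x0. x \<in> ball x0 r" by (rule eventually_nhds_in_open) (use r in auto)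
  with c have "\<forall>\<^sub>F x in nhds x0. (0 < ht \<sigma> x \<longrightarrow> F x = c + j \<sigma>) \<and> (ht \<sigma> x < 0 \<longrightarrow> F x = c)"
  proof eventually_elim
    case (elim x)
    then show ?case using r(2)[of x] unfolding s by (auto split: if_splits)
  qed
  then show ?thesis by (intro exI[of _ c])
qed

text \<open>At a non-vertex point of a cell, \<open>F\<close> has one value above and one below.
  Both are locally constant along the cell without its vertices, which is connected, so the jump
  depends on the cell alone.\<close>

lemma component_constant_jumps:
  fixes F :: "real ^ 2 \<Rightarrow> real ^ 2"
  assumes F: "\<And>x y. connected_component (- \<Union>S) x y \<Longrightarrow> F x = F y"
  shows "\<exists>j. potential F j"
proof -
  have two_sides: "\<exists>a l. \<forall>\<^sub>F x in nhds x0. (0 < ht \<sigma> x \<longrightarrow> F x = a) \<and> (ht \<sigma> x < 0 \<longrightarrow> F x = l)"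
    if s: "\<sigma> \<in> S" and "x0 \<in> \<sigma> - P" for \<sigma> x0
  proof -
    have m: "x0 \<in> \<sigma>" "x0 \<notin> P" using that by auto
    obtain r where r: "r > 0" "\<And>x x'. x \<in> ball x0 r \<Longrightarrow> x' \<in> ball x0 r \<Longrightarrow>
        ht \<sigma> x * ht \<sigma> x' > 0 \<Longrightarrow> connected_component (- \<Union>S) x x'"
      using sides_connected[OF s m] by blast
    have ev: "\<forall>\<^sub>F x in nhds x0. x \<in> ball x0 r" by (rule eventually_nhds_in_open) (use r in auto)
    note h = ht_on[OF s m(1)]
    obtain z where z: "z \<in> ball x0 r" "0 < ht \<sigma> z" using ht_generic(1)[OF s ev h] by auto
    obtain z' where z': "z' \<in> ball x0 r" "ht \<sigma> z' < 0" using ht_generic(2)[OF s ev h] by auto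
    from ev have "\<forall>\<^sub>F x in nhds x0. (0 < ht \<sigma> x \<longrightarrow> F x = F z) \<and> (ht \<sigma> x < 0 \<longrightarrow> F x = F z')"
    proof eventually_elim
      case (elim x)
      then show ?case using F r(2)[OF elim z(1)] r(2)[OF elim z'(1)] z z'
        by (simp add: mult_neg_neg)
    qed
    then show ?thesis by blast
  qed
  have "\<exists>J. \<forall>x0\<in>\<sigma> - P. \<exists>l. \<forall>\<^sub>F x in nhds x0. (0 < ht \<sigma> x \<longrightarrow> F x = l + J) \<and> (ht \<sigma> x < 0 \<longrightarrow> F x = l)"
    if s: "\<sigma> \<in> S" for \<sigma>
  proof -
    have "\<forall>x0\<in>\<sigma> - P. \<exists>q. \<forall>\<^sub>F x in nhds x0. (0 < ht \<sigma> x \<longrightarrow> F x = fst q) \<and> (ht \<sigma> x < 0 \<longrightarrow> F x = snd q)"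
      using two_sides[OF s] by simp
    from bchoice[OF this] obtain q where q: "\<forall>x0\<in>\<sigma> - P. \<forall>\<^sub>F x in nhds x0.
        (0 < ht \<sigma> x \<longrightarrow> F x = fst (q x0)) \<and> (ht \<sigma> x < 0 \<longrightarrow> F x = snd (q x0))"
      by (elim exE)
    \<comment> \<open>\<open>q\<close> pairs the values above and below. Neighbourhoods of two
      nearby cell points share generic points on either side, so the pairs agree.\<close>
    have loc: "\<forall>a\<in>\<sigma> - P. \<forall>\<^sub>F x in at a within \<sigma> - P. q a = q x"
    proof
      fix a assume a: "a \<in> \<sigma> - P"
      obtain V where V: "open V" "a \<in> V"
        "\<And>x. x \<in> V \<Longrightarrow> (0 < ht \<sigma> x \<longrightarrow> F x = fst (q a)) \<and> (ht \<sigma> x < 0 \<longrightarrow> F x = snd (q a))"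
        using bspec[OF q a] unfolding eventually_nhds by blast
      have "q a = q x" if x: "x \<in> V" "x \<in> \<sigma> - P" for x
      proof -
        have "\<forall>\<^sub>F z in nhds x. z \<in> V" by (rule eventually_nhds_in_open) (use V x in auto)
        with bspec[OF q x(2)] have ev: "\<forall>\<^sub>F z in nhds x. z \<in> V \<and>
          (0 < ht \<sigma> z \<longrightarrow> F z = fst (q x)) \<and> (ht \<sigma> z < 0 \<longrightarrow> F z = snd (q x))"
          by eventually_elim auto
        have h: "ht \<sigma> x = 0" using ht_on[OF s] x(2) by auto
        have "fst (q a) = fst (q x)" using ht_generic(1)[OF s ev h] V(3) by metis
        moreover have "snd (q a) = snd (q x)" using ht_generic(2)[OF s ev h] V(3) by metis
        ultimately show ?thesis by (simp add: prod_eq_iff)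
      qed
      then show "\<forall>\<^sub>F x in at a within \<sigma> - P. q a = q x"
        unfolding eventually_at_topological using V by blast
    qed
    obtain m where m: "m \<in> \<sigma> - P" using cell_avoid[OF s, of "{}"] by auto
    have "q x0 = q m" if "x0 \<in> \<sigma> - P" for x0
      using connected_local_const[OF connected_inner_cell[OF s] that m loc] .
    then have "\<forall>x0\<in>\<sigma> - P. \<exists>l. \<forall>\<^sub>F x in nhds x0.
        (0 < ht \<sigma> x \<longrightarrow> F x = l + (fst (q m) - snd (q m))) \<and> (ht \<sigma> x < 0 \<longrightarrow> F x = l)"
      using q by (intro ballI exI[of _ "snd (q m)"]) simp
    then show ?thesis by (intro exI[of _ "fst (q m) - snd (q m)"])
  qed
  then have "\<forall>\<sigma>\<in>S. \<exists>J. \<forall>x0\<in>\<sigma> - P. \<exists>l. \<forall>\<^sub>F x in nhds x0.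
      (0 < ht \<sigma> x \<longrightarrow> F x = l + J) \<and> (ht \<sigma> x < 0 \<longrightarrow> F x = l)" by simp
  from bchoice[OF this] obtain j where j: "\<forall>\<sigma>\<in>S. \<forall>x0\<in>\<sigma> - P. \<exists>l. \<forall>\<^sub>F x in nhds x0.
      (0 < ht \<sigma> x \<longrightarrow> F x = l + j \<sigma>) \<and> (ht \<sigma> x < 0 \<longrightarrow> F x = l)" by (elim exE)
  have "potential F j" unfolding potential_def
  proof (intro allI impI)
    fix x0 assume x0: "x0 \<notin> P"
    show "\<exists>c. \<forall>\<^sub>F x in nhds x0. x \<notin> \<Union>S \<longrightarrow>
       F x = c + (\<Sum>\<sigma> | \<sigma> \<in> S \<and> x0 \<in> \<sigma>. if 0 < ht \<sigma> x then j \<sigma> else 0)"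
    proof (cases "x0 \<in> \<Union>S")
      case True
      then obtain \<sigma> where s: "\<sigma> \<in> S" "x0 \<in> \<sigma>" by auto
      then obtain l where l: "\<forall>\<^sub>F x in nhds x0. (0 < ht \<sigma> x \<longrightarrow> F x = l + j \<sigma>) \<and> (ht \<sigma> x < 0 \<longrightarrow> F x = l)"
        using j x0 by blast
      obtain r where r: "r > 0" "\<And>x. x \<in> ball x0 r \<Longrightarrow> x \<in> \<Union>S \<longleftrightarrow> ht \<sigma> x = 0"
        using curve_near_cell_point[OF s x0] by auto
      have "\<forall>\<^sub>F x in nhds x0. x \<in> ball x0 r" by (rule eventually_nhds_in_open) (use r in auto)
      with l show ?thesis
        unfolding unique_cell[OF s x0]
      proof (intro exI[of _ l], eventually_elim)
        case (elim x)
        then show ?case using r(2)[of x] by (auto simp: not_less_iff_gr_or_eq)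
      qed
    next
      case False
      then have none: "{\<sigma>. \<sigma> \<in> S \<and> x0 \<in> \<sigma>} = {}" by auto
      have "open (- \<Union>S)" using closed_curve by auto
      then obtain r where r: "r > 0" "ball x0 r \<subseteq> - \<Union>S" using False open_contains_ball by blast
      have "F x = F x0" if "x \<in> ball x0 r" for x
        by (rule F) (use r that in \<open>auto simp: connected_component_def intro!: exI[of _ "ball x0 r"]\<close>)
      moreover have "\<forall>\<^sub>F x in nhds x0. x \<in> ball x0 r" by (rule eventually_nhds_in_open) (use r in auto)
      ultimately show ?thesis unfolding none
        by (intro exI[of _ "F x0"]) (auto elim!: eventually_mono)
    qed
  qed
  then show ?thesis by blast
qed

end


section \<open>Regions\<close>

text \<open>\<open>Z\<close> stands for the parameters where a segment meets the curve and
  \<open>g\<close> for a potential along it. All jumps go up, so equal end values leave room for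
  none. Bisection takes the place of listing the jumps in order.\<close>

lemma increasing_steps:
  fixes g :: "real \<Rightarrow> real"
  assumes local: "\<And>t. t \<in> {0..1} \<Longrightarrow> \<exists>l u. (if t \<in> Z then l < u else l = g t \<and> u = g t) \<and>
      (\<forall>\<^sub>F s in nhds t. (s < t \<longrightarrow> s \<notin> Z \<and> g s = l) \<and> (t < s \<longrightarrow> s \<notin> Z \<and> g s = u))"
    and ends: "0 \<notin> Z" "1 \<notin> Z" "g 0 = g 1"
  shows "Z \<inter> {0..1} = {}"
proof -
  have "\<forall>t\<in>{0..1}. \<exists>q. (if t \<in> Z then fst q < snd q else fst q = g t \<and> snd q = g t) \<and>
      (\<forall>\<^sub>F s in nhds t. (s < t \<longrightarrow> s \<notin> Z \<and> g s = fst q) \<and> (t < s \<longrightarrow> s \<notin> Z \<and> g s = snd q))"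
    unfolding split_paired_Ex fst_conv snd_conv using local by blast
  from bchoice[OF this] obtain q where q: "\<forall>t\<in>{0..1}. (if t \<in> Z then fst (q t) < snd (q t) else fst (q t) = g t \<and> snd (q t) = g t) \<and>
      (\<forall>\<^sub>F s in nhds t. (s < t \<longrightarrow> s \<notin> Z \<and> g s = fst (q t)) \<and> (t < s \<longrightarrow> s \<notin> Z \<and> g s = snd (q t)))"
    by (elim exE)
  define L U where "L t = fst (q t)" and "U t = snd (q t)" for t
  have on: "L t < U t" if "t \<in> Z" "t \<in> {0..1}" for t
    using bspec[OF q that(2)] that(1) by (simp add: L_def U_def)
  have off: "L t = g t" "U t = g t" if "t \<notin> Z" "t \<in> {0..1}" for t
    using bspec[OF q that(2)] that(1) by (simp_all add: L_def U_def)
  have LU: "L t \<le> U t" if "t \<in> {0..1}" for t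
    using on[OF _ that] off[OF _ that] by fastforce
  have near: "\<forall>\<^sub>F s in nhds t. (s < t \<longrightarrow> s \<notin> Z \<and> g s = L t) \<and> (t < s \<longrightarrow> s \<notin> Z \<and> g s = U t)"
    if "t \<in> {0..1}" for t
    using bspec[OF q that] by (simp add: L_def U_def)
  \<comment> \<open>Right limits together with intervals open on the left make \<open>Q\<close>
    transitive: a jump at the left end \<open>s\<close> is already contained in
    \<open>U s\<close>.\<close>
  define Q where "Q s t \<longleftrightarrow> (0 \<le> s \<longrightarrow> s \<le> t \<longrightarrow> t \<le> 1 \<longrightarrow> U s \<le> U t \<and> (Z \<inter> {s<..t} \<noteq> {} \<longrightarrow> U s < U t))"
    for s t
  have "(0 :: real) \<le> 1" by simp
  then have "Q 0 1"
  proof (induction rule: Bolzano)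
    case (trans a b c)
    have "{a<..c} = {a<..b} \<union> {b<..c}" using trans(3,4) by auto
    then have "Z \<inter> {a<..c} \<noteq> {} \<longleftrightarrow> Z \<inter> {a<..b} \<noteq> {} \<or> Z \<inter> {b<..c} \<noteq> {}" by auto
    then show ?case using trans unfolding Q_def by fastforce
  next
    case (local x)
    then have x: "x \<in> {0..1}" by simp
    obtain r where r: "r > 0" "\<And>s. dist s x < r \<Longrightarrow> (s < x \<longrightarrow> s \<notin> Z \<and> g s = L x) \<and> (x < s \<longrightarrow> s \<notin> Z \<and> g s = U x)"
      using near[OF x] unfolding eventually_nhds_metric by blast
    have "Q a b" if ab: "a \<le> x" "x \<le> b" "b - a < r" for a b
      unfolding Q_def
    proof (intro impI)
      assume 01: "0 \<le> a" "a \<le> b" "b \<le> 1"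
      have d: "dist s x < r" if "a \<le> s" "s \<le> b" for s
        using that ab by (auto simp: dist_real_def)
      have Ub: "U b = U x"
        using r(2)[of b] d[of b] off(2)[of b] ab 01 by (cases "b = x") auto
      have Ua: "U a = (if a = x then U x else L x)"
        using r(2)[of a] d[of a] off(2)[of a] ab 01 by (cases "a = x") auto
      have zx: "s = x" if "s \<in> Z" "s \<in> {a<..b}" for s
        using r(2)[of s] d[of s] that by (cases s x rule: linorder_cases) auto
      show "U a \<le> U b \<and> (Z \<inter> {a<..b} \<noteq> {} \<longrightarrow> U a < U b)"
        using Ua Ub LU[OF x] on[OF _ x] zx by fastforce
    qed
    then show ?case using r(1) by blast
  qed
  then have "Z \<inter> {0<..1} = {}"
    using off(2)[of 0] off(2)[of 1] ends by (auto simp: Q_def)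
  moreover have "{0..1::real} = insert 0 {0<..1}" by auto
  ultimately show ?thesis using ends by auto
qed

context planar_curve
begin

section \<open>Components of the complement and their closures\<close>

abbreviation component :: "real ^ 2 \<Rightarrow> (real ^ 2) set" where
  "component x \<equiv> connected_component_set (- \<Union>S) x"

definition region :: "real ^ 2 \<Rightarrow> (real ^ 2) set" where
  "region x = closure (component x)"

lemma open_component: "open (component x)"
  using closed_curve by (intro open_connected_component) auto

lemma curve_regions_iff: "v \<in> curve_regions (\<Union>S) \<longleftrightarrow> (\<exists>a. a \<notin> \<Union>S \<and> v = region a)"
  unfolding curve_regions_def components_def region_def by auto

lemma component_self: "x \<notin> \<Union>S \<Longrightarrow> x \<in> component x"
  by (simp add: connected_component_refl)

lemma region_cong: "connected_component (- \<Union>S) x y \<Longrightarrow> region x = region y"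
  unfolding region_def by (metis connected_component_eq mem_Collect_eq)

text \<open>An open component disjoint from another one is also disjoint from its closure. So
  closures add only points of the curve, and passing to regions merges no components.\<close>

lemma in_region_connected:
  assumes "x \<notin> \<Union>S" "x \<in> region y"
  shows "connected_component (- \<Union>S) y x"
proof -
  have "component x \<inter> component y \<noteq> {}"
    using open_Int_closure_eq_empty[OF open_component] component_self[OF assms(1)] assms(2)
    unfolding region_def by blast
  then have "component x = component y"
    by (meson connected_component_nonoverlap)
  then show ?thesis using component_self[OF assms(1)] by simp
qed

lemma region_eq_iff:
  assumes "x \<notin> \<Union>S"
  shows "region x = region y \<longleftrightarrow> connected_component (- \<Union>S) y x"
proof
  assume "region x = region y"
  moreover have "x \<in> region x"
    unfolding region_def by (rule subsetD[OF closure_subset component_self[OF assms]])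
  ultimately show "connected_component (- \<Union>S) y x" using in_region_connected[OF assms] by simp
qed (use region_cong in metis)

lemma regions_meet_in_curve:
  assumes "region x \<noteq> region y"
  shows "region x \<inter> region y \<subseteq> \<Union>S"
proof
  fix u assume "u \<in> region x \<inter> region y"
  then have u: "u \<in> region x" "u \<in> region y" by auto
  show "u \<in> \<Union>S"
  proof (rule ccontr)
    assume "u \<notin> \<Union>S"
    then show False
      using region_cong[OF in_region_connected[OF _ u(1)]] region_cong[OF in_region_connected[OF _ u(2)]]
        assms by simp
  qed
qed

definition positive_jumps :: "((real ^ 2) set \<Rightarrow> real ^ 2) \<Rightarrow> bool" where
  "positive_jumps j \<longleftrightarrow> (\<forall>\<sigma>\<in>S. \<exists>k>0. j \<sigma> = k *\<^sub>R rot (d \<sigma>))"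

text \<open>Each crossing of a cell increases the component of \<open>F\<close> in the direction of travel.\<close>

lemma segment_avoids_curve:
  assumes pot: "potential F j" and pos: "positive_jumps j"
    and con: "connected_component (- \<Union>S) p q"
    and off_lines: "\<And>\<sigma>. \<sigma> \<in> S \<Longrightarrow> ht \<sigma> p \<noteq> 0" and off_P: "closed_segment p q \<inter> P = {}"
  shows "closed_segment p q \<inter> \<Union>S = {}"
proof -
  define \<gamma> where "\<gamma> t = p + t *\<^sub>R (q - p)" for t :: real
  define g where "g t = F (\<gamma> t) \<bullet> (q - p)" for t
  define Z where "Z = {t. \<gamma> t \<in> \<Union>S}"
  have "\<gamma> = (\<lambda>t. (1 - t) *\<^sub>R p + t *\<^sub>R q)" by (auto simp: \<gamma>_def algebra_simps)
  then have seg: "closed_segment p q = \<gamma> ` {0..1}" by (simp add: closed_segment_image_interval)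
  have tend: "(\<gamma> \<longlongrightarrow> \<gamma> t) (nhds t)" for t
    unfolding \<gamma>_def by (intro tendsto_intros) (simp add: filterlim_ident)
  have ev\<gamma>: "\<forall>\<^sub>F s in nhds t. R (\<gamma> s)" if "\<forall>\<^sub>F x in nhds (\<gamma> t). R x" for R t
    using tend that unfolding filterlim_iff by blast
  have "Z \<inter> {0..1} = {}"
  proof (rule increasing_steps)
    fix t :: real assume t: "t \<in> {0..1}"
    show "\<exists>l u. (if t \<in> Z then l < u else l = g t \<and> u = g t) \<and>
      (\<forall>\<^sub>F s in nhds t. (s < t \<longrightarrow> s \<notin> Z \<and> g s = l) \<and> (t < s \<longrightarrow> s \<notin> Z \<and> g s = u))"
    proof (cases "t \<in> Z")
      case False
      then have nin: "\<gamma> t \<notin> \<Union>S" by (simp add: Z_def)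
      from potential_locally_constant[OF pot nin] obtain c
        where c: "\<forall>\<^sub>F x in nhds (\<gamma> t). x \<notin> \<Union>S \<longrightarrow> F x = c" by (elim exE)
      have cF: "c = F (\<gamma> t)" using eventually_nhds_x_imp_x[OF c] nin by simp
      have "\<forall>\<^sub>F x in nhds (\<gamma> t). x \<in> - \<Union>S"
        by (rule eventually_nhds_in_open) (use closed_curve nin in auto)
      with c have "\<forall>\<^sub>F x in nhds (\<gamma> t). x \<notin> \<Union>S \<and> F x = F (\<gamma> t)"
        unfolding cF by eventually_elim auto
      from ev\<gamma>[OF this] have "\<forall>\<^sub>F s in nhds t. (s < t \<longrightarrow> s \<notin> Z \<and> g s = g t) \<and> (t < s \<longrightarrow> s \<notin> Z \<and> g s = g t)"
        by eventually_elim (simp add: Z_def g_def)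
      then show ?thesis using False by (intro exI[of _ "g t"]) simp
    next
      case True
      then obtain \<sigma> where s: "\<sigma> \<in> S" "\<gamma> t \<in> \<sigma>" by (auto simp: Z_def)
      have nP: "\<gamma> t \<notin> P" using off_P t unfolding seg by blast
      define m where "m = rot (d \<sigma>) \<bullet> (q - p)"
      have h: "ht \<sigma> (\<gamma> s) = ht \<sigma> p + s * m" for s
        by (simp add: ht_def \<gamma>_def m_def inner_add_right inner_diff_right algebra_simps)
      have "ht \<sigma> p + t * m = 0" using h[of t] ht_on[OF s] by simp
      then have h': "ht \<sigma> (\<gamma> s) = (s - t) * m" for s unfolding h by (simp add: algebra_simps)
      \<comment> \<open>Transversality: if \<open>m\<close> were 0, the height would vanish along
        the whole segment, but \<open>p\<close> is on no line carrying a cell.\<close>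
      have m0: "m \<noteq> 0" using h'[of 0] off_lines[OF s(1)] by (auto simp: \<gamma>_def)
      obtain k where k: "k > 0" "j \<sigma> = k *\<^sub>R rot (d \<sigma>)" using pos s(1) unfolding positive_jumps_def by blast
      have jm: "j \<sigma> \<bullet> (q - p) = k * m" by (simp add: k m_def)
      from potential_jump[OF pot s nP] obtain c
        where c: "\<forall>\<^sub>F x in nhds (\<gamma> t). (0 < ht \<sigma> x \<longrightarrow> F x = c + j \<sigma>) \<and> (ht \<sigma> x < 0 \<longrightarrow> F x = c)"
        by (elim exE)
      obtain r where r: "r > 0" "\<And>x. x \<in> ball (\<gamma> t) r \<Longrightarrow> x \<in> \<Union>S \<longleftrightarrow> ht \<sigma> x = 0"
        using curve_near_cell_point[OF s nP] by auto
      have "\<forall>\<^sub>F x in nhds (\<gamma> t). x \<in> ball (\<gamma> t) r" by (rule eventually_nhds_in_open) (use r in auto)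
      with c have "\<forall>\<^sub>F x in nhds (\<gamma> t). (0 < ht \<sigma> x \<longrightarrow> x \<notin> \<Union>S \<and> F x = c + j \<sigma>) \<and>
          (ht \<sigma> x < 0 \<longrightarrow> x \<notin> \<Union>S \<and> F x = c)"
      proof eventually_elim
        case (elim x)
        then show ?case using r(2)[of x] by (metis less_irrefl)
      qed
      from ev\<gamma>[OF this] have ev: "\<forall>\<^sub>F s in nhds t. (0 < (s - t) * m \<longrightarrow> s \<notin> Z \<and> g s = (c + j \<sigma>) \<bullet> (q - p)) \<and>
          ((s - t) * m < 0 \<longrightarrow> s \<notin> Z \<and> g s = c \<bullet> (q - p))"
        unfolding h' by eventually_elim (simp add: Z_def g_def)
      have cj: "(c + j \<sigma>) \<bullet> (q - p) = c \<bullet> (q - p) + k * m" by (simp add: inner_add_left jm)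
      show ?thesis
      proof (cases "m > 0")
        case m: True
        from ev have "\<forall>\<^sub>F s in nhds t. (s < t \<longrightarrow> s \<notin> Z \<and> g s = c \<bullet> (q - p)) \<and>
            (t < s \<longrightarrow> s \<notin> Z \<and> g s = c \<bullet> (q - p) + k * m)"
          by eventually_elim (use m cj in \<open>simp add: mult_neg_pos\<close>)
        moreover have "c \<bullet> (q - p) < c \<bullet> (q - p) + k * m" using k m by simp
        ultimately show ?thesis using True
          by (intro exI[of _ "c \<bullet> (q - p)"] exI[of _ "c \<bullet> (q - p) + k * m"]) simp
      next
        \<comment> \<open>A downward crossing swaps the sides and reverses the sign of
          \<open>m\<close>, so \<open>g\<close> increases again.\<close>
        case False
        then have m: "m < 0" using m0 by simp
        from ev have "\<forall>\<^sub>F s in nhds t. (s < t \<longrightarrow> s \<notin> Z \<and> g s = c \<bullet> (q - p) + k * m) \<and>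
            (t < s \<longrightarrow> s \<notin> Z \<and> g s = c \<bullet> (q - p))"
          by eventually_elim (use m cj in \<open>simp add: mult_neg_neg mult_pos_neg\<close>)
        moreover have "c \<bullet> (q - p) + k * m < c \<bullet> (q - p)" using k m by (simp add: mult_pos_neg)
        ultimately show ?thesis using True
          by (intro exI[of _ "c \<bullet> (q - p) + k * m"] exI[of _ "c \<bullet> (q - p)"]) simp
      qed
    qed
  next
    show "0 \<notin> Z" "1 \<notin> Z" using connected_component_in[OF con] by (simp_all add: Z_def \<gamma>_def)
    show "g 0 = g 1" using potential_component_constant[OF pot con] by (simp add: g_def \<gamma>_def)
  qed
  then show ?thesis unfolding seg by (auto simp: Z_def)
qed

text \<open>Points of the region are limits of points in its component, and for generic such points
  the joining segment misses the curve. They are perturbed in turn: \<open>p'\<close> off the lines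
  of the cells, then \<open>q'\<close> off the lines through \<open>p'\<close> and a vertex.\<close>

lemma convex_region:
  assumes pot: "potential F j" and pos: "positive_jumps j"
  shows "convex (region x)"
proof (rule convexI)
  fix p q :: "real ^ 2" and u v :: real
  assume pq: "p \<in> region x" "q \<in> region x" and uv: "0 \<le> u" "0 \<le> v" "u + v = 1"
  show "u *\<^sub>R p + v *\<^sub>R q \<in> region x"
    unfolding region_def closure_approachable
  proof (intro allI impI)
    fix r :: real assume r: "r > 0"
    have meets: "ball m r \<inter> component x \<noteq> {}" if "m \<in> region x" for m
    proof -
      have "m \<in> ball m r \<inter> closure (component x)" using that r by (simp add: region_def)
      then show ?thesis using open_Int_closure_eq_empty[OF open_ball, of m r "component x"] by blast
    qed
    have op: "open (ball m r \<inter> component x)" for m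
      by (intro open_Int open_ball open_component)
    obtain p' where p': "p' \<in> ball p r" "p' \<in> component x" "\<forall>\<sigma>\<in>S. rot (d \<sigma>) \<bullet> p' \<noteq> rot (d \<sigma>) \<bullet> b \<sigma>"
      using avoid_hyperplanes[of "ball p r \<inter> component x" S "\<lambda>\<sigma>. rot (d \<sigma>)" "\<lambda>\<sigma>. rot (d \<sigma>) \<bullet> b \<sigma>"]
        op[of p] finite_S d_nonzero meets[OF pq(1)] by auto
    have p'C: "p' \<notin> \<Union>S" using p'(2) connected_component_subset by blast
    \<comment> \<open>Vertices lie on the curve and \<open>p'\<close> does not, so these normals
      define genuine lines.\<close>
    have "rot (y - p') \<noteq> 0" if "y \<in> P" for y using that p'C vertices_in by auto
    then obtain q' where q': "q' \<in> ball q r" "q' \<in> component x" "\<forall>y\<in>P. rot (y - p') \<bullet> q' \<noteq> rot (y - p') \<bullet> p'"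
      using avoid_hyperplanes[of "ball q r \<inter> component x" P "\<lambda>y. rot (y - p')" "\<lambda>y. rot (y - p') \<bullet> p'"]
        op[of q] finite_P meets[OF pq(2)] by auto
    have "y \<notin> closed_segment p' q'" if y: "y \<in> P" for y
    proof
      assume "y \<in> closed_segment p' q'"
      then obtain s where "y = (1 - s) *\<^sub>R p' + s *\<^sub>R q'" by (auto simp: in_segment)
      then have "y - p' = s *\<^sub>R (q' - p')" by (simp add: algebra_simps)
      then have "rot (y - p') \<bullet> (q' - p') = 0" by (simp only: rot_linear_simps(3)) simp
      then show False using q'(3) y by (simp add: inner_diff_right)
    qed
    moreover have con: "connected_component (- \<Union>S) p' q'"
      using p'(2) q'(2) by (metis connected_component_eq mem_Collect_eq)
    ultimately have "closed_segment p' q' \<inter> \<Union>S = {}"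
      using p'(3) by (intro segment_avoids_curve[OF pot pos]) (auto simp: ht_def inner_diff_right)
    then have "closed_segment p' q' \<subseteq> component p'"
      by (intro connected_component_maximal) auto
    then have "closed_segment p' q' \<subseteq> component x"
      using p'(2) connected_component_eq by blast
    moreover have "u *\<^sub>R p' + v *\<^sub>R q' \<in> closed_segment p' q'"
      using uv by (auto simp: closed_segment_def intro!: exI[of _ v])
    moreover have "dist (u *\<^sub>R p' + v *\<^sub>R q') (u *\<^sub>R p + v *\<^sub>R q) < r"
    proof -
      have "dist (u *\<^sub>R p' + v *\<^sub>R q') (u *\<^sub>R p + v *\<^sub>R q) \<le> dist (u *\<^sub>R p') (u *\<^sub>R p) + dist (v *\<^sub>R q') (v *\<^sub>R q)"
        by (rule dist_triangle_add)
      also have "\<dots> = u * dist p' p + v * dist q' q"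
        using uv by (simp add: dist_norm flip: scaleR_diff_right)
      also have "\<dots> < r"
        by (rule convex_bound_lt) (use p' q' uv in \<open>auto simp: dist_commute\<close>)
      finally show ?thesis .
    qed
    ultimately show "\<exists>y\<in>component x. dist y (u *\<^sub>R p + v *\<^sub>R q) < r" by blast
  qed
qed

text \<open>The nonzero jump separates the two sides of the cell. Their closures share a piece of
  the cell, so the intersection has affine dimension at least 1; it is convex and inside the curve,
  which has empty interior, so the dimension is not 2.\<close>

lemma two_regions:
  assumes pot: "potential F j" and pos: "positive_jumps j"
    and s: "\<sigma> \<in> S" "x0 \<in> \<sigma>" "x0 \<notin> P"
  shows "\<exists>v w. v \<in> curve_regions (\<Union>S) \<and> w \<in> curve_regions (\<Union>S) \<and> v \<noteq> w \<and>
    v \<inter> w \<in> curve_edges (\<Union>S) \<and> d \<sigma> \<in> direction_space (v \<inter> w) \<and>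
    (\<forall>\<^sub>F x in nhds x0. (0 < ht \<sigma> x \<longrightarrow> region x = v) \<and> (ht \<sigma> x < 0 \<longrightarrow> region x = w))"
proof -
  obtain r where r: "r > 0" and con: "\<And>x x'. x \<in> ball x0 r \<Longrightarrow> x' \<in> ball x0 r \<Longrightarrow>
      ht \<sigma> x * ht \<sigma> x' > 0 \<Longrightarrow> connected_component (- \<Union>S) x x'"
    using sides_connected[OF s] by blast
  from potential_jump[OF pot s] obtain c
    where c: "\<forall>\<^sub>F x in nhds x0. (0 < ht \<sigma> x \<longrightarrow> F x = c + j \<sigma>) \<and> (ht \<sigma> x < 0 \<longrightarrow> F x = c)"
    by (elim exE)
  have ball: "\<forall>\<^sub>F x in nhds x0. x \<in> ball x0 r" by (rule eventually_nhds_in_open) (use r in auto)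
  note ev = eventually_conj[OF c ball]
  note h0 = ht_on[OF s(1,2)]
  obtain z where z: "z \<in> ball x0 r" "0 < ht \<sigma> z" "z \<notin> \<Union>S" "F z = c + j \<sigma>"
    using ht_generic(1)[OF s(1) ev h0] by blast
  obtain z' where z': "z' \<in> ball x0 r" "ht \<sigma> z' < 0" "z' \<notin> \<Union>S" "F z' = c"
    using ht_generic(2)[OF s(1) ev h0] by blast
  have "j \<sigma> \<noteq> 0" using pos s(1) d_nonzero[OF s(1)] unfolding positive_jumps_def by fastforce
  then have "F z' \<noteq> F z" using z z' by simp
  then have ne: "region z \<noteq> region z'"
    using region_eq_iff[OF z(3)] potential_component_constant[OF pot] by metis
  have near: "\<forall>\<^sub>F x in nhds x0. (0 < ht \<sigma> x \<longrightarrow> region x = region z) \<and> (ht \<sigma> x < 0 \<longrightarrow> region x = region z')"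
    using ball
  proof eventually_elim
    case (elim x)
    then show ?case using con[OF elim z(1)] con[OF elim z'(1)] z z' region_cong
      by (simp add: mult_neg_neg)
  qed
  have touch: "m \<in> region z \<inter> region z'" if m: "m \<in> \<sigma>" "m \<in> ball x0 r" for m
  proof -
    have "m \<in> closure (component z) \<and> m \<in> closure (component z')"
      unfolding closure_approachable
    proof (intro conjI allI impI)
      fix q :: real assume q: "q > 0"
      have evm: "\<forall>\<^sub>F x in nhds m. x \<in> ball x0 r \<inter> ball m q"
        by (rule eventually_nhds_in_open) (use m q in auto)
      note hm = ht_on[OF s(1) m(1)]
      obtain x where "x \<in> ball x0 r \<inter> ball m q" "0 < ht \<sigma> x"
        using ht_generic(1)[OF s(1) evm hm] by blast
      then show "\<exists>y\<in>component z. dist y m < q"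
        using con[OF z(1), of x] z by (auto simp: dist_commute)
      obtain x where "x \<in> ball x0 r \<inter> ball m q" "ht \<sigma> x < 0"
        using ht_generic(2)[OF s(1) evm hm] by blast
      then show "\<exists>y\<in>component z'. dist y m < q"
        using con[OF z'(1), of x] z' by (auto simp: dist_commute mult_neg_neg)
    qed
    then show ?thesis by (simp add: region_def)
  qed
  obtain u where u: "u \<in> \<sigma>" "e \<bullet> u < e \<bullet> x0" using inner_cell_neighbours[OF s] by auto
  \<comment> \<open>The step from \<open>x0\<close> towards \<open>u\<close> is shortened to at most
    \<open>r / 2\<close>, and \<open>\<theta> \<le> 1\<close> keeps it in the cell. This gives a
    second common point \<open>m\<close> of both regions, hence the direction of the cell.\<close>
  define \<theta> where "\<theta> = min 1 (r / (2 * norm (u - x0)))"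
  have ux: "norm (u - x0) > 0" using u by auto
  have \<theta>: "0 < \<theta>" "\<theta> \<le> 1" using r ux by (auto simp: \<theta>_def)
  define m where "m = (1 - \<theta>) *\<^sub>R x0 + \<theta> *\<^sub>R u"
  have mdiff: "m - x0 = \<theta> *\<^sub>R (u - x0)" by (simp add: m_def algebra_simps)
  have "m \<in> \<sigma>" unfolding m_def using convex_cell[OF s(1)] s(2) u(1) \<theta> by (intro convexD) auto
  have "norm (m - x0) \<le> r / 2"
  proof -
    have "\<theta> * norm (u - x0) \<le> (r / (2 * norm (u - x0))) * norm (u - x0)"
      using ux by (intro mult_right_mono) (auto simp: \<theta>_def)
    then show ?thesis using ux \<theta> by (simp add: mdiff)
  qed
  then have "m \<in> ball x0 r" using r by (simp add: dist_norm norm_minus_commute)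
  have "m \<noteq> x0" using mdiff \<theta> ux by auto
  have mm: "m \<in> region z \<inter> region z'" "x0 \<in> region z \<inter> region z'"
    using touch[of m] touch[of x0] \<open>m \<in> \<sigma>\<close> \<open>m \<in> ball x0 r\<close> s(2) r by auto
  have ad1: "1 \<le> aff_dim (region z \<inter> region z')"
    using aff_dim_subset[of "{m, x0}" "region z \<inter> region z'"] mm \<open>m \<noteq> x0\<close> by (simp add: aff_dim_2)
  have cvx: "convex (region z \<inter> region z')"
    by (intro convex_Int convex_region[OF pot pos])
  have "interior (region z \<inter> region z') = {}"
    using interior_mono[OF regions_meet_in_curve[OF ne]] interior_curve by auto
  then have "aff_dim (region z \<inter> region z') \<noteq> 2"
    using rel_interior_eq_empty[OF cvx] mm(1) interior_rel_interior_gen[of "region z \<inter> region z'"] by auto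
  moreover have "aff_dim (region z \<inter> region z') \<le> 2"
    using aff_dim_le_DIM[of "region z \<inter> region z'"] by simp
  ultimately have ad: "aff_dim (region z \<inter> region z') = 1" using ad1 by linarith
  have "ht \<sigma> m = 0" "ht \<sigma> x0 = 0" using ht_on[OF s(1)] \<open>m \<in> \<sigma>\<close> s(2) by auto
  then have "rot (d \<sigma>) \<bullet> (m - x0) = 0" using ht_diff[of \<sigma> m x0] by simp
  then obtain k where k: "m - x0 = k *\<^sub>R d \<sigma>" using perp_rot_imp_multiple[OF d_nonzero[OF s(1)]] by blast
  have "k \<noteq> 0" using k \<open>m \<noteq> x0\<close> by auto
  then have dk: "d \<sigma> = (1 / k) *\<^sub>R (m - x0)" using k by simp
  have "d \<sigma> \<in> direction_space (region z \<inter> region z')"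
    unfolding direction_space_def dk using mm by (intro span_scale span_base) blast
  moreover have rz: "region z \<in> curve_regions (\<Union>S)" "region z' \<in> curve_regions (\<Union>S)"
    using z(3) z'(3) curve_regions_iff by auto
  moreover have "region z \<inter> region z' \<in> curve_edges (\<Union>S)"
    unfolding curve_edges_def using rz ne ad by blast
  ultimately show ?thesis using ne near
    by (intro exI[of _ "region z"] exI[of _ "region z'"]) simp
qed

text \<open>The intersection of two regions is convex and has more than one point, so it is
  uncountable and contains a point outside the finite sets \<open>P\<close> and \<open>Q\<close>.
  That point is on the curve, and only two regions come near it. Which of \<open>v\<close> and
  \<open>w\<close> lies above is not determined, hence the disjunction.\<close>

lemma dual_edge_location:
  assumes pot: "potential F j" and pos: "positive_jumps j"
    and v: "v \<in> curve_regions (\<Union>S)" and w: "w \<in> curve_regions (\<Union>S)"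
    and vw: "{v, w} \<in> snd (dual_graph (\<Union>S))" and Q: "finite Q"
  shows "\<exists>\<sigma>\<in>S. \<exists>x0\<in>\<sigma>. x0 \<notin> P \<and> x0 \<notin> Q \<and>
    ((\<forall>\<^sub>F x in nhds x0. (0 < ht \<sigma> x \<longrightarrow> region x = v) \<and> (ht \<sigma> x < 0 \<longrightarrow> region x = w)) \<or>
     (\<forall>\<^sub>F x in nhds x0. (0 < ht \<sigma> x \<longrightarrow> region x = w) \<and> (ht \<sigma> x < 0 \<longrightarrow> region x = v)))"
proof -
  have "\<exists>v1 w1. {v, w} = {v1, w1} \<and> v1 \<noteq> w1 \<and> v1 \<inter> w1 \<in> curve_edges (\<Union>S)"
    using vw unfolding dual_graph_def snd_conv mem_Collect_eq by (elim exE conjE) (intro exI conjI)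
  then obtain v1 w1 where vw1: "{v, w} = {v1, w1}" "v1 \<noteq> w1" "v1 \<inter> w1 \<in> curve_edges (\<Union>S)"
    by (elim exE conjE)
  have int: "v \<inter> w = v1 \<inter> w1"
    using arg_cong[OF vw1(1), of Inter] by simp
  have ne: "v \<noteq> w" using vw1(1,2) by (auto simp: doubleton_eq_iff)
  have edge: "v \<inter> w \<in> curve_edges (\<Union>S)" unfolding int by (rule vw1(3))
  from edge have ad: "aff_dim (v \<inter> w) = 1"
    unfolding curve_edges_def mem_Collect_eq by (elim exE conjE) (simp only:)
  obtain p q where pq: "p \<notin> \<Union>S" "v = region p" "q \<notin> \<Union>S" "w = region q"
    using v w curve_regions_iff by metis
  have cvx: "convex (v \<inter> w)" unfolding pq by (intro convex_Int convex_region[OF pot pos])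
  have "v \<inter> w \<noteq> {}" using ad by auto
  then obtain m where m: "m \<in> v \<inter> w" by auto
  have "v \<inter> w \<noteq> {m}" using ad by auto
  then obtain m' where m': "m' \<in> v \<inter> w" "m' \<noteq> m" using m by blast
  have "uncountable (v \<inter> w)" using uncountable_convex[OF cvx m m'(1)] m'(2) by simp
  moreover have "countable (P \<union> Q)" using Q finite_P by (simp add: countable_finite)
  ultimately have "\<not> v \<inter> w \<subseteq> P \<union> Q" using countable_subset by blast
  then obtain x0 where x0: "x0 \<in> v" "x0 \<in> w" "x0 \<notin> P" "x0 \<notin> Q" by auto
  have "x0 \<in> \<Union>S" using regions_meet_in_curve ne x0 unfolding pq by blast
  then obtain \<sigma> where s: "\<sigma> \<in> S" "x0 \<in> \<sigma>" by auto
  from two_regions[OF pot pos s x0(3)] have "\<exists>v2 w2. \<forall>\<^sub>F x in nhds x0.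
    (0 < ht \<sigma> x \<longrightarrow> region x = v2) \<and> (ht \<sigma> x < 0 \<longrightarrow> region x = w2)" by meson
  then obtain v2 w2 where ev:
    "\<forall>\<^sub>F x in nhds x0. (0 < ht \<sigma> x \<longrightarrow> region x = v2) \<and> (ht \<sigma> x < 0 \<longrightarrow> region x = w2)"
    by (elim exE)
  obtain r where r: "r > 0" "\<And>x. x \<in> ball x0 r \<Longrightarrow> x \<in> \<Union>S \<longleftrightarrow> ht \<sigma> x = 0"
    using curve_near_cell_point[OF s x0(3)] by auto
  have "\<forall>\<^sub>F x in nhds x0. x \<in> ball x0 r" by (rule eventually_nhds_in_open) (use r in auto)
  with ev have "\<forall>\<^sub>F x in nhds x0. x \<notin> \<Union>S \<longrightarrow> region x = v2 \<or> region x = w2"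
  proof eventually_elim
    case (elim x)
    then show ?case using r(2)[of x] by (metis linorder_neqE)
  qed
  then obtain V where V: "open V" "x0 \<in> V" "\<And>x. x \<in> V \<Longrightarrow> x \<notin> \<Union>S \<Longrightarrow> region x = v2 \<or> region x = w2"
    unfolding eventually_nhds by blast
  have side: "region a = v2 \<or> region a = w2" if a: "a \<notin> \<Union>S" "x0 \<in> region a" for a
  proof -
    have "V \<inter> component a \<noteq> {}"
      using open_Int_closure_eq_empty[OF V(1), of "component a"] V(2) a(2) unfolding region_def by blast
    then obtain x where x: "x \<in> V" "connected_component (- \<Union>S) a x" by auto
    then show ?thesis using V(3)[of x] region_cong[OF x(2)] connected_component_in[OF x(2)] by auto
  qed
  have "(v = v2 \<and> w = w2) \<or> (v = w2 \<and> w = v2)"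
    using side[of p] side[of q] pq x0 ne by auto
  then show ?thesis using ev s x0 by blast
qed

end


section \<open>Flexes from subcurves\<close>

lemma skew_matrix_rot:
  fixes M :: "real ^ 2 ^ 2"
  assumes "transpose M = - M"
  shows "\<exists>\<mu>. \<forall>x. M *v x = \<mu> *\<^sub>R rot x"
proof -
  have sk: "M $ j $ i = - (M $ i $ j)" for i j
    using arg_cong[OF assms, of "\<lambda>A. A $ i $ j"] by (simp add: transpose_def)
  have "M $ 1 $ 1 = 0" "M $ 2 $ 2 = 0" "M $ 1 $ 2 = - (M $ 2 $ 1)"
    using sk[of 1 1] sk[of 2 2] sk[of 1 2] by auto
  then have "M *v x = (M $ 2 $ 1) *\<^sub>R rot x" for x
    by (simp add: vec_eq_iff forall_2 matrix_vector_mult_def sum_2)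
  then show ?thesis by blast
qed

section \<open>From one-dimensional complexes to planar curves\<close>

lemma max_cells_cover:
  assumes "polyhedral_complex X" "pure_complex X"
  shows "\<Union>(max_cells X) = \<Union>X"
proof
  show "\<Union>X \<subseteq> \<Union>(max_cells X)"
  proof
    fix x assume "x \<in> \<Union>X"
    then obtain \<rho> where r: "\<rho> \<in> X" "x \<in> \<rho>" by auto
    have "finite X" using assms(1) by (simp add: polyhedral_complex_def)
    then have "aff_dim \<rho> \<le> complex_dim X"
      unfolding complex_dim_def using r(1) by (intro Max_ge) simp_all
    then consider "\<rho> \<in> max_cells X" | "aff_dim \<rho> < complex_dim X"
      unfolding max_cells_def using r(1) by fastforce
    then show "x \<in> \<Union>(max_cells X)"
    proof cases
      case 2
      then obtain \<sigma> where "\<sigma> \<in> max_cells X" "\<rho> face_of \<sigma>"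
        using assms(2) r unfolding pure_complex_def by blast
      then show ?thesis using r face_of_imp_subset by blast
    qed (use r in auto)
  qed
qed (auto simp: max_cells_def)

lemma direction_space_singleton: "direction_space {y} = {0}"
proof -
  have "{x - y' | x y'. x \<in> {y} \<and> y' \<in> {y}} = {0}" by auto
  then show ?thesis by (simp add: direction_space_def)
qed

lemma cell_lattice_singleton: "cell_lattice {y} = {0}"
  by (auto simp: cell_lattice_def direction_space_singleton integer_vectors_def)

lemma lattice_normal_vertex:
  assumes "lattice_normal {y} \<sigma> z"
  shows "cell_lattice \<sigma> = {of_int m *\<^sub>R z | m. True}" "\<exists>c>0. y + c *\<^sub>R z \<in> \<sigma>"
  using assms unfolding lattice_normal_def by (simp_all add: cell_lattice_singleton)

text \<open>Both vectors generate the same lattice of rank 1, so they agree up to sign. This allows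
  a single vector \<open>d \<sigma>\<close> to serve both ends of a cell.\<close>

lemma lattice_normal_unique:
  assumes "lattice_normal {y} \<sigma> z" "lattice_normal {y'} \<sigma> z'" "z \<noteq> 0"
  shows "z' = z \<or> z' = - z"
proof -
  note in_lattice = conjunct1[OF assms(1)[unfolded lattice_normal_def]]
    conjunct1[OF assms(2)[unfolded lattice_normal_def]]
  then obtain m m' where m: "z = of_int m *\<^sub>R z'" and m': "z' = of_int m' *\<^sub>R z"
    using in_lattice[unfolded lattice_normal_vertex(1)[OF assms(1)]]
      in_lattice[unfolded lattice_normal_vertex(1)[OF assms(2)]] by blast
  have "(real_of_int m * of_int m') *\<^sub>R z = 1 *\<^sub>R z" using m m' by simp
  then have "real_of_int (m * m') = 1" using assms(3) by (simp only: scaleR_cancel_right of_int_mult) auto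
  then have "m * m' = 1" by linarith
  then have "m' = 1 \<or> m' = - 1" using zmult_eq_1_iff by auto
  then show ?thesis using m' by auto
qed

text \<open>Up to sign, \<open>d \<sigma>\<close> is the lattice vector at a vertex of the cell.
  Closure under faces makes the vertices of the complex on a cell exactly its extreme points, and
  \<open>e\<close> is generic so that no cell is vertical.\<close>

lemma planar_curve_of_complex:
  fixes X :: "(real ^ 2) set set"
  assumes X: "polyhedral_complex X" and dim: "complex_dim X = 1"
    and pure: "pure_complex X" and rat: "rational_complex X"
    and z: "\<And>\<tau> \<sigma>. \<tau> \<in> ridges X \<Longrightarrow> \<sigma> \<in> max_cells X \<Longrightarrow> \<tau> \<subset> \<sigma> \<Longrightarrow> lattice_normal \<tau> \<sigma> (z \<tau> \<sigma>)"
  shows "\<exists>d b e. planar_curve (max_cells X) {y. {y} \<in> X} d b e \<and>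
    (\<forall>\<sigma>\<in>max_cells X. \<forall>y\<in>\<sigma>. {y} \<in> X \<longrightarrow> z {y} \<sigma> = planar_curve.side e \<sigma> y *\<^sub>R d \<sigma>)"
proof -
  let ?S = "max_cells X" and ?P = "{y. {y} \<in> X}"
  have cell: "\<sigma> \<in> X" "polyhedron \<sigma>" "aff_dim \<sigma> = 1" if "\<sigma> \<in> ?S" for \<sigma>
    using that X dim by (auto simp: max_cells_def polyhedral_complex_def)
  have face_in: "\<tau> \<in> X" if "\<sigma> \<in> X" "\<tau> face_of \<sigma>" "\<tau> \<noteq> {}" for \<sigma> \<tau>
    using X that unfolding polyhedral_complex_def by blast
  have meet: "(\<rho> \<inter> \<rho>') face_of \<rho>" "(\<rho> \<inter> \<rho>') face_of \<rho>'" if "\<rho> \<in> X" "\<rho>' \<in> X" "\<rho> \<inter> \<rho>' \<noteq> {}" for \<rho> \<rho>'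
    using X that unfolding polyhedral_complex_def by blast+
  have small_face: "\<tau> = \<sigma> \<or> (\<exists>y. \<tau> = {y})" if "\<sigma> \<in> ?S" "\<tau> face_of \<sigma>" "\<tau> \<noteq> {}" for \<sigma> \<tau>
  proof (cases "\<tau> = \<sigma>")
    case False
    then have "aff_dim \<tau> < 1"
      using face_of_aff_dim_lt[of \<sigma> \<tau>] polyhedron_imp_convex cell[OF that(1)] that(2) by auto
    moreover have "\<not> aff_dim \<tau> < 0" using that(3) by (simp add: aff_dim_negative_iff)
    ultimately have "aff_dim \<tau> = 0" by linarith
    then show ?thesis using aff_dim_eq_0 by blast
  qed simp
  have nontriv: "\<exists>x\<in>\<sigma>. x \<noteq> y" if "\<sigma> \<in> ?S" for \<sigma> y
  proof (rule ccontr)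
    assume "\<not> ?thesis"
    then have "\<sigma> \<subseteq> {y}" by auto
    then have "aff_dim \<sigma> \<le> 0" using aff_dim_subset[of \<sigma> "{y}"] by simp
    then show False using cell(3)[OF that] by simp
  qed
  have ridge: "{y} \<in> ridges X" if "{y} \<in> X" for y using that dim by (simp add: ridges_def)
  have normal: "lattice_normal {y} \<sigma> (z {y} \<sigma>)" if "\<sigma> \<in> ?S" "y \<in> \<sigma>" "{y} \<in> X" for \<sigma> y
    using z[OF ridge[OF that(3)] that(1)] nontriv[OF that(1), of y] that(2) by auto
  \<comment> \<open>Rationality enters here: a zero vector would generate a lattice of rank
    0.\<close>
  have z0: "z {y} \<sigma> \<noteq> 0" if "\<sigma> \<in> ?S" "y \<in> \<sigma>" "{y} \<in> X" for \<sigma> y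
  proof
    assume "z {y} \<sigma> = 0"
    then have "cell_lattice \<sigma> = {0}" using lattice_normal_vertex(1)[OF normal[OF that]] by auto
    moreover have "int (dim (cell_lattice \<sigma>)) = aff_dim \<sigma>"
      using rat that(1) unfolding rational_complex_def by simp
    ultimately show False using cell(3)[OF that(1)] by simp
  qed
  have ex_d: "\<exists>d. d \<noteq> 0 \<and> (\<forall>x\<in>\<sigma>. \<forall>y\<in>\<sigma>. \<exists>c. x - y = c *\<^sub>R d) \<and>
      (\<forall>y\<in>\<sigma>. {y} \<in> X \<longrightarrow> z {y} \<sigma> = d \<or> z {y} \<sigma> = - d)" if s: "\<sigma> \<in> ?S" for \<sigma>
  proof -
    obtain u where u: "\<And>x y. x \<in> \<sigma> \<Longrightarrow> y \<in> \<sigma> \<Longrightarrow> \<exists>c. x - y = c *\<^sub>R u"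
      using cell(3)[OF s] collinear_aff_dim[of \<sigma>] unfolding collinear_def by auto
    obtain x where x: "x \<in> \<sigma>" using nontriv[OF s] by auto
    obtain x' where x': "x' \<in> \<sigma>" "x' \<noteq> x" using nontriv[OF s] by auto
    have u0: "u \<noteq> 0" using u[OF x'(1) x] x'(2) by auto
    show ?thesis
    proof (cases "\<exists>y\<in>\<sigma>. {y} \<in> X")
      \<comment> \<open>A cell without vertices is a whole line; there is no \<open>z\<close> to
        match, so any direction vector serves.\<close>
      case False
      then show ?thesis using u u0 by (intro exI[of _ u]) blast
    next
      case True
      then obtain y where y: "y \<in> \<sigma>" "{y} \<in> X" by auto
      define d where "d = z {y} \<sigma>"
      have d0: "d \<noteq> 0" using z0[OF s y] by (simp add: d_def)
      have "d \<in> direction_space \<sigma>"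
        using normal[OF s y] by (simp add: d_def lattice_normal_def cell_lattice_def)
      also have "direction_space \<sigma> \<subseteq> span {u}"
        unfolding direction_space_def
      proof (rule span_minimal)
        show "{x - y | x y. x \<in> \<sigma> \<and> y \<in> \<sigma>} \<subseteq> span {u}"
        proof
          fix t assume "t \<in> {x - y | x y. x \<in> \<sigma> \<and> y \<in> \<sigma>}"
          then obtain c where "t = c *\<^sub>R u" using u by blast
          then show "t \<in> span {u}" by (simp add: span_mul span_base)
        qed
      qed (rule subspace_span)
      finally obtain k where k: "d = k *\<^sub>R u" by (auto simp: span_singleton)
      then have k0: "k \<noteq> 0" using d0 by auto
      have "\<exists>c. x - y = c *\<^sub>R d" if xy: "x \<in> \<sigma>" "y \<in> \<sigma>" for x y
      proof -
        obtain c where "x - y = c *\<^sub>R u" using u[OF xy] by auto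
        then show ?thesis using k k0 by (intro exI[of _ "c / k"]) simp
      qed
      moreover have "z {y'} \<sigma> = d \<or> z {y'} \<sigma> = - d" if y': "y' \<in> \<sigma>" "{y'} \<in> X" for y'
        using lattice_normal_unique[OF normal[OF s y] normal[OF s y']] d0 by (simp add: d_def)
      ultimately show ?thesis using d0 by (intro exI[of _ d]) blast
    qed
  qed
  then have "\<forall>\<sigma>\<in>?S. \<exists>d. d \<noteq> 0 \<and> (\<forall>x\<in>\<sigma>. \<forall>y\<in>\<sigma>. \<exists>c. x - y = c *\<^sub>R d) \<and>
      (\<forall>y\<in>\<sigma>. {y} \<in> X \<longrightarrow> z {y} \<sigma> = d \<or> z {y} \<sigma> = - d)" by simp
  from bchoice[OF this] obtain d0 where all: "\<forall>\<sigma>\<in>?S. d0 \<sigma> \<noteq> 0 \<and>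
      (\<forall>x\<in>\<sigma>. \<forall>y\<in>\<sigma>. \<exists>c. x - y = c *\<^sub>R d0 \<sigma>) \<and>
      (\<forall>y\<in>\<sigma>. {y} \<in> X \<longrightarrow> z {y} \<sigma> = d0 \<sigma> \<or> z {y} \<sigma> = - d0 \<sigma>)"
    by (elim exE)
  have d0: "d0 \<sigma> \<noteq> 0" if "\<sigma> \<in> ?S" for \<sigma>
    using bspec[OF all that] by simp
  have diffs: "\<exists>c. x - y = c *\<^sub>R d0 \<sigma>" if "\<sigma> \<in> ?S" "x \<in> \<sigma>" "y \<in> \<sigma>" for \<sigma> x y
    using bspec[OF all that(1)] that(2,3) by simp
  have zd0: "z {y} \<sigma> = d0 \<sigma> \<or> z {y} \<sigma> = - d0 \<sigma>" if "\<sigma> \<in> ?S" "y \<in> \<sigma>" "{y} \<in> X" for \<sigma> y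
    using bspec[OF all that(1)] that(2,3) by simp
  have fin: "finite ?S" using X by (simp add: max_cells_def polyhedral_complex_def)
  obtain e where e: "\<And>\<sigma>. \<sigma> \<in> ?S \<Longrightarrow> d0 \<sigma> \<bullet> e \<noteq> 0"
    using avoid_hyperplanes[of UNIV ?S d0 "\<lambda>_. 0"] fin d0 by auto
  define d where "d \<sigma> = (if e \<bullet> d0 \<sigma> > 0 then d0 \<sigma> else - d0 \<sigma>)" for \<sigma>
  define b where "b \<sigma> = (SOME x. x \<in> \<sigma>)" for \<sigma> :: "(real ^ 2) set"
  have b: "b \<sigma> \<in> \<sigma>" if "\<sigma> \<in> ?S" for \<sigma>
    unfolding b_def using nontriv[OF that] by (metis someI_ex)
  have diffs': "\<exists>c. x - y = c *\<^sub>R d \<sigma>" if xy: "\<sigma> \<in> ?S" "x \<in> \<sigma>" "y \<in> \<sigma>" for \<sigma> x y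
  proof -
    obtain c where "x - y = c *\<^sub>R d0 \<sigma>" using diffs[OF xy] by auto
    then show ?thesis by (intro exI[of _ "if e \<bullet> d0 \<sigma> > 0 then c else - c"]) (simp add: d_def)
  qed
  have zd: "z {y} \<sigma> = d \<sigma> \<or> z {y} \<sigma> = - d \<sigma>" if "\<sigma> \<in> ?S" "y \<in> \<sigma>" "{y} \<in> X" for \<sigma> y
    using zd0[OF that] by (auto simp: d_def)
  have curve: "planar_curve ?S ?P d b e"
  proof
    show "finite ?S" by (rule fin)
    have "finite ((\<lambda>y. {y}) -` X)"
      using X by (intro finite_vimageI) (auto simp: polyhedral_complex_def inj_def)
    then show "finite ?P" by (simp add: vimage_def)
    show "?P \<subseteq> \<Union>?S"
    proof
      fix y assume "y \<in> ?P"
      then have y: "{y} \<in> X" by simp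
      then obtain \<sigma> where "\<sigma> \<in> ?S" "{y} face_of \<sigma>"
        using pure dim unfolding pure_complex_def by fastforce
      then show "y \<in> \<Union>?S" using face_of_imp_subset by blast
    qed
    fix \<sigma> assume s: "\<sigma> \<in> ?S"
    show "closed \<sigma>" "convex \<sigma>" using cell[OF s] polyhedron_imp_closed polyhedron_imp_convex by auto
    show "b \<sigma> \<in> \<sigma>" by (rule b[OF s])
    show "\<sigma> \<subseteq> range (\<lambda>t. b \<sigma> + t *\<^sub>R d \<sigma>)"
    proof
      fix x assume "x \<in> \<sigma>"
      then obtain c where "x - b \<sigma> = c *\<^sub>R d \<sigma>" using diffs'[OF s _ b[OF s]] by blast
      then have "x = b \<sigma> + c *\<^sub>R d \<sigma>" by (simp add: algebra_simps)
      then show "x \<in> range (\<lambda>t. b \<sigma> + t *\<^sub>R d \<sigma>)" by auto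
    qed
    show "0 < e \<bullet> d \<sigma>" using e[OF s] by (auto simp: d_def inner_commute)
    show "\<exists>x\<in>\<sigma>. x \<noteq> b \<sigma>" using nontriv[OF s] by blast
    show "y \<in> ?P \<longleftrightarrow> y extreme_point_of \<sigma>" if y: "y \<in> \<sigma>" for y
    proof
      assume "y \<in> ?P"
      then have "({y} \<inter> \<sigma>) face_of \<sigma>" using meet(2)[of "{y}" \<sigma>] cell(1)[OF s] y by auto
      moreover have "{y} \<inter> \<sigma> = {y}" using y by auto
      ultimately show "y extreme_point_of \<sigma>" by (simp add: face_of_singleton)
    next
      assume "y extreme_point_of \<sigma>"
      then have "{y} face_of \<sigma>" by (simp add: face_of_singleton)
      then show "y \<in> ?P" using face_in[OF cell(1)[OF s]] by simp
    qed
    fix \<sigma>' assume s': "\<sigma>' \<in> ?S" and ne: "\<sigma> \<noteq> \<sigma>'"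
    show "\<sigma> \<inter> \<sigma>' \<subseteq> ?P"
    proof
      fix x assume x: "x \<in> \<sigma> \<inter> \<sigma>'"
      note f = meet[OF cell(1)[OF s] cell(1)[OF s']]
      have "\<exists>y. \<sigma> \<inter> \<sigma>' = {y}"
      proof (rule ccontr)
        assume "\<nexists>y. \<sigma> \<inter> \<sigma>' = {y}"
        then have "\<sigma> \<inter> \<sigma>' = \<sigma>" "\<sigma> \<inter> \<sigma>' = \<sigma>'"
          using small_face[OF s f(1)] small_face[OF s' f(2)] x by blast+
        then show False using ne by simp
      qed
      then obtain y where y: "\<sigma> \<inter> \<sigma>' = {y}" ..
      have "x = y" using x unfolding y by simp
      then have "\<sigma> \<inter> \<sigma>' = {x}" using y by simp
      then show "x \<in> ?P" using face_in[OF cell(1)[OF s] f(1)] by auto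
    qed
  qed
  interpret planar_curve ?S ?P d b e by (rule curve)
  have "z {y} \<sigma> = side \<sigma> y *\<^sub>R d \<sigma>" if *: "\<sigma> \<in> ?S" "y \<in> \<sigma>" "{y} \<in> X" for \<sigma> y
  proof -
    obtain c where c: "c > 0" "y + c *\<^sub>R z {y} \<sigma> \<in> \<sigma>"
      using lattice_normal_vertex(2)[OF normal[OF *]] by auto
    have cd: "0 < c * (e \<bullet> d \<sigma>)" using c e_pos[OF *(1)] by simp
    \<comment> \<open>The sign is decided by the cell point \<open>y + c z\<close>: the vertex
      \<open>y\<close> is an end of the cell, so all other cell points lie on one side of
      it.\<close>
    from zd[OF *] show ?thesis
    proof
      assume zz: "z {y} \<sigma> = d \<sigma>"
      have "e \<bullet> y < e \<bullet> (y + c *\<^sub>R z {y} \<sigma>)" using cd by (simp add: zz inner_add_right)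
      then have "side \<sigma> y = 1" using c(2) by (auto simp: side_def)
      then show ?thesis using zz by simp
    next
      assume zz: "z {y} \<sigma> = - d \<sigma>"
      have "e \<bullet> (y + c *\<^sub>R z {y} \<sigma>) < e \<bullet> y" using cd by (simp add: zz inner_diff_right)
      then have "side \<sigma> y = - 1"
        using vertex_extremal[OF *(1,2) _ c(2)] *(3) by (auto simp: side_def)
      then show ?thesis using zz by simp
    qed
  qed
  then show ?thesis using curve by blast
qed

section \<open>Comparison of a curve with a proper subcurve\<close>

context planar_curve
begin

lemma dual_graph_edge:
  assumes "v \<in> curve_regions C" "w \<in> curve_regions C" "v \<noteq> w" "v \<inter> w \<in> curve_edges C"
  shows "{v, w} \<in> snd (dual_graph C)"
  unfolding dual_graph_def using assms by auto

lemma sides_unique: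
  assumes "\<sigma> \<in> S" "x0 \<in> \<sigma>"
    and "\<forall>\<^sub>F x in nhds x0. (0 < ht \<sigma> x \<longrightarrow> region x = v) \<and> (ht \<sigma> x < 0 \<longrightarrow> region x = w)"
    and "\<forall>\<^sub>F x in nhds x0. (0 < ht \<sigma> x \<longrightarrow> region x = v') \<and> (ht \<sigma> x < 0 \<longrightarrow> region x = w')"
  shows "v = v' \<and> w = w'"
  using ht_generic(1)[OF assms(1) eventually_conj[OF assms(3,4)] ht_on[OF assms(1,2)]]
    ht_generic(2)[OF assms(1) eventually_conj[OF assms(3,4)] ht_on[OF assms(1,2)]] by metis

end

text \<open>The subcurve has its own cells, vertices, orientations and generic functional; only the
  inclusion of the point sets relates it to the curve. Local comparison takes place at points that
  are vertices of neither.\<close>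

locale planar_subcurve = planar_curve S P d b e + sub: planar_curve S1 P1 d1 b1 e1
  for S P d b e S1 P1 d1 b1 e1 +
  fixes F F1 :: "real ^ 2 \<Rightarrow> real ^ 2" and j j1 :: "(real ^ 2) set \<Rightarrow> real ^ 2"
    and p :: "(real ^ 2) set \<Rightarrow> real ^ 2"
  assumes pot: "potential F j" and pos: "positive_jumps j"
    and pot1: "sub.potential F1 j1" and pos1: "sub.positive_jumps j1"
    and sub_nonempty: "S1 \<noteq> {}" and proper: "\<Union>S1 \<subset> \<Union>S"
    and reciprocal: "\<And>v w. v \<in> curve_regions (\<Union>S) \<Longrightarrow> w \<in> curve_regions (\<Union>S) \<Longrightarrow>
      {v, w} \<in> snd (dual_graph (\<Union>S)) \<Longrightarrow>
      p v \<noteq> p w \<and> (\<forall>y\<in>direction_space (v \<inter> w). (p v - p w) \<bullet> y = 0)"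
begin

definition q :: "(real ^ 2) set \<Rightarrow> real ^ 2" where
  "q v = F1 (SOME x. x \<notin> \<Union>S \<and> region x = v)"

text \<open>The sample point chosen in \<open>q\<close> does not matter: a connected set missing the
  curve also misses the subcurve, where \<open>F1\<close> is constant on components.\<close>

lemma q_region:
  assumes "x \<notin> \<Union>S"
  shows "q (region x) = F1 x"
proof -
  define x' where "x' = (SOME x'. x' \<notin> \<Union>S \<and> region x' = region x)"
  have "x' \<notin> \<Union>S \<and> region x' = region x"
    unfolding x'_def by (rule someI[of _ x]) (use assms in simp)
  then have "connected_component (- \<Union>S) x x'" using region_eq_iff[of x' x] by auto
  then have "connected_component (- \<Union>S1) x x'"
    by (rule connected_component_of_subset) (use proper in auto)
  then have "F1 x = F1 x'" by (rule sub.potential_component_constant[OF pot1])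
  then show ?thesis by (simp add: q_def x'_def)
qed

text \<open>A small step along \<open>d1 \<sigma>1\<close> stays on the subcurve, hence on the
  curve, which near \<open>x0\<close> is the line of \<open>\<sigma>\<close>.\<close>

lemma parallel_cells:
  assumes "\<sigma> \<in> S" "x0 \<in> \<sigma>" "x0 \<notin> P" "\<sigma>1 \<in> S1" "x0 \<in> \<sigma>1" "x0 \<notin> P1"
  shows "\<exists>k. k \<noteq> 0 \<and> d1 \<sigma>1 = k *\<^sub>R d \<sigma>"
proof -
  obtain r where r: "r > 0" "\<And>x. x \<in> ball x0 r \<Longrightarrow> x \<in> \<Union>S \<longleftrightarrow> ht \<sigma> x = 0"
    using curve_near_cell_point[OF assms(1-3)] by auto
  obtain r1 where r1: "r1 > 0" "\<And>x. x \<in> ball x0 r1 \<Longrightarrow> x \<in> \<Union>S1 \<longleftrightarrow> sub.ht \<sigma>1 x = 0"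
    using sub.curve_near_cell_point[OF assms(4-6)] by auto
  have nd: "norm (d1 \<sigma>1) > 0" using sub.d_nonzero[OF assms(4)] by simp
  \<comment> \<open>Gives a step of half the smaller radius, so both local descriptions apply at its
    end.\<close>
  define t where "t = min r r1 / (2 * norm (d1 \<sigma>1))"
  have t: "t > 0" using r r1 nd by (simp add: t_def)
  have "norm (t *\<^sub>R d1 \<sigma>1) = min r r1 / 2" using nd r r1 by (simp add: t_def)
  then have m: "x0 + t *\<^sub>R d1 \<sigma>1 \<in> ball x0 r" "x0 + t *\<^sub>R d1 \<sigma>1 \<in> ball x0 r1"
    using r r1 by (auto simp: dist_norm)
  have "sub.ht \<sigma>1 (x0 + t *\<^sub>R d1 \<sigma>1) = sub.ht \<sigma>1 x0"
    by (simp add: sub.ht_def inner_add_right inner_diff_right)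
  then have "x0 + t *\<^sub>R d1 \<sigma>1 \<in> \<Union>S1" using r1(2)[OF m(2)] sub.ht_on[OF assms(4,5)] by simp
  then have "ht \<sigma> (x0 + t *\<^sub>R d1 \<sigma>1) = 0" using r(2)[OF m(1)] proper by blast
  then have "rot (d \<sigma>) \<bullet> (t *\<^sub>R d1 \<sigma>1) = 0"
    using ht_on[OF assms(1,2)] ht_diff[of \<sigma> "x0 + t *\<^sub>R d1 \<sigma>1" x0] by simp
  then have "rot (d \<sigma>) \<bullet> d1 \<sigma>1 = 0" using t by simp
  then obtain k where "d1 \<sigma>1 = k *\<^sub>R d \<sigma>" using perp_rot_imp_multiple[OF d_nonzero[OF assms(1)]] by blast
  then show ?thesis using nd by (intro exI[of _ k]) auto
qed

text \<open>\<open>q\<close> inherits the jumps of \<open>F1\<close>: it jumps normally to the cell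
  where the subcurve runs along it, and not at all elsewhere. The equivalence for \<open>k\<close>
  lets jumps detect the subcurve.\<close>

lemma q_jump:
  assumes s: "\<sigma> \<in> S" "x0 \<in> \<sigma>" "x0 \<notin> P" and "x0 \<notin> P1"
    and ev: "\<forall>\<^sub>F x in nhds x0. (0 < ht \<sigma> x \<longrightarrow> region x = v) \<and> (ht \<sigma> x < 0 \<longrightarrow> region x = w)"
  shows "\<exists>k. q v - q w = k *\<^sub>R rot (d \<sigma>) \<and> (k = 0 \<longleftrightarrow> x0 \<notin> \<Union>S1)"
proof -
  note h = ht_on[OF s(1,2)]
  have sides: "\<exists>x x'. q v = F1 x \<and> q w = F1 x' \<and> R x \<and> R x' \<and> 0 < ht \<sigma> x \<and> ht \<sigma> x' < 0 \<and>
      x \<notin> \<Union>S1 \<and> x' \<notin> \<Union>S1" if R: "\<forall>\<^sub>F x in nhds x0. R x" for R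
  proof -
    note evR = eventually_conj[OF ev R]
    obtain x where x: "region x = v" "R x" "0 < ht \<sigma> x" "x \<notin> \<Union>S"
      using ht_generic(1)[OF s(1) evR h] by blast
    obtain x' where x': "region x' = w" "R x'" "ht \<sigma> x' < 0" "x' \<notin> \<Union>S"
      using ht_generic(2)[OF s(1) evR h] by blast
    have "q v = F1 x" "q w = F1 x'" using q_region[OF x(4)] q_region[OF x'(4)] x(1) x'(1) by auto
    moreover have "x \<notin> \<Union>S1" "x' \<notin> \<Union>S1" using x(4) x'(4) proper by auto
    ultimately show ?thesis using x x' by blast
  qed
  show ?thesis
  proof (cases "x0 \<in> \<Union>S1")
    case False
    from sub.potential_locally_constant[OF pot1 False] obtain c
      where c: "\<forall>\<^sub>F x in nhds x0. x \<notin> \<Union>S1 \<longrightarrow> F1 x = c" by (elim exE)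
    have "q v - q w = 0" using sides[OF c] by auto
    then show ?thesis using False by (intro exI[of _ 0]) simp
  next
    case True
    then obtain \<sigma>1 where s1: "\<sigma>1 \<in> S1" "x0 \<in> \<sigma>1" by auto
    obtain k where k: "k \<noteq> 0" "d1 \<sigma>1 = k *\<^sub>R d \<sigma>"
      using parallel_cells[OF s s1 assms(4)] by auto
    have ht1: "sub.ht \<sigma>1 x = k * ht \<sigma> x" for x
    proof -
      have "sub.ht \<sigma>1 x = rot (d1 \<sigma>1) \<bullet> (x - x0)"
        using sub.ht_diff[of \<sigma>1 x x0] sub.ht_on[OF s1] by simp
      also have "\<dots> = k * (rot (d \<sigma>) \<bullet> (x - x0))" by (simp only: k(2) rot_linear_simps(3)) simp
      also have "\<dots> = k * ht \<sigma> x" using ht_diff[of \<sigma> x x0] h by simp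
      finally show ?thesis .
    qed
    from sub.potential_jump[OF pot1 s1 assms(4)] obtain c where c:
      "\<forall>\<^sub>F x in nhds x0. (0 < sub.ht \<sigma>1 x \<longrightarrow> F1 x = c + j1 \<sigma>1) \<and> (sub.ht \<sigma>1 x < 0 \<longrightarrow> F1 x = c)"
      by (elim exE)
    from sides[OF c] obtain x x' where x: "q v = F1 x" "q w = F1 x'" "0 < ht \<sigma> x" "ht \<sigma> x' < 0"
      "(0 < sub.ht \<sigma>1 x \<longrightarrow> F1 x = c + j1 \<sigma>1) \<and> (sub.ht \<sigma>1 x < 0 \<longrightarrow> F1 x = c)"
      "(0 < sub.ht \<sigma>1 x' \<longrightarrow> F1 x' = c + j1 \<sigma>1) \<and> (sub.ht \<sigma>1 x' < 0 \<longrightarrow> F1 x' = c)"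
      by (elim exE conjE) blast
    obtain l where l: "l > 0" "j1 \<sigma>1 = l *\<^sub>R rot (d1 \<sigma>1)"
      using pos1 s1(1) unfolding sub.positive_jumps_def by blast
    have j1: "j1 \<sigma>1 = (l * k) *\<^sub>R rot (d \<sigma>)"
      unfolding l(2) k(2) by (simp only: rot_linear_simps(3)) simp
    \<comment> \<open>If \<open>d1 \<sigma>1\<close> points against \<open>d \<sigma>\<close>, then
      above and below are exchanged between the two curves, so the difference is taken in the
      opposite order.\<close>
    have "q v - q w = (if k > 0 then l * k else - (l * k)) *\<^sub>R rot (d \<sigma>)"
    proof (cases "k > 0")
      case True
      then have "0 < sub.ht \<sigma>1 x" "sub.ht \<sigma>1 x' < 0" using x(3,4) by (simp_all add: ht1 mult_pos_neg)
      then show ?thesis using True x j1 by simp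
    next
      case False
      then have "k < 0" using k(1) by simp
      then have "sub.ht \<sigma>1 x < 0" "0 < sub.ht \<sigma>1 x'" using x(3,4) by (simp_all add: ht1 mult_neg_pos mult_neg_neg)
      then show ?thesis using False x j1 by simp
    qed
    moreover have "(if k > 0 then l * k else - (l * k)) \<noteq> 0" using k(1) l(1) by simp
    ultimately show ?thesis using True by blast
  qed
qed

text \<open>Across an edge the differences of \<open>p\<close> and of \<open>q\<close> are both
  normal to it, so a quarter turn of one makes them orthogonal.\<close>

lemma flex_rot_q: "infinitesimal_flex (dual_graph (\<Union>S)) p (\<lambda>v. rot (q v))"
  unfolding infinitesimal_flex_def
proof (intro ballI impI)
  fix v w assume "v \<in> fst (dual_graph (\<Union>S))" "w \<in> fst (dual_graph (\<Union>S))"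
    and vw: "{v, w} \<in> snd (dual_graph (\<Union>S))"
  then have v: "v \<in> curve_regions (\<Union>S)" and w: "w \<in> curve_regions (\<Union>S)"
    by (simp_all add: dual_graph_def)
  \<comment> \<open>Stated for \<open>v\<close> above \<open>w\<close> and with its own variables,
    so that it can be applied in both orders.\<close>
  have main: "(p v - p w) \<bullet> (rot (q v) - rot (q w)) = 0"
    if v: "v \<in> curve_regions (\<Union>S)" and w: "w \<in> curve_regions (\<Union>S)"
      and vw: "{v, w} \<in> snd (dual_graph (\<Union>S))"
      and s: "\<sigma> \<in> S" "x0 \<in> \<sigma>" "x0 \<notin> P" "x0 \<notin> P1"
      and ev: "\<forall>\<^sub>F x in nhds x0. (0 < ht \<sigma> x \<longrightarrow> region x = v) \<and> (ht \<sigma> x < 0 \<longrightarrow> region x = w)"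
    for v w \<sigma> x0
  proof -
    from two_regions[OF pot pos s(1-3)] obtain v' w' where v'w': "d \<sigma> \<in> direction_space (v' \<inter> w')"
      and ev': "\<forall>\<^sub>F x in nhds x0. (0 < ht \<sigma> x \<longrightarrow> region x = v') \<and> (ht \<sigma> x < 0 \<longrightarrow> region x = w')"
      by (elim exE conjE)
    have "d \<sigma> \<in> direction_space (v \<inter> w)" using sides_unique[OF s(1,2) ev ev'] v'w' by simp
    then have perp: "(p v - p w) \<bullet> d \<sigma> = 0" using reciprocal[OF v w vw] by blast
    from q_jump[OF s ev] obtain k where "q v - q w = k *\<^sub>R rot (d \<sigma>)" by auto
    then have "rot (q v) - rot (q w) = - (k *\<^sub>R d \<sigma>)"
      using linear_diff[OF linear_rot, of "q v" "q w"] by (simp add: linear_cmul[OF linear_rot])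
    then show ?thesis using perp by simp
  qed
  from dual_edge_location[OF pot pos v w vw sub.finite_P] obtain \<sigma> x0 where
    s: "\<sigma> \<in> S" "x0 \<in> \<sigma>" "x0 \<notin> P" "x0 \<notin> P1" and ev:
    "(\<forall>\<^sub>F x in nhds x0. (0 < ht \<sigma> x \<longrightarrow> region x = v) \<and> (ht \<sigma> x < 0 \<longrightarrow> region x = w)) \<or>
     (\<forall>\<^sub>F x in nhds x0. (0 < ht \<sigma> x \<longrightarrow> region x = w) \<and> (ht \<sigma> x < 0 \<longrightarrow> region x = v))"
    by (elim bexE conjE)
  from ev show "(p v - p w) \<bullet> (rot (q v) - rot (q w)) = 0"
  proof
    assume "\<forall>\<^sub>F x in nhds x0. (0 < ht \<sigma> x \<longrightarrow> region x = v) \<and> (ht \<sigma> x < 0 \<longrightarrow> region x = w)"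
    from main[OF v w vw s this] show ?thesis .
  next
    assume ev: "\<forall>\<^sub>F x in nhds x0. (0 < ht \<sigma> x \<longrightarrow> region x = w) \<and> (ht \<sigma> x < 0 \<longrightarrow> region x = v)"
    have "{w, v} \<in> snd (dual_graph (\<Union>S))" using vw by (simp add: insert_commute)
    from main[OF w v this s ev] show ?thesis by (simp add: inner_diff_left inner_diff_right)
  qed
qed

text \<open>Triviality would make differences of \<open>q\<close> equal to \<open>\<mu>\<close>
  times those of \<open>p\<close>, which never vanish across an edge. A point on the subcurve forces
  \<open>\<mu> \<noteq> 0\<close>, and a point of the curve off the subcurve forces
  \<open>\<mu> = 0\<close>.\<close>

lemma not_rigid: "\<not> infinitesimally_rigid (dual_graph (\<Union>S)) p"
proof
  assume "infinitesimally_rigid (dual_graph (\<Union>S)) p"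
  then have "trivial_flex (dual_graph (\<Union>S)) p (\<lambda>v. rot (q v))"
    using flex_rot_q unfolding infinitesimally_rigid_def by blast
  then obtain M a where "transpose M = - M"
    and Ma: "\<And>v. v \<in> curve_regions (\<Union>S) \<Longrightarrow> rot (q v) = M *v p v + a"
    unfolding trivial_flex_def dual_graph_def by auto
  then obtain \<mu> where \<mu>: "\<And>x. M *v x = \<mu> *\<^sub>R rot x" using skew_matrix_rot by blast
  have scaled: "q v - q w = \<mu> *\<^sub>R (p v - p w)"
    if "v \<in> curve_regions (\<Union>S)" "w \<in> curve_regions (\<Union>S)" for v w
  proof -
    have "rot (q v - q w) = \<mu> *\<^sub>R rot (p v - p w)"
      using Ma[OF that(1)] Ma[OF that(2)]
      by (simp add: \<mu> rot_linear_simps(2) scaleR_diff_right)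
    then have "rot (rot (q v - q w)) = rot (\<mu> *\<^sub>R rot (p v - p w))" by simp
    then show ?thesis
      by (simp only: rot_linear_simps(3) rot_rot scaleR_minus_right neg_equal_iff_equal)
  qed
  have local: "(\<mu> = 0) = (x0 \<notin> \<Union>S1)" if s: "\<sigma> \<in> S" "x0 \<in> \<sigma>" "x0 \<notin> P" "x0 \<notin> P1" for \<sigma> x0
  proof -
    from two_regions[OF pot pos s(1-3)] obtain v w
      where v: "v \<in> curve_regions (\<Union>S)" and w: "w \<in> curve_regions (\<Union>S)" and "v \<noteq> w"
        "v \<inter> w \<in> curve_edges (\<Union>S)"
        and ev: "\<forall>\<^sub>F x in nhds x0. (0 < ht \<sigma> x \<longrightarrow> region x = v) \<and> (ht \<sigma> x < 0 \<longrightarrow> region x = w)"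
      by (elim exE conjE)
    then have "{v, w} \<in> snd (dual_graph (\<Union>S))" by (intro dual_graph_edge)
    then have "p v \<noteq> p w" using reciprocal[OF v w] by blast
    then have "\<mu> = 0 \<longleftrightarrow> q v - q w = 0" using scaled[OF v w] by simp
    moreover from q_jump[OF s ev] obtain k where "q v - q w = k *\<^sub>R rot (d \<sigma>)" "k = 0 \<longleftrightarrow> x0 \<notin> \<Union>S1" by auto
    ultimately show ?thesis using d_nonzero[OF s(1)] by simp
  qed
  obtain \<sigma>1 where s1: "\<sigma>1 \<in> S1" using sub_nonempty by auto
  obtain x1 where x1: "x1 \<in> \<sigma>1" "x1 \<notin> P1" "x1 \<notin> P" using sub.cell_avoid[OF s1 finite_P] by auto
  then obtain \<sigma> where "\<sigma> \<in> S" "x1 \<in> \<sigma>" using s1 proper by blast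
  from local[OF this x1(3,2)] have "\<mu> \<noteq> 0" using x1 s1 by auto
  obtain x where x: "x \<in> \<Union>S" "x \<notin> \<Union>S1" using proper by auto
  then obtain \<sigma>' where s': "\<sigma>' \<in> S" "x \<in> \<sigma>'" by auto
  have "open (- \<Union>S1)" using sub.closed_curve by auto
  then obtain r where r: "r > 0" "ball x r \<subseteq> - \<Union>S1" using x(2) open_contains_ball by blast
  obtain u where u: "u \<in> \<sigma>'" "u \<noteq> x" using nontrivial_cell[OF s'(1)] base_in[OF s'(1)] by metis
  have "\<sigma>' \<noteq> {y}" for y using u s'(2) by auto
  \<comment> \<open>\<open>x\<close> may be a vertex itself. The cell has infinitely many points in
    the ball missing the subcurve, and only finitely many of them are vertices.\<close>
  then have "x islimpt \<sigma>'"
    by (rule connected_imp_perfect[OF convex_connected[OF convex_cell[OF s'(1)]] s'(2)])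
  then have "infinite (\<sigma>' \<inter> ball x r)" using r(1) by (simp add: islimpt_eq_infinite_ball)
  moreover have "finite (P \<union> P1)" using finite_P sub.finite_P by simp
  ultimately have "\<not> \<sigma>' \<inter> ball x r \<subseteq> P \<union> P1" using finite_subset by blast
  then obtain x0 where x0: "x0 \<in> \<sigma>'" "x0 \<in> ball x r" "x0 \<notin> P" "x0 \<notin> P1" by blast
  then have "x0 \<notin> \<Union>S1" using r(2) by blast
  then have "\<mu> = 0" using local[OF s'(1) x0(1,3,4)] by simp
  then show False using \<open>\<mu> \<noteq> 0\<close> by simp
qed

end


section \<open>Balanced weightings and extremality\<close>

text \<open>Scale so that \<open>s i1\<close> becomes 1 and multiply by a common denominator
  \<open>q\<close> of good approximations. If the errors are small enough, each relation holds up to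
  less than 1 in absolute value, hence exactly, by integrality. The same argument keeps 0 at
  \<open>i0\<close>, and at \<open>i1\<close> the value is within less than 1 of
  \<open>q \<ge> 1\<close>.\<close>

lemma integer_solution:
  fixes s :: "'i \<Rightarrow> real" and a :: "'r \<Rightarrow> 'i \<Rightarrow> int"
  assumes fin: "finite I" "finite R" and rel: "\<And>r. r \<in> R \<Longrightarrow> (\<Sum>i\<in>I. of_int (a r i) * s i) = 0"
    and i0: "i0 \<in> I" "s i0 = 0" and i1: "i1 \<in> I" "s i1 \<noteq> 0"
  shows "\<exists>m :: 'i \<Rightarrow> int. (\<forall>r\<in>R. (\<Sum>i\<in>I. a r i * m i) = 0) \<and> m i0 = 0 \<and> m i1 \<noteq> 0"
proof -
  obtain h where h: "bij_betw h {..<card I} I"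
    using ex_bij_betw_nat_finite[OF fin(1)] by (auto simp: atLeast0LessThan)
  define g where "g = the_inv_into {..<card I} h"
  have g: "g i < card I" "h (g i) = i" if "i \<in> I" for i
    using that h f_the_inv_into_f_bij_betw[OF h] the_inv_into_into[of h "{..<card I}" i "{..<card I}"]
    unfolding g_def bij_betw_def by auto
  \<comment> \<open>An upper bound for the sum of absolute coefficients in each relation, so errors
    below \<open>1 / (K + 1)\<close> add up to less than 1.\<close>
  define K where "K = nat (\<Sum>r\<in>R. \<Sum>i\<in>I. \<bar>a r i\<bar>)"
  obtain q :: int and p :: "nat \<Rightarrow> int" where q: "0 < q" "q \<le> int (Suc K ^ card I)"
    and p: "\<And>k. k < card I \<Longrightarrow> \<bar>of_int q * (s (h k) / s i1) - of_int (p k)\<bar> < 1 / real (Suc K)"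
    by (rule Dirichlet_approx_simult[where N = "Suc K" and n = "card I" and \<theta> = "\<lambda>k. s (h k) / s i1",
          OF zero_less_Suc]) (rule that)
  define m where "m i = p (g i)" for i
  define \<delta> where "\<delta> i = of_int (m i) - of_int q * (s i / s i1)" for i
  have \<delta>: "\<bar>\<delta> i\<bar> < 1 / real (Suc K)" if "i \<in> I" for i
    using p[OF g(1)[OF that]] g(2)[OF that] by (simp add: m_def \<delta>_def abs_minus_commute)
  have \<delta>1: "\<bar>\<delta> i\<bar> < 1" if "i \<in> I" for i
    by (rule less_le_trans[OF \<delta>[OF that]]) simp
  have "\<bar>real_of_int (m i0)\<bar> < 1" using \<delta>1[OF i0(1)] i0(2) by (simp add: \<delta>_def)
  then have m0: "m i0 = 0" by linarith
  have "\<bar>real_of_int (m i1) - of_int q\<bar> < 1" using \<delta>1[OF i1(1)] i1(2) by (simp add: \<delta>_def)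
  then have m1: "m i1 \<noteq> 0" using q by linarith
  have "(\<Sum>i\<in>I. a r i * m i) = 0" if r: "r \<in> R" for r
  proof -
    have "real_of_int (\<Sum>i\<in>I. a r i * m i) = (\<Sum>i\<in>I. of_int (a r i) * \<delta> i) +
        of_int q / s i1 * (\<Sum>i\<in>I. of_int (a r i) * s i)"
      by (simp add: \<delta>_def sum_distrib_left algebra_simps flip: sum.distrib)
    also have "\<dots> = (\<Sum>i\<in>I. of_int (a r i) * \<delta> i)" using rel[OF r] by simp
    finally have eq: "real_of_int (\<Sum>i\<in>I. a r i * m i) = (\<Sum>i\<in>I. of_int (a r i) * \<delta> i)" .
    have "\<bar>\<Sum>i\<in>I. of_int (a r i) * \<delta> i\<bar> \<le> (\<Sum>i\<in>I. \<bar>of_int (a r i) * \<delta> i\<bar>)" by (rule sum_abs)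
    also have "\<dots> \<le> (\<Sum>i\<in>I. of_int \<bar>a r i\<bar> * (1 / real (Suc K)))"
    proof (rule sum_mono)
      fix i assume i: "i \<in> I"
      show "\<bar>of_int (a r i) * \<delta> i\<bar> \<le> of_int \<bar>a r i\<bar> * (1 / real (Suc K))"
        unfolding abs_mult of_int_abs by (rule mult_left_mono[OF less_imp_le[OF \<delta>[OF i]] abs_ge_zero])
    qed
    also have "\<dots> = of_int (\<Sum>i\<in>I. \<bar>a r i\<bar>) * (1 / real (Suc K))"
      by (simp only: of_int_sum sum_distrib_right)
    also have "\<dots> \<le> real K * (1 / real (Suc K))"
    proof (rule mult_right_mono)
      have "(\<Sum>i\<in>I. \<bar>a r i\<bar>) \<le> (\<Sum>r\<in>R. \<Sum>i\<in>I. \<bar>a r i\<bar>)"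
        using fin(2) r by (intro member_le_sum) (auto intro: sum_nonneg)
      then have "(\<Sum>i\<in>I. \<bar>a r i\<bar>) \<le> int K" unfolding K_def by simp
      then show "real_of_int (\<Sum>i\<in>I. \<bar>a r i\<bar>) \<le> real K" by linarith
    qed simp
    also have "\<dots> < 1" by simp
    finally have "\<bar>real_of_int (\<Sum>i\<in>I. a r i * m i)\<bar> < 1" by (simp only: eq)
    then show ?thesis by linarith
  qed
  then show ?thesis using m0 m1 by blast
qed

section \<open>Subcurves supported by nonnegative weightings\<close>

lemma polyhedral_complex_cell:
  assumes "polyhedral_complex X" "\<rho> \<in> X"
  shows "polyhedron \<rho>" "\<rho> \<noteq> {}"
proof -
  have "\<forall>\<rho>\<in>X. polyhedron \<rho> \<and> \<rho> \<noteq> {}"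
    using assms(1) unfolding polyhedral_complex_def by (elim conjE)
  then show "polyhedron \<rho>" "\<rho> \<noteq> {}" using assms(2) by simp_all
qed

lemma max_cells_nonempty:
  assumes "polyhedral_complex X"
  shows "max_cells X \<noteq> {}"
proof -
  have "finite X" "X \<noteq> {}" using assms by (simp_all add: polyhedral_complex_def)
  then have "complex_dim X \<in> aff_dim ` X" unfolding complex_dim_def by (intro Max_in) auto
  then show ?thesis by (auto simp: max_cells_def)
qed

text \<open>The faces of the cells of positive weight form a subcomplex whose ridges are ridges of
  \<open>X\<close>. The vectors \<open>z\<close> can be kept, and the discarded cells have weight 0,
  so the balancing sums do not change.\<close>

lemma tropical_subcurve:
  fixes X :: "(real ^ 'd) set set" and m :: "(real ^ 'd) set \<Rightarrow> int"
  assumes X: "polyhedral_complex X" and dim: "complex_dim X = 1"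
    and rat: "rational_complex X"
    and z: "\<And>\<tau> \<sigma>. \<tau> \<in> ridges X \<Longrightarrow> \<sigma> \<in> max_cells X \<Longrightarrow> \<tau> \<subset> \<sigma> \<Longrightarrow> lattice_normal \<tau> \<sigma> (z \<tau> \<sigma>)"
    and nonneg: "\<And>\<sigma>. \<sigma> \<in> max_cells X \<Longrightarrow> 0 \<le> m \<sigma>"
    and ex: "\<exists>\<sigma>\<in>max_cells X. 0 < m \<sigma>"
    and bal: "\<And>\<tau>. \<tau> \<in> ridges X \<Longrightarrow>
      (\<Sum>\<sigma> | \<sigma> \<in> max_cells X \<and> \<tau> face_of \<sigma>. of_int (m \<sigma>) *\<^sub>R z \<tau> \<sigma>) \<in> direction_space \<tau>"
  shows "tropical_variety 1 (\<Union>{\<sigma> \<in> max_cells X. 0 < m \<sigma>})"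
proof -
  define Y where "Y = {\<rho> \<in> X. \<exists>\<sigma>\<in>max_cells X. 0 < m \<sigma> \<and> \<rho> face_of \<sigma>}"
  have YX: "Y \<subseteq> X" by (auto simp: Y_def)
  have cell: "polyhedron \<sigma>" "\<sigma> \<noteq> {}" "aff_dim \<sigma> = 1" "\<sigma> \<in> X" if "\<sigma> \<in> max_cells X" for \<sigma>
    using X that dim by (auto simp: max_cells_def polyhedral_complex_def)
  have pos_in: "\<sigma> \<in> Y" if "\<sigma> \<in> max_cells X" "0 < m \<sigma>" for \<sigma>
    using that cell[OF that(1)] polyhedron_imp_convex[of \<sigma>] face_of_refl[of \<sigma>] unfolding Y_def by blast
  have finX: "finite X" using X by (simp add: polyhedral_complex_def)
  have finY: "finite Y" using finX YX finite_subset by blast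
  have "\<exists>\<sigma>. \<sigma> \<in> Y \<and> \<sigma> \<in> max_cells X" using ex pos_in by blast
  then have Y1: "1 \<in> aff_dim ` Y" "Y \<noteq> {}" using cell(3) by force+
  have le1: "aff_dim \<rho> \<le> 1" if "\<rho> \<in> X" for \<rho>
    using Max_ge[OF finite_imageI[OF finX], of "aff_dim \<rho>" aff_dim] that dim by (simp add: complex_dim_def)
  have dimY: "complex_dim Y = 1"
    unfolding complex_dim_def using finY Y1 le1 YX by (intro Max_eqI) auto
  have full_face: "\<rho> = \<sigma>" if "\<sigma> \<in> max_cells X" "\<rho> face_of \<sigma>" "aff_dim \<rho> = 1" for \<rho> \<sigma>
    using face_of_aff_dim_lt[of \<sigma> \<rho>] cell[OF that(1)] polyhedron_imp_convex that(2,3) by fastforce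
  have maxY: "max_cells Y = {\<sigma> \<in> max_cells X. 0 < m \<sigma>}"
  proof
    show "max_cells Y \<subseteq> {\<sigma> \<in> max_cells X. 0 < m \<sigma>}"
    proof
      fix \<rho> assume "\<rho> \<in> max_cells Y"
      then have r: "\<rho> \<in> Y" "aff_dim \<rho> = 1" by (simp_all add: max_cells_def dimY)
      then obtain \<sigma> where "\<sigma> \<in> max_cells X" "0 < m \<sigma>" "\<rho> face_of \<sigma>" by (auto simp: Y_def)
      then show "\<rho> \<in> {\<sigma> \<in> max_cells X. 0 < m \<sigma>}" using full_face[of \<sigma> \<rho>] r(2) by simp
    qed
    show "{\<sigma> \<in> max_cells X. 0 < m \<sigma>} \<subseteq> max_cells Y"
      using pos_in cell(3) by (auto simp: max_cells_def[of Y] dimY)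
  qed
  have ridgesY: "ridges Y \<subseteq> ridges X" using YX by (auto simp: ridges_def dim dimY)
  have UY: "\<Union>Y = \<Union>{\<sigma> \<in> max_cells X. 0 < m \<sigma>}"
  proof
    show "\<Union>Y \<subseteq> \<Union>{\<sigma> \<in> max_cells X. 0 < m \<sigma>}"
    proof
      fix x assume "x \<in> \<Union>Y"
      then obtain \<rho> \<sigma> where "x \<in> \<rho>" "\<sigma> \<in> max_cells X" "0 < m \<sigma>" "\<rho> face_of \<sigma>" by (auto simp: Y_def)
      then show "x \<in> \<Union>{\<sigma> \<in> max_cells X. 0 < m \<sigma>}" using face_of_imp_subset by blast
    qed
  qed (use pos_in in auto)
  have "polyhedral_complex Y"
    unfolding polyhedral_complex_def
  proof (intro conjI ballI allI impI)
    show "finite Y" "Y \<noteq> {}" by (fact finY Y1(2))+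
    fix \<rho> assume r: "\<rho> \<in> Y"
    then show "polyhedron \<rho>" "\<rho> \<noteq> {}" using X YX by (auto simp: polyhedral_complex_def)
    show "\<tau> \<in> Y" if "\<tau> face_of \<rho> \<and> \<tau> \<noteq> {}" for \<tau>
    proof -
      obtain \<sigma> where s: "\<sigma> \<in> max_cells X" "0 < m \<sigma>" "\<rho> face_of \<sigma>" using r by (auto simp: Y_def)
      have "\<tau> face_of \<sigma>" using that s(3) face_of_trans by blast
      moreover have "\<tau> \<in> X" using X r YX that unfolding polyhedral_complex_def by blast
      ultimately show ?thesis using s by (auto simp: Y_def)
    qed
    fix \<rho>' assume r': "\<rho>' \<in> Y" and ne: "\<rho> \<inter> \<rho>' \<noteq> {}"
    then have "(\<rho> \<inter> \<rho>') face_of \<rho> \<and> (\<rho> \<inter> \<rho>') face_of \<rho>'"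
      using X r YX unfolding polyhedral_complex_def by blast
    then show "(\<rho> \<inter> \<rho>') face_of \<rho>" "(\<rho> \<inter> \<rho>') face_of \<rho>'" by auto
  qed
  moreover have "pure_complex Y"
    unfolding pure_complex_def maxY by (auto simp: Y_def)
  moreover have "rational_complex Y"
    using rat ridgesY unfolding rational_complex_def maxY by blast
  moreover have "balanced_weighting Y m"
    unfolding balanced_weighting_def maxY
  proof (intro conjI exI[of _ z] ballI impI)
    fix \<tau> assume t: "\<tau> \<in> ridges Y"
    then have tX: "\<tau> \<in> ridges X" using ridgesY by auto
    show "lattice_normal \<tau> \<sigma> (z \<tau> \<sigma>)" if "\<sigma> \<in> {\<sigma> \<in> max_cells X. 0 < m \<sigma>}" "\<tau> \<subset> \<sigma>" for \<sigma>
      using z[OF tX] that by auto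
    have "(\<Sum>\<sigma> | \<sigma> \<in> {\<sigma> \<in> max_cells X. 0 < m \<sigma>} \<and> \<tau> face_of \<sigma>. of_int (m \<sigma>) *\<^sub>R z \<tau> \<sigma>) =
        (\<Sum>\<sigma> | \<sigma> \<in> max_cells X \<and> \<tau> face_of \<sigma>. of_int (m \<sigma>) *\<^sub>R z \<tau> \<sigma>)"
    proof (rule sum.mono_neutral_left)
      show "finite {\<sigma> \<in> max_cells X. \<tau> face_of \<sigma>}" using finX by (simp add: max_cells_def)
      show "\<forall>\<sigma>\<in>{\<sigma> \<in> max_cells X. \<tau> face_of \<sigma>} - {\<sigma> \<in> {\<sigma> \<in> max_cells X. 0 < m \<sigma>}. \<tau> face_of \<sigma>}.
          of_int (m \<sigma>) *\<^sub>R z \<tau> \<sigma> = 0"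
        using nonneg by force
    qed auto
    then show "(\<Sum>\<sigma> | \<sigma> \<in> {\<sigma> \<in> max_cells X. 0 < m \<sigma>} \<and> \<tau> face_of \<sigma>. of_int (m \<sigma>) *\<^sub>R z \<tau> \<sigma>)
        \<in> direction_space \<tau>" using bal[OF tX] by simp
  qed auto
  ultimately show ?thesis
    unfolding tropical_variety_def using UY dimY by (intro exI[of _ Y]) auto
qed

locale weighted_curve = planar_curve "max_cells X" "{y. {y} \<in> X}" d b e
  for X d b e +
  fixes \<omega> :: "(real ^ 2) set \<Rightarrow> int" and z :: "(real ^ 2) set \<Rightarrow> (real ^ 2) set \<Rightarrow> real ^ 2"
  assumes complex: "polyhedral_complex X" and dim1: "complex_dim X = 1"
    and pure: "pure_complex X" and rational: "rational_complex X"
    and weight_pos: "\<And>\<sigma>. \<sigma> \<in> max_cells X \<Longrightarrow> 0 < \<omega> \<sigma>"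
    and normal: "\<And>\<tau> \<sigma>. \<tau> \<in> ridges X \<Longrightarrow> \<sigma> \<in> max_cells X \<Longrightarrow> \<tau> \<subset> \<sigma> \<Longrightarrow> lattice_normal \<tau> \<sigma> (z \<tau> \<sigma>)"
    and balanced: "\<And>\<tau>. \<tau> \<in> ridges X \<Longrightarrow>
      (\<Sum>\<sigma> | \<sigma> \<in> max_cells X \<and> \<tau> face_of \<sigma>. of_int (\<omega> \<sigma>) *\<^sub>R z \<tau> \<sigma>) \<in> direction_space \<tau>"
    and z_side: "\<And>\<sigma> y. \<sigma> \<in> max_cells X \<Longrightarrow> y \<in> \<sigma> \<Longrightarrow> {y} \<in> X \<Longrightarrow> z {y} \<sigma> = side \<sigma> y *\<^sub>R d \<sigma>"

lemma weighted_curve_exists: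
  assumes "tropical_variety 1 (C :: (real ^ 2) set)"
  shows "\<exists>X d b e \<omega> z. weighted_curve X d b e \<omega> z \<and> \<Union>(max_cells X) = C"
proof -
  obtain X \<omega> where X: "polyhedral_complex X" "\<Union>X = C" "complex_dim X = 1" "pure_complex X"
    "rational_complex X" "balanced_weighting X \<omega>"
    using assms by (auto simp: tropical_variety_def)
  from X(6) have w: "\<And>\<sigma>. \<sigma> \<in> max_cells X \<Longrightarrow> 0 < \<omega> \<sigma>"
    and "\<exists>z. (\<forall>\<tau>\<in>ridges X. \<forall>\<sigma>\<in>max_cells X. \<tau> \<subset> \<sigma> \<longrightarrow> lattice_normal \<tau> \<sigma> (z \<tau> \<sigma>)) \<and>
      (\<forall>\<tau>\<in>ridges X. (\<Sum>\<sigma> | \<sigma> \<in> max_cells X \<and> \<tau> face_of \<sigma>. of_int (\<omega> \<sigma>) *\<^sub>R z \<tau> \<sigma>) \<in> direction_space \<tau>)"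
    unfolding balanced_weighting_def by simp_all
  then obtain z where zb: "(\<forall>\<tau>\<in>ridges X. \<forall>\<sigma>\<in>max_cells X. \<tau> \<subset> \<sigma> \<longrightarrow> lattice_normal \<tau> \<sigma> (z \<tau> \<sigma>)) \<and>
      (\<forall>\<tau>\<in>ridges X. (\<Sum>\<sigma> | \<sigma> \<in> max_cells X \<and> \<tau> face_of \<sigma>. of_int (\<omega> \<sigma>) *\<^sub>R z \<tau> \<sigma>) \<in> direction_space \<tau>)"
    by (elim exE)
  have z: "lattice_normal \<tau> \<sigma> (z \<tau> \<sigma>)" if "\<tau> \<in> ridges X" "\<sigma> \<in> max_cells X" "\<tau> \<subset> \<sigma>" for \<tau> \<sigma>
    using conjunct1[OF zb] that by simp
  have bal: "(\<Sum>\<sigma> | \<sigma> \<in> max_cells X \<and> \<tau> face_of \<sigma>. of_int (\<omega> \<sigma>) *\<^sub>R z \<tau> \<sigma>) \<in> direction_space \<tau>"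
    if "\<tau> \<in> ridges X" for \<tau>
    using conjunct2[OF zb] that by simp
  from planar_curve_of_complex[OF X(1,3,4,5) z] obtain d b e where
    pc: "planar_curve (max_cells X) {y. {y} \<in> X} d b e"
    and zs: "\<forall>\<sigma>\<in>max_cells X. \<forall>y\<in>\<sigma>. {y} \<in> X \<longrightarrow> z {y} \<sigma> = planar_curve.side e \<sigma> y *\<^sub>R d \<sigma>" by blast
  interpret planar_curve "max_cells X" "{y. {y} \<in> X}" d b e by (rule pc)
  have "weighted_curve X d b e \<omega> z"
    by unfold_locales (use X w z bal zs in auto)
  then show ?thesis using max_cells_cover[OF X(1,4)] X(2) by blast
qed

section \<open>Redrawings of the diagram as weightings\<close>

context planar_curve
begin

lemma potential_combine:
  assumes "potential F j" "potential F' j'"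
  shows "potential (\<lambda>x. F x - k *\<^sub>R F' x) (\<lambda>\<sigma>. j \<sigma> - k *\<^sub>R j' \<sigma>)"
  unfolding potential_def
proof (intro allI impI)
  fix x0 assume x0: "x0 \<notin> P"
  from potentialD[OF assms(1) x0] obtain c where c: "\<forall>\<^sub>F x in nhds x0. x \<notin> \<Union>S \<longrightarrow>
     F x = c + (\<Sum>\<sigma> | \<sigma> \<in> S \<and> x0 \<in> \<sigma>. if 0 < ht \<sigma> x then j \<sigma> else 0)" by (elim exE)
  from potentialD[OF assms(2) x0] obtain c' where c': "\<forall>\<^sub>F x in nhds x0. x \<notin> \<Union>S \<longrightarrow>
     F' x = c' + (\<Sum>\<sigma> | \<sigma> \<in> S \<and> x0 \<in> \<sigma>. if 0 < ht \<sigma> x then j' \<sigma> else 0)" by (elim exE)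
  have split: "(\<Sum>\<sigma> | \<sigma> \<in> S \<and> x0 \<in> \<sigma>. if 0 < ht \<sigma> x then j \<sigma> - k *\<^sub>R j' \<sigma> else 0) =
      (\<Sum>\<sigma> | \<sigma> \<in> S \<and> x0 \<in> \<sigma>. if 0 < ht \<sigma> x then j \<sigma> else 0) -
      k *\<^sub>R (\<Sum>\<sigma> | \<sigma> \<in> S \<and> x0 \<in> \<sigma>. if 0 < ht \<sigma> x then j' \<sigma> else 0)" for x
    unfolding scaleR_sum_right sum_subtractf[symmetric] by (rule sum.cong) auto
  from c c' have "\<forall>\<^sub>F x in nhds x0. x \<notin> \<Union>S \<longrightarrow> F x - k *\<^sub>R F' x = (c - k *\<^sub>R c') +
     (\<Sum>\<sigma> | \<sigma> \<in> S \<and> x0 \<in> \<sigma>. if 0 < ht \<sigma> x then j \<sigma> - k *\<^sub>R j' \<sigma> else 0)"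
    unfolding split by eventually_elim (simp add: algebra_simps)
  then show "\<exists>c. \<forall>\<^sub>F x in nhds x0. x \<notin> \<Union>S \<longrightarrow> F x - k *\<^sub>R F' x = c +
     (\<Sum>\<sigma> | \<sigma> \<in> S \<and> x0 \<in> \<sigma>. if 0 < ht \<sigma> x then j \<sigma> - k *\<^sub>R j' \<sigma> else 0)"
    by (intro exI[of _ "c - k *\<^sub>R c'"])
qed

lemma region_jump:
  assumes pot: "potential (\<lambda>x. f (region x)) j" and s: "\<sigma> \<in> S" "x0 \<in> \<sigma>" "x0 \<notin> P"
    and ev: "\<forall>\<^sub>F x in nhds x0. (0 < ht \<sigma> x \<longrightarrow> region x = v) \<and> (ht \<sigma> x < 0 \<longrightarrow> region x = w)"
  shows "j \<sigma> = f v - f w"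
proof -
  from potential_jump[OF pot s] obtain c where
    c: "\<forall>\<^sub>F x in nhds x0. (0 < ht \<sigma> x \<longrightarrow> f (region x) = c + j \<sigma>) \<and> (ht \<sigma> x < 0 \<longrightarrow> f (region x) = c)"
    by (elim exE)
  note ev2 = eventually_conj[OF ev c] and h = ht_on[OF s(1,2)]
  have "f v = c + j \<sigma>" using ht_generic(1)[OF s(1) ev2 h] by auto
  moreover have "f w = c" using ht_generic(2)[OF s(1) ev2 h] by auto
  ultimately show ?thesis by simp
qed

lemma region_potential: "\<exists>j. potential (\<lambda>x. f (region x) :: real ^ 2) j"
  by (rule component_constant_jumps) (simp add: region_cong)

end

context weighted_curve
begin

abbreviation weight_balanced :: "((real ^ 2) set \<Rightarrow> real) \<Rightarrow> bool" where
  "weight_balanced s \<equiv> \<forall>y. {y} \<in> X \<longrightarrow> (\<Sum>\<sigma> | \<sigma> \<in> max_cells X \<and> y \<in> \<sigma>. s \<sigma> *\<^sub>R z {y} \<sigma>) = 0"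

lemma ridge_iff: "\<tau> \<in> ridges X \<longleftrightarrow> (\<exists>y. \<tau> = {y} \<and> {y} \<in> X)"
  unfolding ridges_def dim1 using aff_dim_eq_0 by auto

lemma vertex_face_iff:
  assumes "{y} \<in> X" "\<sigma> \<in> max_cells X"
  shows "{y} face_of \<sigma> \<longleftrightarrow> y \<in> \<sigma>"
  using vertex_iff[OF assms(2), of y] assms(1) face_of_singleton[of y \<sigma>] face_of_imp_subset[of "{y}" \<sigma>] by auto

lemma vertex_cells:
  "{y} \<in> X \<Longrightarrow> {\<sigma>. \<sigma> \<in> max_cells X \<and> {y} face_of \<sigma>} = {\<sigma>. \<sigma> \<in> max_cells X \<and> y \<in> \<sigma>}"
  using vertex_face_iff by blast

lemma weight_balanced_iff:
  "weight_balanced s \<longleftrightarrow> (\<forall>\<tau>\<in>ridges X.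
    (\<Sum>\<sigma> | \<sigma> \<in> max_cells X \<and> \<tau> face_of \<sigma>. s \<sigma> *\<^sub>R z \<tau> \<sigma>) \<in> direction_space \<tau>)"
proof -
  have "(\<forall>\<tau>\<in>ridges X. R \<tau>) \<longleftrightarrow> (\<forall>y. {y} \<in> X \<longrightarrow> R {y})" for R
    by (auto simp: ridge_iff)
  then show ?thesis by (simp add: vertex_cells direction_space_singleton)
qed

text \<open>The bridge between the two sides of the proof: the closing condition for normal jumps
  around a vertex is the balancing condition turned by a right angle.\<close>

lemma imbalance_rot:
  assumes "{y} \<in> X"
  shows "imbalance (\<lambda>\<sigma>. s \<sigma> *\<^sub>R rot (d \<sigma>)) y = rot (\<Sum>\<sigma> | \<sigma> \<in> max_cells X \<and> y \<in> \<sigma>. s \<sigma> *\<^sub>R z {y} \<sigma>)"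
  unfolding imbalance_def linear_sum[OF linear_rot]
  by (rule sum.cong) (use assms in \<open>auto simp: z_side linear_cmul[OF linear_rot]\<close>)

lemma weight_potential: "\<exists>F j. potential F j \<and> positive_jumps j"
proof -
  define j where "j \<sigma> = real_of_int (\<omega> \<sigma>) *\<^sub>R rot (d \<sigma>)" for \<sigma>
  have "weight_balanced (\<lambda>\<sigma>. real_of_int (\<omega> \<sigma>))" unfolding weight_balanced_iff using balanced by blast
  then have "imbalance j y = 0" if "y \<in> {y. {y} \<in> X}" for y
    using that imbalance_rot[of y "\<lambda>\<sigma>. real_of_int (\<omega> \<sigma>)"] by (simp add: j_def[abs_def])
  then have "potential (strip_sum j) j" by (rule potential_exists)
  moreover have "positive_jumps j"
    unfolding positive_jumps_def j_def using weight_pos by (metis of_int_0_less_iff)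
  ultimately show ?thesis by blast
qed

lemma weights_proportional:
  assumes ext: "extremal_tropical_variety (\<Union>(max_cells X))" and s: "weight_balanced s"
  shows "\<exists>c. \<forall>\<sigma>\<in>max_cells X. s \<sigma> = c * of_int (\<omega> \<sigma>)"
proof (rule ccontr)
  assume not: "\<not> ?thesis"
  have wb: "weight_balanced (\<lambda>\<sigma>. real_of_int (\<omega> \<sigma>))" unfolding weight_balanced_iff using balanced by blast
  obtain \<sigma>0 where s0: "\<sigma>0 \<in> max_cells X" using max_cells_nonempty[OF complex] by auto
  \<comment> \<open>Subtracting this multiple of \<open>\<omega>\<close> creates a zero at
    \<open>\<sigma>0\<close> while some other value stays nonzero. \<open>integer_solution\<close>
    preserves both, so the integral weighting is again not proportional to
    \<open>\<omega>\<close>.\<close>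
  define c where "c = s \<sigma>0 / of_int (\<omega> \<sigma>0)"
  define t where "t \<sigma> = s \<sigma> - c * of_int (\<omega> \<sigma>)" for \<sigma>
  have t0: "t \<sigma>0 = 0" using weight_pos[OF s0] by (simp add: t_def c_def)
  obtain \<sigma>1 where s1: "\<sigma>1 \<in> max_cells X" "t \<sigma>1 \<noteq> 0" using not by (auto simp: t_def)
  have tb: "(\<Sum>\<sigma> | \<sigma> \<in> max_cells X \<and> y \<in> \<sigma>. t \<sigma> *\<^sub>R z {y} \<sigma>) = 0" if y: "{y} \<in> X" for y
  proof -
    have "(\<Sum>\<sigma> | \<sigma> \<in> max_cells X \<and> y \<in> \<sigma>. t \<sigma> *\<^sub>R z {y} \<sigma>) =
      (\<Sum>\<sigma> | \<sigma> \<in> max_cells X \<and> y \<in> \<sigma>. s \<sigma> *\<^sub>R z {y} \<sigma>) -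
      c *\<^sub>R (\<Sum>\<sigma> | \<sigma> \<in> max_cells X \<and> y \<in> \<sigma>. of_int (\<omega> \<sigma>) *\<^sub>R z {y} \<sigma>)"
      by (simp add: t_def scaleR_diff_left sum_subtractf scaleR_sum_right)
    then show ?thesis using s wb y by simp
  qed
  \<comment> \<open>One relation per vertex and coordinate. The floor is exact because lattice
    vectors are integral, and cells not containing the vertex get coefficient 0.\<close>
  define a where "a r \<sigma> = (if fst r \<in> \<sigma> then \<lfloor>z {fst r} \<sigma> $ snd r\<rfloor> else 0)" for r :: "(real ^ 2) \<times> 2" and \<sigma>
  have z_int: "real_of_int \<lfloor>z {y} \<sigma> $ i\<rfloor> = z {y} \<sigma> $ i"
    if y: "{y} \<in> X" "\<sigma> \<in> max_cells X" "y \<in> \<sigma>" for y \<sigma> i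
  proof -
    obtain x where "x \<in> \<sigma>" "x \<noteq> y" using nontrivial_cell[OF y(2)] base_in[OF y(2)] by metis
    then have "lattice_normal {y} \<sigma> (z {y} \<sigma>)" using y ridge_iff by (intro normal) auto
    then have "z {y} \<sigma> \<in> integer_vectors" by (simp add: lattice_normal_def cell_lattice_def)
    then show ?thesis by (simp add: integer_vectors_def)
  qed
  have comp: "(\<Sum>\<sigma>\<in>max_cells X. of_int (a (y, i) \<sigma>) * f \<sigma>) =
      (\<Sum>\<sigma> | \<sigma> \<in> max_cells X \<and> y \<in> \<sigma>. f \<sigma> *\<^sub>R z {y} \<sigma>) $ i" if "{y} \<in> X" for y i and f :: "_ \<Rightarrow> real"
  proof -
    have "(\<Sum>\<sigma>\<in>max_cells X. of_int (a (y, i) \<sigma>) * f \<sigma>) =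
        (\<Sum>\<sigma>\<in>max_cells X. if y \<in> \<sigma> then f \<sigma> * z {y} \<sigma> $ i else 0)"
      by (rule sum.cong) (use that in \<open>auto simp: a_def z_int\<close>)
    also have "\<dots> = (\<Sum>\<sigma> | \<sigma> \<in> max_cells X \<and> y \<in> \<sigma>. f \<sigma> * z {y} \<sigma> $ i)"
      using sum.inter_filter[OF finite_S, of "\<lambda>\<sigma>. f \<sigma> * z {y} \<sigma> $ i" "\<lambda>\<sigma>. y \<in> \<sigma>"] by simp
    finally show ?thesis by simp
  qed
  have "\<exists>m. (\<forall>r\<in>{y. {y} \<in> X} \<times> UNIV. (\<Sum>\<sigma>\<in>max_cells X. a r \<sigma> * m \<sigma>) = 0) \<and> m \<sigma>0 = 0 \<and> m \<sigma>1 \<noteq> 0"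
  proof (rule integer_solution[OF finite_S _ _ s0 t0 s1])
    show "finite ({y. {y} \<in> X} \<times> (UNIV :: 2 set))" using finite_P by simp
    fix r :: "(real ^ 2) \<times> 2" assume "r \<in> {y. {y} \<in> X} \<times> UNIV"
    then show "(\<Sum>\<sigma>\<in>max_cells X. of_int (a r \<sigma>) * t \<sigma>) = 0"
      using comp[of "fst r" "snd r" t] tb[of "fst r"] by auto
  qed
  then obtain m :: "(real ^ 2) set \<Rightarrow> int" where
    rel: "\<And>r. r \<in> {y. {y} \<in> X} \<times> UNIV \<Longrightarrow> (\<Sum>\<sigma>\<in>max_cells X. a r \<sigma> * m \<sigma>) = 0"
    and m0: "m \<sigma>0 = 0" and m1: "m \<sigma>1 \<noteq> 0" by blast
  have mb: "weight_balanced (\<lambda>\<sigma>. real_of_int (m \<sigma>))"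
  proof (intro allI impI)
    fix y assume y: "{y} \<in> X"
    have "(\<Sum>\<sigma> | \<sigma> \<in> max_cells X \<and> y \<in> \<sigma>. real_of_int (m \<sigma>) *\<^sub>R z {y} \<sigma>) $ i = 0" for i
    proof -
      have "real_of_int (\<Sum>\<sigma>\<in>max_cells X. a (y, i) \<sigma> * m \<sigma>) = 0" using rel[of "(y, i)"] y by simp
      then show ?thesis using comp[OF y, of i "\<lambda>\<sigma>. real_of_int (m \<sigma>)"] by simp
    qed
    then show "(\<Sum>\<sigma> | \<sigma> \<in> max_cells X \<and> y \<in> \<sigma>. real_of_int (m \<sigma>) *\<^sub>R z {y} \<sigma>) = 0"
      by (simp only: vec_eq_iff zero_index) simp
  qed
  define f where "f \<sigma> = real_of_int (m \<sigma>) / of_int (\<omega> \<sigma>)" for \<sigma>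
  obtain hi where hi: "hi \<in> max_cells X" "\<And>\<sigma>. \<sigma> \<in> max_cells X \<Longrightarrow> f \<sigma> \<le> f hi"
    using ex_is_arg_min_if_finite[OF finite_S max_cells_nonempty[OF complex], of "\<lambda>\<sigma>. - f \<sigma>"]
    by (auto simp: is_arg_min_linorder)
  obtain lo where lo: "lo \<in> max_cells X" "\<And>\<sigma>. \<sigma> \<in> max_cells X \<Longrightarrow> f lo \<le> f \<sigma>"
    using ex_is_arg_min_if_finite[OF finite_S max_cells_nonempty[OF complex], of f]
    by (auto simp: is_arg_min_linorder)
  have cross: "m \<sigma> * \<omega> \<sigma>' \<le> m \<sigma>' * \<omega> \<sigma> \<longleftrightarrow> f \<sigma> \<le> f \<sigma>'"
    if "\<sigma> \<in> max_cells X" "\<sigma>' \<in> max_cells X" for \<sigma> \<sigma>'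
  proof -
    have "f \<sigma> \<le> f \<sigma>' \<longleftrightarrow> real_of_int (m \<sigma>) * of_int (\<omega> \<sigma>') \<le> real_of_int (m \<sigma>') * of_int (\<omega> \<sigma>)"
      using weight_pos[OF that(1)] weight_pos[OF that(2)] by (simp add: f_def divide_simps mult.commute)
    also have "\<dots> \<longleftrightarrow> m \<sigma> * \<omega> \<sigma>' \<le> m \<sigma>' * \<omega> \<sigma>" by (simp only: of_int_le_iff flip: of_int_mult)
    finally show ?thesis by simp
  qed
  have "f \<sigma>0 = 0" "f \<sigma>1 \<noteq> 0" using m0 m1 weight_pos[OF s1(1)] by (auto simp: f_def)
  then have lohi: "f lo < f hi" using hi(2)[OF s0] hi(2)[OF s1(1)] lo(2)[OF s0] lo(2)[OF s1(1)] by linarith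
  \<comment> \<open>\<open>k1\<close> and \<open>k2\<close> are \<open>f hi - f \<sigma>\<close> and
    \<open>f \<sigma> - f lo\<close> with denominators cleared by the positive factors
    \<open>\<omega> hi * \<omega> \<sigma>\<close> and
    \<open>\<omega> lo * \<omega> \<sigma>\<close>. They are nonnegative and vanish exactly where
    \<open>f\<close> is maximal or minimal, respectively.\<close>
  define k1 where "k1 \<sigma> = m hi * \<omega> \<sigma> - \<omega> hi * m \<sigma>" for \<sigma>
  define k2 where "k2 \<sigma> = \<omega> lo * m \<sigma> - m lo * \<omega> \<sigma>" for \<sigma>
  have k1: "0 \<le> k1 \<sigma>" "0 < k1 \<sigma> \<longleftrightarrow> f \<sigma> < f hi" if "\<sigma> \<in> max_cells X" for \<sigma>
    using cross[OF that hi(1)] cross[OF hi(1) that] hi(2)[OF that] by (auto simp: k1_def mult.commute)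
  have k2: "0 \<le> k2 \<sigma>" "0 < k2 \<sigma> \<longleftrightarrow> f lo < f \<sigma>" if "\<sigma> \<in> max_cells X" for \<sigma>
    using cross[OF that lo(1)] cross[OF lo(1) that] lo(2)[OF that] by (auto simp: k2_def mult.commute)
  have comb: "weight_balanced (\<lambda>\<sigma>. real_of_int (\<alpha> * \<omega> \<sigma> + \<beta> * m \<sigma>))" for \<alpha> \<beta>
  proof (intro allI impI)
    fix y assume y: "{y} \<in> X"
    have "(\<Sum>\<sigma> | \<sigma> \<in> max_cells X \<and> y \<in> \<sigma>. real_of_int (\<alpha> * \<omega> \<sigma> + \<beta> * m \<sigma>) *\<^sub>R z {y} \<sigma>) =
      of_int \<alpha> *\<^sub>R (\<Sum>\<sigma> | \<sigma> \<in> max_cells X \<and> y \<in> \<sigma>. real_of_int (\<omega> \<sigma>) *\<^sub>R z {y} \<sigma>) +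
      of_int \<beta> *\<^sub>R (\<Sum>\<sigma> | \<sigma> \<in> max_cells X \<and> y \<in> \<sigma>. real_of_int (m \<sigma>) *\<^sub>R z {y} \<sigma>)"
      by (simp add: scaleR_add_left sum.distrib scaleR_sum_right)
    then show "(\<Sum>\<sigma> | \<sigma> \<in> max_cells X \<and> y \<in> \<sigma>. real_of_int (\<alpha> * \<omega> \<sigma> + \<beta> * m \<sigma>) *\<^sub>R z {y} \<sigma>) = 0"
      using wb mb y by simp
  qed
  have b1: "weight_balanced (\<lambda>\<sigma>. real_of_int (k1 \<sigma>))"
    using comb[of "m hi" "- \<omega> hi"] by (simp add: k1_def)
  have b2: "weight_balanced (\<lambda>\<sigma>. real_of_int (k2 \<sigma>))"
    using comb[of "- m lo" "\<omega> lo"] by (simp add: k2_def)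
  define C1 C2 where "C1 = \<Union>{\<sigma> \<in> max_cells X. 0 < k1 \<sigma>}" and "C2 = \<Union>{\<sigma> \<in> max_cells X. 0 < k2 \<sigma>}"
  \<comment> \<open>A non-vertex point of a cell lies in no other cell, so omitting the cell loses a
    point.\<close>
  have proper: "\<Union>{\<sigma> \<in> max_cells X. 0 < k \<sigma>} \<subset> \<Union>(max_cells X)"
    if s: "\<sigma> \<in> max_cells X" "\<not> 0 < k \<sigma>" for \<sigma> and k :: "_ \<Rightarrow> int"
  proof -
    obtain x where x: "x \<in> \<sigma>" "x \<notin> {y. {y} \<in> X}" using cell_avoid[OF s(1), of "{}"] by auto
    have "\<sigma>' = \<sigma>" if "\<sigma>' \<in> max_cells X" "x \<in> \<sigma>'" for \<sigma>'
      using equalityD1[OF unique_cell[OF s(1) x]] that by auto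
    then have "x \<notin> \<Union>{\<sigma> \<in> max_cells X. 0 < k \<sigma>}" using s(2) by auto
    then show ?thesis using x(1) s(1) by blast
  qed
  have "tropical_variety 1 C1"
    unfolding C1_def
  proof (rule tropical_subcurve[OF complex dim1 rational normal])
    show "\<exists>\<sigma>\<in>max_cells X. 0 < k1 \<sigma>" using k1(2)[OF lo(1)] lohi lo(1) by blast
    show "\<And>\<tau>. \<tau> \<in> ridges X \<Longrightarrow>
      (\<Sum>\<sigma> | \<sigma> \<in> max_cells X \<and> \<tau> face_of \<sigma>. of_int (k1 \<sigma>) *\<^sub>R z \<tau> \<sigma>) \<in> direction_space \<tau>"
      using b1 unfolding weight_balanced_iff by blast
  qed (use k1 in auto)
  moreover have "tropical_variety 1 C2"
    unfolding C2_def
  proof (rule tropical_subcurve[OF complex dim1 rational normal])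
    show "\<exists>\<sigma>\<in>max_cells X. 0 < k2 \<sigma>" using k2(2)[OF hi(1)] lohi hi(1) by blast
    show "\<And>\<tau>. \<tau> \<in> ridges X \<Longrightarrow>
      (\<Sum>\<sigma> | \<sigma> \<in> max_cells X \<and> \<tau> face_of \<sigma>. of_int (k2 \<sigma>) *\<^sub>R z \<tau> \<sigma>) \<in> direction_space \<tau>"
      using b2 unfolding weight_balanced_iff by blast
  qed (use k2 in auto)
  moreover have "C1 \<subset> \<Union>(max_cells X)" unfolding C1_def using proper[OF hi(1)] k1(2)[OF hi(1)] by simp
  moreover have "C2 \<subset> \<Union>(max_cells X)" unfolding C2_def using proper[OF lo(1)] k2(2)[OF lo(1)] by simp
  moreover have "\<Union>(max_cells X) = C1 \<union> C2"
  proof -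
    \<comment> \<open>As \<open>f\<close> is not constant, no cell attains both its maximum and its
      minimum.\<close>
    have "0 < k1 \<sigma> \<or> 0 < k2 \<sigma>" if "\<sigma> \<in> max_cells X" for \<sigma>
      using k1(2)[OF that] k2(2)[OF that] lohi by linarith
    then show ?thesis unfolding C1_def C2_def by blast
  qed
  ultimately show False using ext unfolding extremal_tropical_variety_def by blast
qed

text \<open>The jumps of \<open>p\<close> and of the rotated flex define two real balanced
  weightings, both proportional to \<open>\<omega>\<close>. A combination of the two redrawings then
  has no jumps at all and is constant, which is triviality of the flex.\<close>

lemma extremal_imp_rigid:
  assumes ext: "extremal_tropical_variety (\<Union>(max_cells X))"
    and reciprocal: "\<And>v w. v \<in> curve_regions (\<Union>(max_cells X)) \<Longrightarrow> w \<in> curve_regions (\<Union>(max_cells X)) \<Longrightarrow>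
      {v, w} \<in> snd (dual_graph (\<Union>(max_cells X))) \<Longrightarrow>
      p v \<noteq> p w \<and> (\<forall>y\<in>direction_space (v \<inter> w). (p v - p w) \<bullet> y = 0)"
  shows "infinitesimally_rigid (dual_graph (\<Union>(max_cells X))) p"
  unfolding infinitesimally_rigid_def
proof (intro allI impI)
  fix u assume flex: "infinitesimal_flex (dual_graph (\<Union>(max_cells X))) p u"
  obtain F j where pot: "potential F j" and pos: "positive_jumps j" using weight_potential by blast
  define q where "q v = rot (u v)" for v
  obtain jp where jp: "potential (\<lambda>x. p (region x)) jp" using region_potential by blast
  obtain jq where jq: "potential (\<lambda>x. q (region x)) jq" using region_potential by blast
  have "\<exists>k. fst k \<noteq> 0 \<and> jp \<sigma> = fst k *\<^sub>R rot (d \<sigma>) \<and> jq \<sigma> = snd k *\<^sub>R rot (d \<sigma>)" if s: "\<sigma> \<in> max_cells X" for \<sigma>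
  proof -
    obtain x0 where x0: "x0 \<in> \<sigma>" "x0 \<notin> {y. {y} \<in> X}" using cell_avoid[OF s, of "{}"] by auto
    from two_regions[OF pot pos s x0] obtain v w
      where v: "v \<in> curve_regions (\<Union>(max_cells X))" and w: "w \<in> curve_regions (\<Union>(max_cells X))"
        and vw: "v \<noteq> w" "v \<inter> w \<in> curve_edges (\<Union>(max_cells X))" and dd: "d \<sigma> \<in> direction_space (v \<inter> w)"
        and ev: "\<forall>\<^sub>F x in nhds x0. (0 < ht \<sigma> x \<longrightarrow> region x = v) \<and> (ht \<sigma> x < 0 \<longrightarrow> region x = w)"
      by (elim exE conjE)
    have edge: "{v, w} \<in> snd (dual_graph (\<Union>(max_cells X)))" by (rule dual_graph_edge[OF v w vw])
    note d0 = d_nonzero[OF s]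
    have "(p v - p w) \<bullet> d \<sigma> = 0" using reciprocal[OF v w edge] dd by blast
    then obtain k where k: "p v - p w = k *\<^sub>R rot (d \<sigma>)" using perp_imp_multiple_rot[OF d0] by blast
    have k0: "k \<noteq> 0" using k reciprocal[OF v w edge] by auto
    have "(p v - p w) \<bullet> (u v - u w) = 0"
      using flex v w edge unfolding infinitesimal_flex_def by (simp add: dual_graph_def)
    then have "rot (d \<sigma>) \<bullet> (u v - u w) = 0" using k k0 by simp
    then obtain l where "u v - u w = l *\<^sub>R d \<sigma>" using perp_rot_imp_multiple[OF d0] by blast
    then have "rot (u v - u w) = l *\<^sub>R rot (d \<sigma>)" by (simp only: rot_linear_simps(3))
    then have l: "q v - q w = l *\<^sub>R rot (d \<sigma>)" by (simp add: q_def rot_linear_simps(2))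
    show ?thesis
      using region_jump[OF jp s x0 ev] region_jump[OF jq s x0 ev] k l k0
      by (intro exI[of _ "(k, l)"]) simp
  qed
  then have "\<forall>\<sigma>\<in>max_cells X. \<exists>k. fst k \<noteq> 0 \<and> jp \<sigma> = fst k *\<^sub>R rot (d \<sigma>) \<and> jq \<sigma> = snd k *\<^sub>R rot (d \<sigma>)"
    by blast
  from bchoice[OF this] obtain k where all: "\<forall>\<sigma>\<in>max_cells X. fst (k \<sigma>) \<noteq> 0 \<and>
      jp \<sigma> = fst (k \<sigma>) *\<^sub>R rot (d \<sigma>) \<and> jq \<sigma> = snd (k \<sigma>) *\<^sub>R rot (d \<sigma>)"
    by (elim exE)
  have k: "fst (k \<sigma>) \<noteq> 0" and kp: "jp \<sigma> = fst (k \<sigma>) *\<^sub>R rot (d \<sigma>)"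
    and kq: "jq \<sigma> = snd (k \<sigma>) *\<^sub>R rot (d \<sigma>)" if "\<sigma> \<in> max_cells X" for \<sigma>
    using bspec[OF all that] by simp_all
  have bal: "weight_balanced s"
    if "potential G g" and g: "\<And>\<sigma>. \<sigma> \<in> max_cells X \<Longrightarrow> g \<sigma> = s \<sigma> *\<^sub>R rot (d \<sigma>)" for G g s
  proof (intro allI impI)
    fix y assume y: "{y} \<in> X"
    have "imbalance g y = 0" using potential_balanced[OF that(1)] y by simp
    moreover have "imbalance g y = imbalance (\<lambda>\<sigma>. s \<sigma> *\<^sub>R rot (d \<sigma>)) y"
      unfolding imbalance_def by (rule sum.cong) (auto simp: g)
    ultimately show "(\<Sum>\<sigma> | \<sigma> \<in> max_cells X \<and> y \<in> \<sigma>. s \<sigma> *\<^sub>R z {y} \<sigma>) = 0"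
      using imbalance_rot[OF y, of s] by simp
  qed
  obtain cp where cp: "\<And>\<sigma>. \<sigma> \<in> max_cells X \<Longrightarrow> fst (k \<sigma>) = cp * of_int (\<omega> \<sigma>)"
    using weights_proportional[OF ext bal[OF jp kp]] by blast
  obtain cq where cq: "\<And>\<sigma>. \<sigma> \<in> max_cells X \<Longrightarrow> snd (k \<sigma>) = cq * of_int (\<omega> \<sigma>)"
    using weights_proportional[OF ext bal[OF jq kq]] by blast
  \<comment> \<open>The differences of \<open>p\<close> across edges never vanish.\<close>
  have "cp \<noteq> 0" using max_cells_nonempty[OF complex] k cp by fastforce
  define \<mu> where "\<mu> = cq / cp"
  have "jq \<sigma> - \<mu> *\<^sub>R jp \<sigma> = 0" if "\<sigma> \<in> max_cells X" for \<sigma>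
    using \<open>cp \<noteq> 0\<close> by (simp add: kp kq cp cq that \<mu>_def)
  from potential_zero_constant[OF potential_combine[OF jq jp] this] obtain c
    where c: "\<And>x. x \<notin> \<Union>(max_cells X) \<Longrightarrow> q (region x) - \<mu> *\<^sub>R p (region x) = c" by blast
  \<comment> \<open>The matrix of \<open>- \<mu>\<close> times the quarter turn; the sign arises
    because \<open>q\<close> is \<open>rot\<close> of \<open>u\<close>, so that rotating
    \<open>q\<close> once more yields \<open>- u\<close>.\<close>
  define M :: "real ^ 2 ^ 2" where
    "M = (\<chi> i l. if i = 1 \<and> l = 2 then \<mu> else if i = 2 \<and> l = 1 then - \<mu> else 0)"
  have M: "M *v x = - (\<mu> *\<^sub>R rot x)" for x
    by (simp add: M_def vec_eq_iff forall_2 matrix_vector_mult_def sum_2)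
  have "transpose M = - M"
    by (simp add: M_def vec_eq_iff forall_2 transpose_def)
  moreover have "u v = M *v p v + - rot c" if v: "v \<in> fst (dual_graph (\<Union>(max_cells X)))" for v
  proof -
    obtain x where "x \<notin> \<Union>(max_cells X)" "v = region x"
      using v curve_regions_iff by (auto simp: dual_graph_def)
    then have "q v = \<mu> *\<^sub>R p v + c" using c by (auto simp: algebra_simps)
    then have "rot (q v) = \<mu> *\<^sub>R rot (p v) + rot c" by (simp only: rot_linear_simps(1,3))
    then have "- u v = \<mu> *\<^sub>R rot (p v) + rot c" by (simp add: q_def)
    from arg_cong[OF this, of uminus] show ?thesis unfolding M by simp
  qed
  ultimately show "trivial_flex (dual_graph (\<Union>(max_cells X))) p u"
    unfolding trivial_flex_def by blast
qed

end

text \<open>Decompositions may use pieces of any dimension. Dimension 2 would produce interior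
  points, and a zero-dimensional variety is finite.\<close>

lemma tropical_dim_in_curve:
  fixes D :: "(real ^ 2) set"
  assumes D: "tropical_variety k D" and int: "interior D = {}" and inf: "infinite D"
  shows "k = 1"
proof -
  obtain X where X: "polyhedral_complex X" "\<Union>X = D" "complex_dim X = int k"
    using D by (auto simp: tropical_variety_def)
  have fin: "finite X" using X(1) by (simp add: polyhedral_complex_def)
  obtain \<sigma> where s: "\<sigma> \<in> X" "aff_dim \<sigma> = int k"
    using max_cells_nonempty[OF X(1)] X(3) by (auto simp: max_cells_def)
  have "convex \<sigma>" "\<sigma> \<noteq> {}"
    using polyhedral_complex_cell[OF X(1) s(1)] polyhedron_imp_convex by simp_all
  have "interior \<sigma> = {}" using interior_mono[of \<sigma> D] int s(1) X(2) by auto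
  then have "aff_dim \<sigma> \<noteq> 2"
    using rel_interior_eq_empty[OF \<open>convex \<sigma>\<close>] \<open>\<sigma> \<noteq> {}\<close> interior_rel_interior_gen[of \<sigma>] by auto
  moreover have "aff_dim \<sigma> \<le> 2" using aff_dim_le_DIM[of \<sigma>] by simp
  moreover have "k \<noteq> 0"
  proof
    assume "k = 0"
    have "finite \<rho>" if "\<rho> \<in> X" for \<rho>
    proof -
      have "aff_dim \<rho> \<le> 0"
        using Max_ge[OF finite_imageI[OF fin], of "aff_dim \<rho>" aff_dim] that X(3) \<open>k = 0\<close>
        by (simp add: complex_dim_def)
      then have "\<rho> = {} \<or> aff_dim \<rho> = 0" using aff_dim_negative_iff[of \<rho>] by linarith
      then show ?thesis using aff_dim_eq_0[of \<rho>] by auto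
    qed
    then have "finite (\<Union>X)" using fin by auto
    then show False using X(2) inf by simp
  qed
  ultimately show ?thesis using s(2) by linarith
qed

theorem corollary1p2:
  fixes C :: "(real ^ 2) set" and p :: "(real ^ 2) set \<Rightarrow> real ^ 2"
  assumes "tropical_curve C"
    and "reciprocal_diagram C p"
  shows "extremal_tropical_variety C \<longleftrightarrow> infinitesimally_rigid (dual_graph C) p"
proof -
  have reciprocal: "p v \<noteq> p w \<and> (\<forall>y\<in>direction_space (v \<inter> w). (p v - p w) \<bullet> y = 0)"
    if vw: "v \<in> curve_regions C" "w \<in> curve_regions C" "{v, w} \<in> snd (dual_graph C)" for v w
  proof -
    have "v \<in> fst (dual_graph C)" "w \<in> fst (dual_graph C)" using vw by (simp_all add: dual_graph_def)
    then obtain x c where "crossing_vector v w x" "c > 0" "p v - p w = c *\<^sub>R x"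
      using assms(2) vw(3) unfolding reciprocal_diagram_def by blast
    then show ?thesis by (auto simp: crossing_vector_def normal_integer_vector_def)
  qed
  have trop: "tropical_variety 1 C" using assms(1) by (simp add: tropical_curve_def)
  from weighted_curve_exists[OF trop] obtain X d b e \<omega> z where
    wc: "weighted_curve X d b e \<omega> z" and XC: "\<Union>(max_cells X) = C" by blast
  interpret weighted_curve X d b e \<omega> z by (rule wc)
  show ?thesis
  proof
    assume "extremal_tropical_variety C"
    then show "infinitesimally_rigid (dual_graph C) p"
      using extremal_imp_rigid[of p] reciprocal unfolding XC by blast
  next
    assume rigid: "infinitesimally_rigid (dual_graph C) p"
    show "extremal_tropical_variety C"
    proof (rule ccontr)
      assume "\<not> extremal_tropical_variety C"
      then obtain C1 C2 k1 k2 where C12: "tropical_variety k1 C1" "tropical_variety k2 C2"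
        "C1 \<subset> C" "C2 \<subset> C" "C = C1 \<union> C2"
        using trop unfolding extremal_tropical_variety_def by blast
      obtain \<sigma> where s: "\<sigma> \<in> max_cells X" using max_cells_nonempty[OF complex] by auto
      have "\<not> C \<subseteq> Q" if "finite Q" for Q using cell_avoid[OF s that] s XC by blast
      then have "infinite C" by blast
      \<comment> \<open>Two finite sets cannot make up the curve, so at least one piece is an
        infinite proper subset and thus one-dimensional.\<close>
      then have inf: "infinite C1 \<or> infinite C2" using C12(5) by simp
      have int: "interior D = {}" if "D \<subset> C" for D
        using interior_mono[of D C] that interior_curve XC by auto
      have "\<exists>D. tropical_variety 1 D \<and> D \<subset> C"
        using inf tropical_dim_in_curve[OF C12(1) int[OF C12(3)]] tropical_dim_in_curve[OF C12(2) int[OF C12(4)]]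
          C12 by blast
      then obtain D where D: "tropical_variety 1 D" "D \<subset> C" by blast
      from weighted_curve_exists[OF D(1)] obtain X1 d1 b1 e1 \<omega>1 z1 where
        wc1: "weighted_curve X1 d1 b1 e1 \<omega>1 z1" and XD: "\<Union>(max_cells X1) = D" by blast
      interpret sub: weighted_curve X1 d1 b1 e1 \<omega>1 z1 by (rule wc1)
      obtain F j where F: "potential F j" "positive_jumps j" using weight_potential by blast
      obtain F1 j1 where F1: "sub.potential F1 j1" "sub.positive_jumps j1" using sub.weight_potential by blast
      interpret both: planar_subcurve "max_cells X" "{y. {y} \<in> X}" d b e
        "max_cells X1" "{y. {y} \<in> X1}" d1 b1 e1 F F1 j j1 p
        by unfold_locales (use F F1 max_cells_nonempty[OF sub.complex] XC XD D(2) reciprocal in auto)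
      show False using both.not_rigid rigid XC by simp
    qed
  qed
qed

end
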